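(* Let $M$ be a closed smooth surface, let $g:M\to M$ be a diffeomorphism of Morse--Smale type, and let $$D=\sum_k D_kT^k:\ H^s(M)\longrightarrow H^{s-d}(M),\qquad s\in\mathbb R,$$ be a finite sum over $k\in\mathbb Z$, where the $D_k$ are pseudodifferential operators of order $d$ on $M$ and $Tu(x)=u(g(x))$. Then there exists an interval $I=(s_0,s_1)$ with $-\infty\le s_0\le s_1\le+\infty$ such that: 1) if $D$ is elliptic for some $s\in I$, then $D$ is elliptic for all $s\in I$; 2) $D$ is not elliptic whenever $s\notin I$.
   Context: Morse--Smale type: a (smooth) diffeomorphism $g:M\to M$ of a closed smooth surface ($\dim M=2$) is of Morse--Smale type if (1) the set $M^g$ of fixed points of $g$ is finite and $g$ has no periodic points of period $\ge 2$; (2) for every $x_0\in M^g$ the eigenvalues of $dg|_{x_0}:T_{x_0}M\to T_{x_0}M$ are real, positive, distinct and not equal to $1$. Standing assumption: for every $x\in M$ the sequence $g^nx$ has limits as $n\to+\infty$ and as $n\to-\infty$, which are fixed points of $g$. Pseudodifferential operators are scalar and classical; $\sigma(D_k)$ is the (homogeneous principal) symbol of $D_k$ of order $d$, a smooth function on $T_0^*M$, the cotangent bundle without the zero section. $H^s(M)$ is the Sobolev space of smoothness exponent $s$. Codifferential: $\partial g=((dg)^t)^{-1}:T^*M\to T^*M$ is the diffeomorphism of the cotangent bundle induced by $g$, covering $g$; it maps $\xi\in T_x^*M$ to $((dg_x)^t)^{-1}\xi\in T^*_{g(x)}M$. Its iterates are $\partial g^n=(\partial g)^n$, $n\in\mathbb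 Z$. Weights: fix a smooth nonsingular (positive) measure $\mu$ on $M$ and a Riemannian metric with nonnegative Laplacian $\Delta$, so that $\sigma(\Delta^s)(x,\xi)=|\xi|_x^{2s}$. For $(x,\xi)\in T_0^*M$, $s\in\mathbb R$, $n\in\mathbb Z$, put $$\mu_{x,\xi,s}(n)=\frac{(\partial g^{n})^*[\mu\,\sigma(\Delta^s)](x,\xi)}{\mu(x)}=\frac{((g^n)^*\mu)(x)}{\mu(x)}\,\bigl|\partial g^n(x,\xi)\bigr|_{g^nx}^{2s},$$ where $((g^n)^*\mu)/\mu$ is the (positive) Jacobian of $g^n$ with respect to $\mu$. Let $l^2(\mathbb Z,\mu_{x,\xi,s})$ be the space of sequences $\{w(n)\}_{n\in\mathbb Z}$ of complex numbers with $\sum_n|w(n)|^2\mu_{x,\xi,s}(n)<\infty$. Symbol: the symbol of $D$ at $(x,\xi)\in T_0^*M$ (for the given $s$) is the operator $$\sigma(D)(x,\xi):l^2(\mathbb Z,\mu_{x,\xi,s})\to l^2(\mathbb Z,\mu_{x,\xi,s-d}),\qquad \bigl(\sigma(D)(x,\xi)w\bigr)(n)=\sum_k\sigma(D_k)(\partial g^n(x,\xi))\,w(n+k).$$ Ellipticity: $D$ is elliptic for a given $s$ if $\sigma(D)(x,\xi):l^2(\mathbb Z,\mu_{x,\xi,s})\to l^2(\mathbb Z,\mu_{x,\xi,s-d})$ is invertible for all $(x,\xi)\in T_0^*M$. The interval $(s_0,s_1)$ is understood to be empty if $s_0=s_1$. *)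

theory Defs
  imports "HOL-Analysis.Analysis"
begin

section \<open>Smooth functions on open subsets of normed spaces\<close>

text \<open>\<open>S\<close> is meant to be open.\<close>

primrec Ck_on :: "nat \<Rightarrow> 'a::real_normed_vector set \<Rightarrow> ('a \<Rightarrow> 'b::real_normed_vector) \<Rightarrow> bool" where
  "Ck_on 0 S f \<longleftrightarrow> continuous_on S f"
| "Ck_on (Suc k) S f \<longleftrightarrow>
     (\<forall>x\<in>S. f differentiable (at x)) \<and>
     (\<forall>v. Ck_on k S (\<lambda>x. frechet_derivative f (at x) v))"

definition smooth_on :: "'a::real_normed_vector set \<Rightarrow> ('a \<Rightarrow> 'b::real_normed_vector) \<Rightarrow> bool" where
  "smooth_on S f \<longleftrightarrow> (\<forall>k. Ck_on k S f)"

definition test_fun :: "'a::real_normed_vector set \<Rightarrow> ('a \<Rightarrow> complex) \<Rightarrow> bool" where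
  "test_fun V \<phi> \<longleftrightarrow>
     smooth_on UNIV \<phi> \<and> compact (closure {y. \<phi> y \<noteq> 0}) \<and> closure {y. \<phi> y \<noteq> 0} \<subseteq> V"

fun iter_deriv :: "'a::real_normed_vector list \<Rightarrow> ('a \<Rightarrow> 'b::real_normed_vector) \<Rightarrow> 'a \<Rightarrow> 'b" where
  "iter_deriv [] f = f"
| "iter_deriv (v # vs) f = (\<lambda>p. frechet_derivative (iter_deriv vs f) (at p) v)"

section \<open>Smooth surfaces\<close>

text \<open>
  The underlying space of the manifold is the whole type \<open>'m\<close>. A chart is a pair of its domain
  and a coordinate map; the values of the coordinate map outside the domain are irrelevant.
\<close>

type_synonym 'm chart = "'m set \<times> ('m \<Rightarrow> real^2)"

definition is_chart :: "'m::topological_space chart \<Rightarrow> bool" where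
  "is_chart c \<longleftrightarrow>
     open (fst c) \<and> open (snd c ` fst c) \<and>
     homeomorphism (fst c) (snd c ` fst c) (snd c) (inv_into (fst c) (snd c))"

definition in_charts :: "'m chart \<Rightarrow> 'm chart \<Rightarrow> ('m \<Rightarrow> 'm) \<Rightarrow> real^2 \<Rightarrow> real^2" where
  "in_charts c c' h = (\<lambda>y. snd c' (h (inv_into (fst c) (snd c) y)))"

definition compatible :: "'m chart \<Rightarrow> 'm chart \<Rightarrow> bool" where
  "compatible c c' \<longleftrightarrow>
     smooth_on (snd c ` (fst c \<inter> fst c')) (in_charts c c' (\<lambda>x. x)) \<and>
     smooth_on (snd c' ` (fst c \<inter> fst c')) (in_charts c' c (\<lambda>x. x))"

text \<open>A smooth structure is a maximal smooth atlas.\<close>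

definition smooth_structure :: "'m::topological_space chart set \<Rightarrow> bool" where
  "smooth_structure \<A> \<longleftrightarrow>
     (\<forall>c\<in>\<A>. is_chart c) \<and> (\<Union>c\<in>\<A>. fst c) = UNIV \<and>
     (\<forall>c\<in>\<A>. \<forall>c'\<in>\<A>. compatible c c') \<and>
     (\<forall>c. is_chart c \<and> (\<forall>c'\<in>\<A>. compatible c c') \<longrightarrow> c \<in> \<A>)"

definition closed_smooth_surface :: "'m::t2_space chart set \<Rightarrow> bool" where
  "closed_smooth_surface \<A> \<longleftrightarrow> compact (UNIV :: 'm set) \<and> smooth_structure \<A>"

definition smooth_fun :: "'m chart set \<Rightarrow> ('m \<Rightarrow> complex) \<Rightarrow> bool" where
  "smooth_fun \<A> u \<longleftrightarrow> (\<forall>c\<in>\<A>. smooth_on (snd c ` fst c) (\<lambda>y. u (inv_into (fst c) (snd c) y)))"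

definition smooth_map :: "'m::topological_space chart set \<Rightarrow> ('m \<Rightarrow> 'm) \<Rightarrow> bool" where
  "smooth_map \<A> h \<longleftrightarrow> continuous_on UNIV h \<and>
     (\<forall>c\<in>\<A>. \<forall>c'\<in>\<A>. smooth_on (snd c ` (fst c \<inter> h -` fst c')) (in_charts c c' h))"

definition diffeo :: "'m::topological_space chart set \<Rightarrow> ('m \<Rightarrow> 'm) \<Rightarrow> bool" where
  "diffeo \<A> h \<longleftrightarrow> bij h \<and> smooth_map \<A> h \<and> smooth_map \<A> (inv h)"

text \<open>The matrix of \<open>dh\<close> at \<open>x\<close> with respect to a chart \<open>c\<close> at \<open>x\<close> and a chart \<open>c'\<close> at \<open>h x\<close>.\<close>

definition dmat :: "'m chart \<Rightarrow> 'm chart \<Rightarrow> ('m \<Rightarrow> 'm) \<Rightarrow> 'm \<Rightarrow> real^2^2" where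
  "dmat c c' h x = jacobian (in_charts c c' h) (at (snd c x))"

definition chart_at :: "'m chart set \<Rightarrow> 'm \<Rightarrow> 'm chart" where
  "chart_at \<A> x = (SOME c. c \<in> \<A> \<and> x \<in> fst c)"

text \<open>The \<open>n\<close>-th iterate, \<open>n \<in> \<int>\<close>, of a bijection \<open>f\<close> of \<open>S\<close> onto itself.\<close>

definition int_iter :: "'a set \<Rightarrow> ('a \<Rightarrow> 'a) \<Rightarrow> int \<Rightarrow> 'a \<Rightarrow> 'a" where
  "int_iter S f n = (if 0 \<le> n then f ^^ nat n else inv_into S f ^^ nat (- n))"

section \<open>Morse--Smale diffeomorphisms\<close>

definition eigenvalues :: "real^2^2 \<Rightarrow> complex set" where
  "eigenvalues A = {z. \<exists>v :: complex^2. v \<noteq> 0 \<and> (\<chi> i j. complex_of_real (A $ i $ j)) *v v = z *s v}"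

definition morse_smale :: "'m::topological_space chart set \<Rightarrow> ('m \<Rightarrow> 'm) \<Rightarrow> bool" where
  "morse_smale \<A> g \<longleftrightarrow> diffeo \<A> g \<and>
     finite {x. g x = x} \<and>
     (\<forall>x n. n \<ge> 1 \<and> (g ^^ n) x = x \<longrightarrow> g x = x) \<and>
     (\<forall>x. g x = x \<longrightarrow> (\<forall>c\<in>\<A>. x \<in> fst c \<longrightarrow>
        (\<exists>l1 l2 :: real. 0 < l1 \<and> 0 < l2 \<and> l1 \<noteq> l2 \<and> l1 \<noteq> 1 \<and> l2 \<noteq> 1 \<and>
           eigenvalues (dmat c c g x) = {complex_of_real l1, complex_of_real l2})))"

definition orbits_converge :: "('m::topological_space \<Rightarrow> 'm) \<Rightarrow> bool" where
  "orbits_converge g \<longleftrightarrow>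
     (\<forall>x. \<exists>p q. g p = p \<and> g q = q \<and>
        (\<lambda>n. (g ^^ n) x) \<longlonglongrightarrow> p \<and> (\<lambda>n. (inv g ^^ n) x) \<longlonglongrightarrow> q)"

section \<open>The cotangent bundle\<close>

text \<open>
  A covector at \<open>x\<close> is the family of its coordinate vectors in all charts at \<open>x\<close> (and \<open>0\<close> for
  every other argument), subject to the covariant transformation law.
\<close>

type_synonym 'm covector = "'m chart \<Rightarrow> real^2"

definition cotangent :: "'m chart set \<Rightarrow> 'm \<Rightarrow> 'm covector set" where
  "cotangent \<A> x = {\<xi>.
     (\<forall>c\<in>\<A>. \<forall>c'\<in>\<A>. x \<in> fst c \<and> x \<in> fst c' \<longrightarrow>
        \<xi> c' = transpose (dmat c' c (\<lambda>y. y) x) *v \<xi> c) \<and>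
     (\<forall>c. \<not> (c \<in> \<A> \<and> x \<in> fst c) \<longrightarrow> \<xi> c = 0)}"

definition cotangent0 :: "'m chart set \<Rightarrow> ('m \<times> 'm covector) set" where
  "cotangent0 \<A> = {(x, \<xi>). \<xi> \<in> cotangent \<A> x \<and> \<xi> \<noteq> (\<lambda>_. 0)}"

definition codiff :: "'m chart set \<Rightarrow> ('m \<Rightarrow> 'm) \<Rightarrow> 'm \<times> 'm covector \<Rightarrow> 'm \<times> 'm covector" where
  "codiff \<A> h = (\<lambda>(x, \<xi>). (h x, \<lambda>c'.
     if c' \<in> \<A> \<and> h x \<in> fst c'
     then matrix_inv (transpose (dmat (chart_at \<A> x) c' h x)) *v \<xi> (chart_at \<A> x)
     else 0))"

definition codiff_iter :: "'m chart set \<Rightarrow> ('m \<Rightarrow> 'm) \<Rightarrow> int \<Rightarrow> 'm \<times> 'm covector \<Rightarrow> 'm \<times> 'm covector" where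
  "codiff_iter \<A> g n = int_iter (cotangent0 \<A>) (codiff \<A> g) n"

section \<open>Smooth measures and Riemannian metrics\<close>

text \<open>
  \<open>\<rho> c x\<close> is the density at \<open>x\<close> of the measure with respect to Lebesgue measure in the chart \<open>c\<close>;
  \<open>G c x\<close> is the Gram matrix at \<open>x\<close> of the metric on tangent vectors in the chart \<open>c\<close>.
\<close>

definition smooth_measure :: "'m chart set \<Rightarrow> ('m chart \<Rightarrow> 'm \<Rightarrow> real) \<Rightarrow> bool" where
  "smooth_measure \<A> \<rho> \<longleftrightarrow>
     (\<forall>c\<in>\<A>. smooth_on (snd c ` fst c) (\<lambda>y. \<rho> c (inv_into (fst c) (snd c) y)) \<and>
        (\<forall>x\<in>fst c. \<rho> c x > 0)) \<and>
     (\<forall>c\<in>\<A>. \<forall>c'\<in>\<A>. \<forall>x\<in>fst c \<inter> fst c'.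
        \<rho> c' x = \<bar>det (dmat c' c (\<lambda>y. y) x)\<bar> * \<rho> c x)"

definition riemannian_metric :: "'m chart set \<Rightarrow> ('m chart \<Rightarrow> 'm \<Rightarrow> real^2^2) \<Rightarrow> bool" where
  "riemannian_metric \<A> G \<longleftrightarrow>
     (\<forall>c\<in>\<A>. smooth_on (snd c ` fst c) (\<lambda>y. G c (inv_into (fst c) (snd c) y)) \<and>
        (\<forall>x\<in>fst c. transpose (G c x) = G c x \<and> (\<forall>v. v \<noteq> 0 \<longrightarrow> v \<bullet> (G c x *v v) > 0))) \<and>
     (\<forall>c\<in>\<A>. \<forall>c'\<in>\<A>. \<forall>x\<in>fst c \<inter> fst c'.
        G c' x = transpose (dmat c' c (\<lambda>y. y) x) ** G c x ** dmat c' c (\<lambda>y. y) x)"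

definition covector_norm :: "'m chart set \<Rightarrow> ('m chart \<Rightarrow> 'm \<Rightarrow> real^2^2) \<Rightarrow> 'm \<times> 'm covector \<Rightarrow> real" where
  "covector_norm \<A> G = (\<lambda>(x, \<xi>). let c = chart_at \<A> x in
     sqrt (\<xi> c \<bullet> (matrix_inv (G c x) *v \<xi> c)))"

text \<open>The quotient \<open>(h\<^sup>*\<mu>)(x) / \<mu>(x)\<close>.\<close>

definition measure_jacobian ::
    "'m chart set \<Rightarrow> ('m chart \<Rightarrow> 'm \<Rightarrow> real) \<Rightarrow> ('m \<Rightarrow> 'm) \<Rightarrow> 'm \<Rightarrow> real" where
  "measure_jacobian \<A> \<rho> h x = (let c = chart_at \<A> x; c' = chart_at \<A> (h x) in
     \<rho> c' (h x) * \<bar>det (dmat c c' h x)\<bar> / \<rho> c x)"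

section \<open>Classical pseudodifferential operators\<close>

text \<open>
  Estimates of order \<open>m\<close> in the region \<open>|\<xi>| \<ge> r\<close>, uniform in \<open>x\<close>;
  \<open>vs\<close> and \<open>ws\<close> list the coordinate directions of the \<open>x\<close>- and \<open>\<xi>\<close>-derivatives.
\<close>

definition symbol_bounds :: "real \<Rightarrow> real \<Rightarrow> ((real^2) \<times> (real^2) \<Rightarrow> complex) \<Rightarrow> bool" where
  "symbol_bounds r m a \<longleftrightarrow>
     (\<forall>vs ws. set vs \<subseteq> Basis \<and> set ws \<subseteq> Basis \<longrightarrow>
        (\<exists>C. \<forall>x \<xi>. r \<le> norm \<xi> \<longrightarrow>
           cmod (iter_deriv (map (\<lambda>v. (v, 0)) vs @ map (\<lambda>w. (0, w)) ws) a (x, \<xi>))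
             \<le> C * (1 + norm \<xi>) powr (m - real (length ws))))"

text \<open>\<open>a\<close> is a symbol with the asymptotic expansion \<open>a \<sim> \<Sum>j. b j\<close>, \<open>b j\<close> homogeneous of degree \<open>d - j\<close>.\<close>

definition classical_symbol ::
    "real \<Rightarrow> ((real^2) \<times> (real^2) \<Rightarrow> complex) \<Rightarrow> (nat \<Rightarrow> (real^2) \<times> (real^2) \<Rightarrow> complex) \<Rightarrow> bool" where
  "classical_symbol d a b \<longleftrightarrow>
     smooth_on UNIV a \<and> symbol_bounds 0 d a \<and>
     (\<forall>j. smooth_on {(x, \<xi>). \<xi> \<noteq> 0} (b j) \<and>
        (\<forall>x \<xi> t. \<xi> \<noteq> 0 \<and> t > 0 \<longrightarrow>
           b j (x, t *\<^sub>R \<xi>) = complex_of_real (t powr (d - real j)) * b j (x, \<xi>))) \<and>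
     (\<forall>N. symbol_bounds 1 (d - real N) (\<lambda>p. a p - (\<Sum>j<N. b j p)))"

definition fourier :: "(real^2 \<Rightarrow> complex) \<Rightarrow> real^2 \<Rightarrow> complex" where
  "fourier u \<xi> = integral\<^sup>L lborel (\<lambda>y. cis (- (y \<bullet> \<xi>)) * u y)"

definition quantize :: "((real^2) \<times> (real^2) \<Rightarrow> complex) \<Rightarrow> (real^2 \<Rightarrow> complex) \<Rightarrow> real^2 \<Rightarrow> complex" where
  "quantize a u x =
     integral\<^sup>L lborel (\<lambda>\<xi>. cis (x \<bullet> \<xi>) * a (x, \<xi>) * fourier u \<xi>) / complex_of_real ((2 * pi)\<^sup>2)"

text \<open>The operator \<open>\<phi> A \<psi>\<close> in the coordinates of the chart \<open>c\<close>.\<close>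

definition localize ::
    "'m chart \<Rightarrow> (real^2 \<Rightarrow> complex) \<Rightarrow> (real^2 \<Rightarrow> complex) \<Rightarrow> (('m \<Rightarrow> complex) \<Rightarrow> 'm \<Rightarrow> complex) \<Rightarrow>
     (real^2 \<Rightarrow> complex) \<Rightarrow> real^2 \<Rightarrow> complex" where
  "localize c \<phi> \<psi> A u y =
     \<phi> y * A (\<lambda>x. if x \<in> fst c then \<psi> (snd c x) * u (snd c x) else 0) (inv_into (fst c) (snd c) y)"

text \<open>
  In every chart and for all cutoffs \<open>\<phi>\<close>, \<open>\<psi>\<close>, the operator \<open>\<phi> A \<psi>\<close> is the quantization of a
  classical symbol whose leading term is \<open>\<phi> \<psi> \<sigma>\<close>. As chart domains may be disconnected, this
  includes that the Schwartz kernel of \<open>A\<close> is smooth off the diagonal. That the leading terms in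
  the various charts define one function \<open>\<sigma>\<close> on the cotangent bundle, unique off the zero section,
  is the invariance of the principal symbol under changes of coordinates. The continuity
  of \<open>A\<close> on smooth functions follows by a partition of unity.
\<close>

definition has_principal_symbol ::
    "'m chart set \<Rightarrow> real \<Rightarrow> (('m \<Rightarrow> complex) \<Rightarrow> 'm \<Rightarrow> complex) \<Rightarrow> ('m \<times> 'm covector \<Rightarrow> complex) \<Rightarrow> bool" where
  "has_principal_symbol \<A> d A \<sigma> \<longleftrightarrow>
     (\<forall>c\<in>\<A>. \<forall>\<phi> \<psi>. test_fun (snd c ` fst c) \<phi> \<and> test_fun (snd c ` fst c) \<psi> \<longrightarrow>
        (\<exists>a b. classical_symbol d a b \<and>
           (\<forall>u. test_fun UNIV u \<longrightarrow> localize c \<phi> \<psi> A u = quantize a u) \<and>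
           (\<forall>(x, \<xi>) \<in> cotangent0 \<A>. x \<in> fst c \<longrightarrow>
              b 0 (snd c x, \<xi> c) = \<phi> (snd c x) * \<psi> (snd c x) * \<sigma> (x, \<xi>))))"

definition pseudodifferential ::
    "'m chart set \<Rightarrow> real \<Rightarrow> (('m \<Rightarrow> complex) \<Rightarrow> 'm \<Rightarrow> complex) \<Rightarrow> bool" where
  "pseudodifferential \<A> d A \<longleftrightarrow>
     (\<forall>u. smooth_fun \<A> u \<longrightarrow> smooth_fun \<A> (A u)) \<and>
     (\<forall>u v \<alpha> \<beta>. smooth_fun \<A> u \<and> smooth_fun \<A> v \<longrightarrow>
        A (\<lambda>x. \<alpha> * u x + \<beta> * v x) = (\<lambda>x. \<alpha> * A u x + \<beta> * A v x)) \<and>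
     (\<exists>\<sigma>. has_principal_symbol \<A> d A \<sigma>)"

definition principal_symbol ::
    "'m chart set \<Rightarrow> real \<Rightarrow> (('m \<Rightarrow> complex) \<Rightarrow> 'm \<Rightarrow> complex) \<Rightarrow> 'm \<times> 'm covector \<Rightarrow> complex" where
  "principal_symbol \<A> d A = (SOME \<sigma>. has_principal_symbol \<A> d A \<sigma>)"

section \<open>Weighted sequence spaces\<close>

definition l2 :: "(int \<Rightarrow> real) \<Rightarrow> (int \<Rightarrow> complex) set" where
  "l2 m = {w. (\<lambda>n. (cmod (w n))\<^sup>2 * m n) summable_on UNIV}"

definition l2_norm :: "(int \<Rightarrow> real) \<Rightarrow> (int \<Rightarrow> complex) \<Rightarrow> real" where
  "l2_norm m w = sqrt (\<Sum>\<^sub>\<infinity>n. (cmod (w n))\<^sup>2 * m n)"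

definition l2_bounded ::
    "(int \<Rightarrow> real) \<Rightarrow> (int \<Rightarrow> real) \<Rightarrow> ((int \<Rightarrow> complex) \<Rightarrow> int \<Rightarrow> complex) \<Rightarrow> bool" where
  "l2_bounded m m' A \<longleftrightarrow>
     (\<forall>w\<in>l2 m. A w \<in> l2 m') \<and>
     (\<forall>v\<in>l2 m. \<forall>w\<in>l2 m. \<forall>\<alpha> \<beta>.
        A (\<lambda>n. \<alpha> * v n + \<beta> * w n) = (\<lambda>n. \<alpha> * A v n + \<beta> * A w n)) \<and>
     (\<exists>C. \<forall>w\<in>l2 m. l2_norm m' (A w) \<le> C * l2_norm m w)"

definition l2_invertible ::
    "(int \<Rightarrow> real) \<Rightarrow> (int \<Rightarrow> real) \<Rightarrow> ((int \<Rightarrow> complex) \<Rightarrow> int \<Rightarrow> complex) \<Rightarrow> bool" where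
  "l2_invertible m m' A \<longleftrightarrow> l2_bounded m m' A \<and>
     (\<exists>B. l2_bounded m' m B \<and> (\<forall>w\<in>l2 m. B (A w) = w) \<and> (\<forall>w\<in>l2 m'. A (B w) = w))"

section \<open>Nonlocal operators and ellipticity\<close>

text \<open>
  \<open>D = \<Sum>k\<in>K. Dk k T\<^sup>k\<close> on smooth functions, which are dense in every Sobolev space; the operator
  between Sobolev spaces is the extension by continuity.
\<close>

definition nonlocal_operator ::
    "'m chart set \<Rightarrow> ('m \<Rightarrow> 'm) \<Rightarrow> real \<Rightarrow> int set \<Rightarrow> (int \<Rightarrow> ('m \<Rightarrow> complex) \<Rightarrow> 'm \<Rightarrow> complex) \<Rightarrow>
     (('m \<Rightarrow> complex) \<Rightarrow> 'm \<Rightarrow> complex) \<Rightarrow> bool" where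
  "nonlocal_operator \<A> g d K Dk D \<longleftrightarrow>
     finite K \<and> (\<forall>k\<in>K. pseudodifferential \<A> d (Dk k)) \<and>
     (\<forall>u. smooth_fun \<A> u \<longrightarrow> (\<forall>x. D u x = (\<Sum>k\<in>K. Dk k (\<lambda>y. u (int_iter UNIV g k y)) x)))"

definition weight ::
    "'m chart set \<Rightarrow> ('m \<Rightarrow> 'm) \<Rightarrow> ('m chart \<Rightarrow> 'm \<Rightarrow> real) \<Rightarrow> ('m chart \<Rightarrow> 'm \<Rightarrow> real^2^2) \<Rightarrow>
     'm \<times> 'm covector \<Rightarrow> real \<Rightarrow> int \<Rightarrow> real" where
  "weight \<A> g \<rho> G p s n =
     measure_jacobian \<A> \<rho> (int_iter UNIV g n) (fst p) *
     covector_norm \<A> G (codiff_iter \<A> g n p) powr (2 * s)"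

definition operator_symbol ::
    "'m chart set \<Rightarrow> ('m \<Rightarrow> 'm) \<Rightarrow> real \<Rightarrow> int set \<Rightarrow> (int \<Rightarrow> ('m \<Rightarrow> complex) \<Rightarrow> 'm \<Rightarrow> complex) \<Rightarrow>
     'm \<times> 'm covector \<Rightarrow> (int \<Rightarrow> complex) \<Rightarrow> int \<Rightarrow> complex" where
  "operator_symbol \<A> g d K Dk p w n =
     (\<Sum>k\<in>K. principal_symbol \<A> d (Dk k) (codiff_iter \<A> g n p) * w (n + k))"

definition elliptic ::
    "'m chart set \<Rightarrow> ('m \<Rightarrow> 'm) \<Rightarrow> ('m chart \<Rightarrow> 'm \<Rightarrow> real) \<Rightarrow> ('m chart \<Rightarrow> 'm \<Rightarrow> real^2^2) \<Rightarrow>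
     real \<Rightarrow> int set \<Rightarrow> (int \<Rightarrow> ('m \<Rightarrow> complex) \<Rightarrow> 'm \<Rightarrow> complex) \<Rightarrow> real \<Rightarrow> bool" where
  "elliptic \<A> g \<rho> G d K Dk s \<longleftrightarrow>
     (\<forall>p \<in> cotangent0 \<A>.
        l2_invertible (weight \<A> g \<rho> G p s) (weight \<A> g \<rho> G p (s - d)) (operator_symbol \<A> g d K Dk p))"

end

theory Submission
  imports Defs "HOL-Complex_Analysis.Great_Picard"
begin

text \<open>
  The set of all \<open>s\<close> for which the operator is elliptic is open and convex in \<open>\<real>\<close>; hence it is an
  interval \<open>(s0, s1)\<close>, and this interval has both properties claimed.

  Write \<open>\<theta> p n\<close> for the logarithm of \<open>|\<partial>g\<^sup>n p|\<close>. Multiplying sequences by the square roots of the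
  weights turns the symbol at \<open>p\<close> into a band operator on the unweighted sequence space, with
  coefficients \<open>\<alpha> p n k * exp (s * (\<theta> p n - \<theta> p (n + k)))\<close>, where \<open>\<alpha>\<close> does not depend on \<open>s\<close>
  (\<open>elliptic_iff\<close>). So a change of \<open>s\<close> is a conjugation by an exponential of \<open>\<theta>\<close>. The coefficients
  depend only on the ray of \<open>p\<close>, and moving \<open>p\<close> along its orbit shifts them. As \<open>M\<close> is compact, they
  form a family that is invariant under shifts and compact under pointwise convergence.

  For such a family, invertibility of all members is automatically uniform (\<open>uniform_green\<close>). If
  there were no common lower bound in the supremum norm, translates of almost-solutions of the
  homogeneous equation would converge to a bounded solution for some member of the family; but a
  member invertible on square-summable sequences has no nonzero bounded solution. The common lower
  bound, applied to columns of the inverse multiplied by growing exponentials, yields inverse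
  matrices with \<open>|B p n m| \<le> C * exp (- \<gamma> * |n - m|)\<close>, with the same \<open>C\<close> and \<open>\<gamma>\<close> for all \<open>p\<close>.

  For openness, passing from \<open>s\<close> to \<open>s + \<tau>\<close> multiplies \<open>B p n m\<close> by
  \<open>exp (\<tau> * (\<theta> p n - \<theta> p m))\<close>, and \<open>\<theta> p\<close> is Lipschitz uniformly in \<open>p\<close>. A small \<open>\<tau>\<close> therefore costs
  only a part of the exponential decay.

  For convexity, note that for a single \<open>p\<close> the set of good \<open>s\<close> need not be convex, because the inverses at
  \<open>s < s'\<close> may be unrelated. They are related when \<open>\<theta> p\<close> is bounded below. Then a column of the
  inverse at \<open>s'\<close>, carried to \<open>s\<close>, is still bounded, hence it is the column of the inverse at \<open>s\<close>;
  and the matrix carried to an exponent between \<open>s\<close> and \<open>s'\<close> is dominated, entry by entry, by the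
  larger of the two (\<open>green_between\<close>). Because \<open>C\<close> and \<open>\<gamma>\<close> are uniform, a limit reaches every \<open>p\<close>
  that is approximated by such covectors (\<open>green_limit\<close>), and the approximation is always possible.

  The points not fixed by \<open>g\<close> are dense (\<open>bounded_below_dense\<close>). The forward orbit of such
  a point converges to a fixed point where \<open>dg\<close> has eigenvalues \<open>l1 < l2\<close>, and \<open>l1 < 1\<close>, since
  otherwise the fixed point would repel the orbit. The codifferential there has the eigenvalues
  \<open>1 / l1 > 1\<close> and \<open>1 / l2 < 1 / l1\<close>, so by a cone argument all covectors outside one line grow
  (\<open>cone_growth\<close>). The same holds for backward orbits. Hence \<open>\<theta> p\<close> is bounded below for all
  covectors \<open>p\<close> at the point outside two lines.
\<close>

section \<open>Band operators and their inverse matrices\<close>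

definition band :: "int set \<Rightarrow> (int \<Rightarrow> int \<Rightarrow> complex) \<Rightarrow> (int \<Rightarrow> complex) \<Rightarrow> int \<Rightarrow> complex" where
  "band K a w n = (\<Sum>k\<in>K. a n k * w (n + k))"

text \<open>
  The matrix \<open>B\<close> is a two-sided inverse of the band operator, decaying exponentially off the diagonal.
  Both equations involve finite sums only, so they survive pointwise limits.
\<close>

definition green :: "int set \<Rightarrow> real \<Rightarrow> real \<Rightarrow> (int \<Rightarrow> int \<Rightarrow> complex) \<Rightarrow> (int \<Rightarrow> int \<Rightarrow> complex) \<Rightarrow> bool" where
  "green K C \<gamma> a B \<longleftrightarrow>
     (\<forall>n m. (\<Sum>k\<in>K. a n k * B (n + k) m) = of_bool (n = m)) \<and>
     (\<forall>n m. (\<Sum>k\<in>K. B n (m - k) * a (m - k) k) = of_bool (n = m)) \<and>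
     (\<forall>n m. cmod (B n m) \<le> C * exp (- \<gamma> * \<bar>real_of_int (n - m)\<bar>))"

text \<open>
  Membership in the sequence space together with a bound of the norm, expressed through finite
  partial sums, where Minkowski's inequality for \<open>L2_set\<close> applies.
\<close>

definition l2_le :: "(int \<Rightarrow> complex) \<Rightarrow> real \<Rightarrow> bool" where
  "l2_le w S \<longleftrightarrow> (\<forall>F. finite F \<longrightarrow> L2_set (\<lambda>n. cmod (w n)) F \<le> S)"

abbreviation "unit_l2 \<equiv> l2 (\<lambda>_. 1)"
abbreviation "unit_norm \<equiv> l2_norm (\<lambda>_. 1)"

lemma l2_leD:
  assumes "w \<in> unit_l2" shows "l2_le w (unit_norm w)"
  unfolding l2_le_def l2_norm_def L2_set_def
  using assms by (auto simp: l2_def intro!: finite_sum_le_infsum)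

lemma l2_leI:
  assumes "l2_le w S" shows "w \<in> unit_l2" "unit_norm w \<le> S"
proof -
  have S: "S \<ge> 0" using assms[unfolded l2_le_def, rule_format, of "{}"] by simp
  have fin: "(\<Sum>n\<in>F. (cmod (w n))\<^sup>2) \<le> S\<^sup>2" if "finite F" for F
  proof -
    have "sqrt (\<Sum>n\<in>F. (cmod (w n))\<^sup>2) \<le> S"
      using assms that by (simp add: l2_le_def L2_set_def)
    then show ?thesis using S by (simp add: sqrt_le_D)
  qed
  have sq: "(\<lambda>n. (cmod (w n))\<^sup>2) summable_on UNIV"
  proof (rule nonneg_bounded_partial_sums_imp_summable_on)
    show "\<forall>\<^sub>F F in finite_subsets_at_top UNIV. (\<Sum>n\<in>F. (cmod (w n))\<^sup>2) \<le> S\<^sup>2"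
      by (rule eventually_finite_subsets_at_top_weakI) (rule fin)
  qed simp
  then show "w \<in> unit_l2" by (simp add: l2_def)
  have "(\<Sum>\<^sub>\<infinity>n. (cmod (w n))\<^sup>2) \<le> S\<^sup>2"
    by (rule infsum_le_finite_sums[OF sq]) (rule fin)
  then have "sqrt (\<Sum>\<^sub>\<infinity>n. (cmod (w n))\<^sup>2) \<le> S" using S by (simp add: real_le_lsqrt)
  then show "unit_norm w \<le> S" by (simp add: l2_norm_def)
qed

lemma unit_norm_nonneg: "0 \<le> unit_norm w"
  by (simp add: l2_norm_def infsum_nonneg)

lemma l2_le_bound:
  assumes "l2_le w S" shows "cmod (w n) \<le> S"
  using assms[unfolded l2_le_def, rule_format, of "{n}"] by simp

lemma L2_set_shift:
  fixes k :: int
  assumes "l2_le u S" "finite F" shows "L2_set (\<lambda>n. cmod (u (n + k))) F \<le> S"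
proof -
  have "L2_set (\<lambda>n. cmod (u (n + k))) F = L2_set (\<lambda>n. cmod (u n)) ((\<lambda>n. n + k) ` F)"
    unfolding L2_set_def by (subst sum.reindex) (auto simp: inj_on_def o_def)
  then show ?thesis using assms by (auto simp: l2_le_def)
qed

lemma L2_set_sum_le:
  fixes f :: "'a \<Rightarrow> 'b \<Rightarrow> real"
  assumes "finite J"
  shows "L2_set (\<lambda>n. \<Sum>j\<in>J. f j n) F \<le> (\<Sum>j\<in>J. L2_set (f j) F)"
  using assms
proof induction
  case (insert j J)
  have "L2_set (\<lambda>n. f j n + (\<Sum>j\<in>J. f j n)) F \<le> L2_set (f j) F + L2_set (\<lambda>n. \<Sum>j\<in>J. f j n) F"
    by (rule L2_set_triangle_ineq)
  then show ?case using insert by simp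
qed (simp add: L2_set_def)

text \<open>
  Each diagonal of a matrix acts as a multiple of a shift, which preserves the norm. So the norm of a
  matrix operator is at most the sum of the bounds of its diagonals.
\<close>

lemma L2_set_diagonals_le:
  fixes u v :: "int \<Rightarrow> complex"
  assumes u: "l2_le u S" and "finite J" "finite F" and c: "\<And>j. j \<in> J \<Longrightarrow> 0 \<le> c j"
    and v: "\<And>n. n \<in> F \<Longrightarrow> cmod (v n) \<le> (\<Sum>j\<in>J. c j * cmod (u (n + j)))"
  shows "L2_set (\<lambda>n. cmod (v n)) F \<le> (\<Sum>j\<in>J. c j) * S"
proof -
  have "L2_set (\<lambda>n. cmod (v n)) F \<le> L2_set (\<lambda>n. \<Sum>j\<in>J. c j * cmod (u (n + j))) F"
    by (rule L2_set_mono) (auto intro: v)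
  also have "\<dots> \<le> (\<Sum>j\<in>J. L2_set (\<lambda>n. c j * cmod (u (n + j))) F)"
    using assms by (intro L2_set_sum_le)
  also have "\<dots> = (\<Sum>j\<in>J. c j * L2_set (\<lambda>n. cmod (u (n + j))) F)"
    by (intro sum.cong refl L2_set_right_distrib[symmetric] c)
  also have "\<dots> \<le> (\<Sum>j\<in>J. c j * S)"
    by (intro sum_mono mult_left_mono c L2_set_shift assms)
  finally show ?thesis by (simp add: sum_distrib_right)
qed

lemma small_tilt_exists:
  fixes K :: "int set" and M \<epsilon> :: real
  assumes "\<epsilon> > 0"
  shows "\<exists>\<gamma>>0. (\<Sum>k\<in>K. M * (exp (\<gamma> * \<bar>real_of_int k\<bar>) - 1)) < \<epsilon>"
proof -
  have "((\<lambda>\<gamma>. \<Sum>k\<in>K. M * (exp (\<gamma> * \<bar>real_of_int k\<bar>) - 1)) \<longlongrightarrow> (\<Sum>k\<in>K. M * (exp (0 * \<bar>real_of_int k\<bar>) - 1)))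
      (at_right 0)"
    by (intro tendsto_intros)
  then have "\<forall>\<^sub>F \<gamma> in at_right 0. (\<Sum>k\<in>K. M * (exp (\<gamma> * \<bar>real_of_int k\<bar>) - 1)) < \<epsilon>"
    using assms by (intro order_tendstoD(2)) auto
  then have "\<forall>\<^sub>F \<gamma> in at_right 0. \<gamma> > 0 \<and> (\<Sum>k\<in>K. M * (exp (\<gamma> * \<bar>real_of_int k\<bar>) - 1)) < \<epsilon>"
    by (intro eventually_conj eventually_at_right_less)
  then show ?thesis using eventually_happens' trivial_limit_at_right_real by blast
qed

text \<open>
  A slowly varying exponential weight almost commutes with a band operator: the commutator involves
  differences of the weight over the width of the band only, and these are small relative to the weight.
\<close>

lemma band_tilt:
  fixes \<phi> :: "int \<Rightarrow> real" and w :: "int \<Rightarrow> complex"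
  assumes a: "\<And>n k. k \<in> K \<Longrightarrow> cmod (a n k) \<le> M"
    and \<phi>: "\<And>n k. k \<in> K \<Longrightarrow> \<bar>\<phi> (n + k) - \<phi> n\<bar> \<le> \<gamma> * \<bar>real_of_int k\<bar>"
  shows "cmod (band K a (\<lambda>n. of_real (exp (\<phi> n)) * w n) n - of_real (exp (\<phi> n)) * band K a w n)
     \<le> (\<Sum>k\<in>K. M * (exp (\<gamma> * \<bar>real_of_int k\<bar>) - 1) * cmod (of_real (exp (\<phi> (n + k))) * w (n + k)))"
proof -
  have "band K a (\<lambda>n. of_real (exp (\<phi> n)) * w n) n - of_real (exp (\<phi> n)) * band K a w n
      = (\<Sum>k\<in>K. a n k * (of_real (exp (\<phi> (n + k))) - of_real (exp (\<phi> n))) * w (n + k))"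
    unfolding band_def sum_distrib_left sum_subtractf[symmetric]
    by (intro sum.cong) (auto simp: algebra_simps)
  also have "cmod \<dots> \<le> (\<Sum>k\<in>K. cmod (a n k * (of_real (exp (\<phi> (n + k))) - of_real (exp (\<phi> n))) * w (n + k)))"
    by (rule norm_sum)
  also have "\<dots> \<le> (\<Sum>k\<in>K. M * (exp (\<gamma> * \<bar>real_of_int k\<bar>) - 1) * cmod (of_real (exp (\<phi> (n + k))) * w (n + k)))"
  proof (rule sum_mono)
    fix k assume k: "k \<in> K"
    let ?g = "\<gamma> * \<bar>real_of_int k\<bar>" and ?x = "\<phi> (n + k)" and ?y = "\<phi> n"
    have g: "?g \<ge> 0" using \<phi>[OF k, of n] by linarith
    have 1: "exp ?y \<le> exp ?g * exp ?x" and 2: "exp ?x \<le> exp ?g * exp ?y"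
      using \<phi>[OF k, of n] by (auto simp: exp_add[symmetric])
    have "\<bar>exp ?x - exp ?y\<bar> \<le> (exp ?g - 1) * exp ?x"
    proof (cases "?x \<le> ?y")
      case True then show ?thesis using 1 by (auto simp: algebra_simps abs_if)
    next
      case False
      have "exp ?x * 1 \<le> exp ?x * ((exp ?g - 1) + exp (- ?g))"
      proof (intro mult_left_mono)
        have "0 \<le> (exp ?g - 1)\<^sup>2 * exp (- ?g)" by simp
        also have "\<dots> = exp ?g - 2 + exp (-?g)"
          by (simp add: power2_eq_square algebra_simps exp_minus)
        finally show "1 \<le> (exp ?g - 1) + exp (- ?g)" by simp
      qed simp
      moreover have "exp (-?g) * exp ?x \<le> exp ?y"
        using \<phi>[OF k, of n] by (auto simp: exp_add[symmetric])
      ultimately show ?thesis using False by (auto simp: algebra_simps abs_if)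
    qed
    then have "cmod (of_real (exp (\<phi> (n + k))) - of_real (exp (\<phi> n))) \<le> (exp ?g - 1) * exp ?x"
      by (metis norm_of_real of_real_diff)
    then have "cmod (a n k) * cmod (of_real (exp (\<phi> (n + k))) - of_real (exp (\<phi> n))) \<le> M * ((exp ?g - 1) * exp ?x)"
      using a[OF k] by (intro mult_mono) (auto intro: order_trans[OF _ a[OF k]])
    then have "cmod (a n k) * cmod (of_real (exp (\<phi> (n + k))) - of_real (exp (\<phi> n))) * cmod (w (n + k))
       \<le> M * ((exp ?g - 1) * exp ?x) * cmod (w (n + k))"
      by (intro mult_right_mono) auto
    then show "cmod (a n k * (of_real (exp (\<phi> (n + k))) - of_real (exp (\<phi> n))) * w (n + k))
         \<le> M * (exp ?g - 1) * cmod (of_real (exp (\<phi> (n + k))) * w (n + k))"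
      by (simp add: norm_mult mult.assoc)
  qed
  finally show ?thesis .
qed

lemma exp_decay_summable:
  fixes \<gamma> :: real
  assumes "\<gamma> > 0"
  shows "(\<lambda>j::int. exp (- \<gamma> * \<bar>real_of_int (n - j)\<bar>)) summable_on UNIV"
proof -
  define f where "f = (\<lambda>j::int. exp (- \<gamma> * \<bar>real_of_int j\<bar>))"
  have s: "summable (\<lambda>j::nat. exp (- \<gamma> * real j))"
  proof -
    have "exp (- \<gamma> * real j) = exp (- \<gamma>) ^ j" for j
      by (simp add: exp_of_nat_mult[symmetric] mult.commute)
    then show ?thesis using assms by (simp add: summable_geometric)
  qed
  have u: "(UNIV :: int set) = int ` UNIV \<union> (\<lambda>j. - int j) ` UNIV"
  proof -
    have "x \<in> int ` UNIV \<union> (\<lambda>j. - int j) ` UNIV" for x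
      by (cases x rule: int_cases2) auto
    then show ?thesis by auto
  qed
  have s': "(\<lambda>j::nat. exp (- \<gamma> * real j)) summable_on UNIV"
    by (rule summable_nonneg_imp_summable_on) (use s in \<open>auto simp del: mult_minus_left\<close>)
  have "f summable_on int ` UNIV"
    using s' by (subst summable_on_reindex) (auto simp: f_def o_def)
  moreover have "f summable_on (\<lambda>j. - int j) ` UNIV"
    using s' by (subst summable_on_reindex) (auto simp: f_def o_def inj_on_def)
  ultimately have "f summable_on UNIV" using u summable_on_union by metis
  then have "(\<lambda>j. f (n - j)) summable_on UNIV"
    by (subst summable_on_reindex_bij_betw[of "\<lambda>j. n - j" UNIV UNIV f])
       (auto intro!: bij_betwI[where g="\<lambda>j. n - j"])
  then show ?thesis by (simp add: f_def)
qed

subsection \<open>From invertibility to bounded sequences\<close>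

text \<open>
  A bounded solution of the homogeneous equation, damped by \<open>exp (- \<gamma> * |n|)\<close>, becomes
  square-summable, and by \<open>band_tilt\<close> its image is small relative to it when \<open>\<gamma>\<close> is small. This
  contradicts the boundedness of the inverse unless the solution vanishes.
\<close>

lemma invertible_imp_injective_bounded:
  assumes inv: "l2_invertible (\<lambda>_. 1) (\<lambda>_. 1) (band K a)" and K: "finite K"
    and a: "\<And>n k. k \<in> K \<Longrightarrow> cmod (a n k) \<le> M"
    and w: "\<And>n. cmod (w n) \<le> W" and z: "\<And>n. band K a w n = 0"
  shows "w n = 0"
proof -
  obtain B C where BA: "\<forall>w\<in>unit_l2. B (band K a w) = w"
    and C: "\<forall>w\<in>unit_l2. unit_norm (B w) \<le> C * unit_norm w"
    using inv unfolding l2_invertible_def l2_bounded_def by metis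
  have W: "W \<ge> 0" using w[of 0] norm_ge_zero order_trans by blast
  obtain \<gamma> where \<gamma>: "\<gamma> > 0" "(\<Sum>k\<in>K. \<bar>M\<bar> * (exp (\<gamma> * \<bar>real_of_int k\<bar>) - 1)) < 1 / (\<bar>C\<bar> + 1)"
    using small_tilt_exists[of "1 / (\<bar>C\<bar> + 1)"] by force
  let ?c = "\<lambda>k. \<bar>M\<bar> * (exp (\<gamma> * \<bar>real_of_int k\<bar>) - 1)"
  define u where "u = (\<lambda>n. of_real (exp (- \<gamma> * \<bar>real_of_int n\<bar>)) * w n)"
  have dec: "cmod (u n) \<le> W * exp (- \<gamma> * \<bar>real_of_int n\<bar>)" for n
    using w[of n] by (simp add: u_def norm_mult)
  have "u \<in> unit_l2"
  proof -
    have "(\<lambda>j. W\<^sup>2 * exp (- (2 * \<gamma>) * \<bar>real_of_int (0 - j)\<bar>)) summable_on UNIV"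
      using exp_decay_summable[of "2 * \<gamma>" 0] \<gamma> by (intro summable_on_cmult_right) auto
    moreover have "(cmod (u n))\<^sup>2 \<le> W\<^sup>2 * exp (- (2 * \<gamma>) * \<bar>real_of_int (0 - n)\<bar>)" for n
    proof -
      have "(cmod (u n))\<^sup>2 \<le> (W * exp (- \<gamma> * \<bar>real_of_int n\<bar>))\<^sup>2"
        by (intro power_mono dec) auto
      also have "\<dots> = W\<^sup>2 * exp (- (2 * \<gamma>) * \<bar>real_of_int (0 - n)\<bar>)"
        by (simp add: power_mult_distrib exp_double[symmetric])
      finally show ?thesis .
    qed
    ultimately show ?thesis unfolding l2_def
      by (auto intro: summable_on_comparison_test)
  qed
  have ule: "l2_le u (unit_norm u)" by (rule l2_leD) fact
  have "l2_le (band K a u) ((\<Sum>k\<in>K. ?c k) * unit_norm u)"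
    unfolding l2_le_def
  proof (intro allI impI)
    fix F :: "int set" assume F: "finite F"
    have "cmod (band K a u n) \<le> (\<Sum>k\<in>K. ?c k * cmod (u (n + k)))" for n
    proof -
      have "\<bar>- \<gamma> * \<bar>real_of_int (n + k)\<bar> - - \<gamma> * \<bar>real_of_int n\<bar>\<bar> \<le> \<gamma> * \<bar>real_of_int k\<bar>" for n k
      proof -
        have "\<bar>- \<gamma> * \<bar>real_of_int (n + k)\<bar> - - \<gamma> * \<bar>real_of_int n\<bar>\<bar> = \<gamma> * \<bar>\<bar>real_of_int n\<bar> - \<bar>real_of_int (n + k)\<bar>\<bar>"
        proof -
          have "- \<gamma> * \<bar>real_of_int (n + k)\<bar> - - \<gamma> * \<bar>real_of_int n\<bar> = \<gamma> * (\<bar>real_of_int n\<bar> - \<bar>real_of_int (n + k)\<bar>)"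
            by (simp add: algebra_simps)
          then show ?thesis using \<gamma> by (simp only: abs_mult) simp
        qed
        also have "\<dots> \<le> \<gamma> * \<bar>real_of_int k\<bar>"
          using \<gamma> by (intro mult_left_mono) auto
        finally show ?thesis .
      qed
      moreover have "cmod (a n k) \<le> \<bar>M\<bar>" if "k \<in> K" for n k
        using a[OF that, of n] by linarith
      ultimately show ?thesis
        using band_tilt[where \<phi>="\<lambda>n. - \<gamma> * \<bar>real_of_int n\<bar>" and w=w and n=n and M="\<bar>M\<bar>" and K=K and a=a] z
        by (simp only: u_def mult_zero_right diff_zero)
    qed
    then show "L2_set (\<lambda>n. cmod (band K a u n)) F \<le> (\<Sum>k\<in>K. ?c k) * unit_norm u"
      using \<gamma> by (intro L2_set_diagonals_le[OF ule K F]) auto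
  qed
  note Au = l2_leI[OF this]
  have "unit_norm u = unit_norm (B (band K a u))" using BA \<open>u \<in> unit_l2\<close> by simp
  also have "\<dots> \<le> C * unit_norm (band K a u)" using C Au by blast
  also have "\<dots> \<le> (\<bar>C\<bar> + 1) * unit_norm (band K a u)"
    by (intro mult_right_mono unit_norm_nonneg) auto
  also have "\<dots> \<le> (\<bar>C\<bar> + 1) * ((\<Sum>k\<in>K. ?c k) * unit_norm u)"
    using Au by (intro mult_left_mono) auto
  finally have *: "unit_norm u \<le> ((\<bar>C\<bar> + 1) * (\<Sum>k\<in>K. ?c k)) * unit_norm u" by (simp add: mult.assoc)
  have "(\<bar>C\<bar> + 1) * (\<Sum>k\<in>K. ?c k) < 1" using \<gamma> by (simp add: field_simps)
  then have "unit_norm u \<le> 0"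
    using * mult_strict_right_mono[of "(\<bar>C\<bar> + 1) * (\<Sum>k\<in>K. ?c k)" 1 "unit_norm u"] by linarith
  then have "cmod (u n) \<le> 0" using l2_le_bound[OF ule] by (meson order_trans)
  then show ?thesis by (simp add: u_def)
qed

lemma unit_vector_l2: "(\<lambda>n. of_bool (n = m)) \<in> unit_l2"
proof -
  have "(\<lambda>n. (cmod (of_bool (n = m)))\<^sup>2 * 1) summable_on UNIV \<longleftrightarrow>
     (\<lambda>n. (cmod (of_bool (n = m)))\<^sup>2 * 1) summable_on {m}"
    by (rule summable_on_cong_neutral) auto
  then show ?thesis by (simp add: l2_def)
qed

lemma unit_l2_combination:
  assumes "v \<in> unit_l2" "w \<in> unit_l2"
  shows "(\<lambda>n. \<alpha> * v n + \<beta> * w n) \<in> unit_l2"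
proof (rule l2_leI(1))
  have s: "l2_le v (unit_norm v)" "l2_le w (unit_norm w)" using assms by (auto intro: l2_leD)
  show "l2_le (\<lambda>n. \<alpha> * v n + \<beta> * w n) (cmod \<alpha> * unit_norm v + cmod \<beta> * unit_norm w)"
    unfolding l2_le_def
  proof (intro allI impI)
    fix F :: "int set" assume F: "finite F"
    have "L2_set (\<lambda>n. cmod (\<alpha> * v n + \<beta> * w n)) F \<le> L2_set (\<lambda>n. cmod \<alpha> * cmod (v n) + cmod \<beta> * cmod (w n)) F"
      by (intro L2_set_mono) (auto simp: norm_mult[symmetric] norm_triangle_ineq)
    also have "\<dots> \<le> L2_set (\<lambda>n. cmod \<alpha> * cmod (v n)) F + L2_set (\<lambda>n. cmod \<beta> * cmod (w n)) F"
      by (rule L2_set_triangle_ineq)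
    also have "\<dots> = cmod \<alpha> * L2_set (\<lambda>n. cmod (v n)) F + cmod \<beta> * L2_set (\<lambda>n. cmod (w n)) F"
      by (simp add: L2_set_right_distrib)
    also have "\<dots> \<le> cmod \<alpha> * unit_norm v + cmod \<beta> * unit_norm w"
      using s F by (intro add_mono mult_left_mono) (auto simp: l2_le_def)
    finally show "L2_set (\<lambda>n. cmod (\<alpha> * v n + \<beta> * w n)) F \<le> cmod \<alpha> * unit_norm v + cmod \<beta> * unit_norm w" .
  qed
qed

lemma l2_bounded_sum:
  assumes A: "l2_bounded (\<lambda>_. 1) m' A" and "finite J" "J \<noteq> {}" "\<And>j. j \<in> J \<Longrightarrow> v j \<in> unit_l2"
  shows "(\<lambda>n. \<Sum>j\<in>J. c j * v j n) \<in> unit_l2 \<and>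
     A (\<lambda>n. \<Sum>j\<in>J. c j * v j n) = (\<lambda>n. \<Sum>j\<in>J. c j * A (v j) n)"
  using assms(2,3,4)
proof (induction rule: finite_ne_induct)
  have lin: "A (\<lambda>n. \<alpha> * v n + \<beta> * w n) = (\<lambda>n. \<alpha> * A v n + \<beta> * A w n)" if "v \<in> unit_l2" "w \<in> unit_l2" for v w \<alpha> \<beta>
    using A that unfolding l2_bounded_def by blast
  {
    case (singleton x)
    then show ?case using lin[of "v x" "v x" "c x" 0] unit_l2_combination[of "v x" "v x" "c x" 0] by simp
  next
    case (insert x F)
    let ?u = "\<lambda>n. \<Sum>j\<in>F. c j * v j n"
    have IH: "?u \<in> unit_l2" "A ?u = (\<lambda>n. \<Sum>j\<in>F. c j * A (v j) n)"
      using insert by auto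
    show ?case using lin[of "v x" ?u "c x" 1] unit_l2_combination[of "v x" ?u "c x" 1] IH insert
      by (simp add: insert.hyps)
  }
qed

text \<open>
  The columns are the images of the unit vectors under the inverse. The second equation comes from
  applying the inverse to the image of a unit vector, which is a finite combination of unit vectors.
\<close>

lemma invertible_imp_matrix:
  assumes inv: "l2_invertible (\<lambda>_. 1) (\<lambda>_. 1) (band K a)" and K: "finite K"
  shows "\<exists>B. (\<forall>n m. (\<Sum>k\<in>K. a n k * B (n + k) m) = of_bool (n = m)) \<and>
     (\<forall>n m. (\<Sum>k\<in>K. B n (m - k) * a (m - k) k) = of_bool (n = m)) \<and>
     (\<forall>m. \<exists>W. \<forall>n. cmod (B n m) \<le> W)"
proof -
  obtain R where BA: "\<And>w. w\<in>unit_l2 \<Longrightarrow> R (band K a w) = w" and AB: "\<And>w. w\<in>unit_l2 \<Longrightarrow> band K a (R w) = w"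
    and R: "l2_bounded (\<lambda>_. 1) (\<lambda>_. 1) R"
    using inv unfolding l2_invertible_def by metis
  define e :: "int \<Rightarrow> int \<Rightarrow> complex" where "e = (\<lambda>m n. of_bool (n = m))"
  have e: "e m \<in> unit_l2" for m unfolding e_def by (rule unit_vector_l2)
  have "K \<noteq> {}"
  proof
    assume "K = {}"
    then have "band K a (R (e 0)) 0 = 0" by (simp add: band_def)
    then show False using AB[OF e[of 0]] by (simp add: e_def)
  qed
  define B where "B = (\<lambda>n m. R (e m) n)"
  have "(\<Sum>k\<in>K. a n k * B (n + k) m) = of_bool (n = m)" for n m
    using fun_cong[OF AB[OF e], of m n] by (simp add: band_def B_def e_def)
  moreover have "(\<Sum>k\<in>K. B n (m - k) * a (m - k) k) = of_bool (n = m)" for n m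
  proof -
    have "band K a (e m) = (\<lambda>n. \<Sum>k\<in>K. a (m - k) k * e (m - k) n)"
      unfolding band_def e_def by (intro ext sum.cong) (auto simp: of_bool_def algebra_simps)
    then have "R (band K a (e m)) = (\<lambda>n. \<Sum>k\<in>K. a (m - k) k * R (e (m - k)) n)"
      using l2_bounded_sum[OF R K \<open>K \<noteq> {}\<close>, of "\<lambda>k. e (m - k)" "\<lambda>k. a (m - k) k"] e by simp
    then show ?thesis using fun_cong[OF BA[OF e[of m]], of n] by (simp add: B_def e_def mult.commute)
  qed
  moreover have "\<exists>W. \<forall>n. cmod (B n m) \<le> W" for m
  proof -
    have "R (e m) \<in> unit_l2" using R e unfolding l2_bounded_def by blast
    then show ?thesis using l2_le_bound[OF l2_leD] unfolding B_def by blast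
  qed
  ultimately show ?thesis by blast
qed

subsection \<open>Uniform estimates by compactness\<close>

definition shift_compact :: "int set \<Rightarrow> (int \<Rightarrow> int \<Rightarrow> complex) set \<Rightarrow> bool" where
  "shift_compact K \<F> \<longleftrightarrow> (\<forall>a\<in>\<F>. \<forall>j. (\<lambda>n. a (n + j)) \<in> \<F>) \<and>
     (\<forall>f :: nat \<Rightarrow> int \<Rightarrow> int \<Rightarrow> complex. (\<forall>j. f j \<in> \<F>) \<longrightarrow>
        (\<exists>r a. strict_mono r \<and> a \<in> \<F> \<and> (\<forall>n. \<forall>k\<in>K. (\<lambda>j. f (r j) n k) \<longlonglongrightarrow> a n k)))"

lemma shift_compactD:
  assumes "shift_compact K \<F>"
  shows "a \<in> \<F> \<Longrightarrow> (\<lambda>n. a (n + j)) \<in> \<F>"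
    and "(\<And>j. f j \<in> \<F>) \<Longrightarrow> \<exists>r a. strict_mono (r :: nat \<Rightarrow> nat) \<and> a \<in> \<F> \<and> (\<forall>n. \<forall>k\<in>K. (\<lambda>j. f (r j) n k) \<longlonglongrightarrow> a n k)"
  using assms unfolding shift_compact_def by blast+

text \<open>
  Favard's argument. If the bound failed, there would be sequences of supremum one whose images tend
  to zero. Translated so that they are at least \<open>1/2\<close> at the origin, they have a pointwise convergent
  subsequence, and the limit is a nonzero bounded solution for the limit of the translated operators.
\<close>

lemma uniform_lower_bound:
  fixes \<F> :: "(int \<Rightarrow> int \<Rightarrow> complex) set"
  assumes K: "finite K"
    and \<F>: "shift_compact K \<F>"
    and inj: "\<And>a w W. a \<in> \<F> \<Longrightarrow> \<forall>n. cmod (w n) \<le> W \<Longrightarrow> \<forall>n. band K a w n = 0 \<Longrightarrow> \<forall>n. w n = 0"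
  shows "\<exists>c>0. \<forall>a\<in>\<F>. \<forall>w W \<epsilon>. (\<forall>n. cmod (w n) \<le> W) \<longrightarrow> (\<forall>n. cmod (band K a w n) \<le> \<epsilon>) \<longrightarrow>
     (\<forall>n. c * cmod (w n) \<le> \<epsilon>)"
proof (rule ccontr)
  assume neg: "\<not> ?thesis"
  have "\<exists>a u. a \<in> \<F> \<and> (\<forall>n. cmod (u n) \<le> 1) \<and> cmod (u 0) \<ge> 1 / 2 \<and>
     (\<forall>n. cmod (band K a u n) \<le> 1 / (real j + 1))" for j :: nat
  proof -
    let ?c = "1 / (real j + 1)"
    have "?c > 0" by simp
    then have "\<not> (\<forall>a\<in>\<F>. \<forall>w W \<epsilon>. (\<forall>n. cmod (w n) \<le> W) \<longrightarrow> (\<forall>n. cmod (band K a w n) \<le> \<epsilon>) \<longrightarrow>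
        (\<forall>n. ?c * cmod (w n) \<le> \<epsilon>))"
      using neg by blast
    then obtain a w W \<epsilon> n where a: "a \<in> \<F>" and w: "\<And>n. cmod (w n) \<le> W"
      and \<epsilon>: "\<And>n. cmod (band K a w n) \<le> \<epsilon>" and n': "\<not> ?c * cmod (w n) \<le> \<epsilon>"
      by blast
    from n' have n: "\<epsilon> < ?c * cmod (w n)" by (rule not_le_imp_less)
    define s where "s = (SUP n. cmod (w n))"
    have bdd: "bdd_above (range (\<lambda>n. cmod (w n)))" using w by (auto intro!: bdd_aboveI)
    have le: "cmod (w n) \<le> s" for n unfolding s_def by (rule cSUP_upper[OF _ bdd]) simp
    have "0 \<le> \<epsilon>" using \<epsilon>[of 0] norm_ge_zero order_trans by blast
    then have "0 < ?c * cmod (w n)" using n by linarith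
    then have "0 < cmod (w n)" by (cases "w n = 0") auto
    then have s: "s > 0" using le[of n] by linarith
    have "?c * cmod (w n) \<le> ?c * s" using le[of n] by (intro mult_left_mono) auto
    then have \<epsilon>s: "\<epsilon> \<le> ?c * s" using n by linarith
    have "s / 2 < s" using s by simp
    then obtain i where i: "s / 2 < cmod (w i)"
      using less_cSUP_iff[OF _ bdd, of "s / 2"] by (auto simp flip: s_def)
    define u where "u = (\<lambda>n. w (n + i) / of_real s)"
    have "band K (\<lambda>n. a (n + i)) u n = band K a w (n + i) / of_real s" for n
      unfolding band_def u_def sum_divide_distrib
      by (intro sum.cong) (auto simp: algebra_simps)
    moreover have "cmod (band K a w (n + i)) \<le> ?c * s" for n
      using \<epsilon>[of "n + i"] \<epsilon>s by linarith
    ultimately have "cmod (band K (\<lambda>n. a (n + i)) u n) \<le> ?c" for n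
      using s by (simp add: norm_divide divide_le_eq)
    moreover have "cmod (u n) \<le> 1" for n
      using le[of "n + i"] s by (simp add: u_def norm_divide divide_le_eq)
    moreover have "cmod (u 0) \<ge> 1 / 2"
      using i s by (simp add: u_def norm_divide field_simps)
    ultimately show ?thesis using shift_compactD(1)[OF \<F>, OF a, of i] by blast
  qed
  then obtain a u where a: "\<And>j. a j \<in> \<F>" and u1: "\<And>j n. cmod (u j n) \<le> 1"
    and u0: "\<And>j. cmod (u j 0) \<ge> 1 / 2" and Au: "\<And>j n. cmod (band K (a j) (u j) n) \<le> 1 / (real j + 1)"
    by metis
  obtain r b where r: "strict_mono r" and b: "b \<in> \<F>" and lim: "\<And>n k. k \<in> K \<Longrightarrow> (\<lambda>j. a (r j) n k) \<longlonglongrightarrow> b n k"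
    using shift_compactD(2)[OF \<F>, of a, OF a] by blast
  obtain q where q: "strict_mono (q :: nat \<Rightarrow> nat)" and "\<And>n. \<exists>l. (\<lambda>j. u (r (q j)) n) \<longlonglongrightarrow> l"
    using function_convergent_subsequence[of UNIV "\<lambda>j. u (r j)" 1] u1 by auto
  then obtain l where l: "\<And>n. (\<lambda>j. u (r (q j)) n) \<longlonglongrightarrow> l n" by metis
  have rq: "strict_mono (\<lambda>j. r (q j))" using r q by (simp add: strict_mono_def)
  have "\<forall>n. l n = 0"
  proof (rule inj[OF b]; intro allI)
    show "cmod (l n) \<le> 1" for n
      by (rule tendsto_upperbound[OF tendsto_norm[OF l]]) (auto simp: u1)
    fix n
    have "(\<lambda>j. band K (a (r (q j))) (u (r (q j))) n) \<longlonglongrightarrow> band K b l n"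
      unfolding band_def
      by (intro tendsto_sum tendsto_mult l LIMSEQ_subseq_LIMSEQ[OF lim q, unfolded o_def])
    moreover have "(\<lambda>j. band K (a (r (q j))) (u (r (q j))) n) \<longlonglongrightarrow> 0"
    proof (rule Lim_null_comparison)
      have "(\<lambda>j. 1 / (real j + 1)) \<longlonglongrightarrow> 0"
        using LIMSEQ_inverse_real_of_nat by (simp add: inverse_eq_divide add.commute)
      from LIMSEQ_subseq_LIMSEQ[OF this rq] show "(\<lambda>j. 1 / (real (r (q j)) + 1)) \<longlonglongrightarrow> 0"
        by (simp add: o_def)
    qed (use Au in auto)
    ultimately show "band K b l n = 0" by (rule LIMSEQ_unique)
  qed
  then have "l 0 = 0" by blast
  moreover have "1 / 2 \<le> cmod (l 0)"
    by (rule tendsto_lowerbound[OF tendsto_norm[OF l] always_eventually[OF allI[OF u0]]]) simp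
  ultimately show False by simp
qed

lemma uniform_coeff_bound:
  fixes \<F> :: "(int \<Rightarrow> int \<Rightarrow> complex) set"
  assumes K: "finite K"
    and \<F>: "shift_compact K \<F>"
  shows "\<exists>M. \<forall>a\<in>\<F>. \<forall>n. \<forall>k\<in>K. cmod (a n k) \<le> M"
proof -
  have "\<exists>M. \<forall>a\<in>\<F>. cmod (a 0 k) \<le> M" if k: "k \<in> K" for k
  proof (rule ccontr)
    assume "\<not> ?thesis"
    then have "\<forall>j::nat. \<exists>a\<in>\<F>. cmod (a 0 k) > real j" by (meson not_le)
    then obtain f where f: "\<And>j::nat. f j \<in> \<F>" and big: "\<And>j. cmod (f j 0 k) > real j" by metis
    obtain r and a :: "int \<Rightarrow> int \<Rightarrow> complex" where r: "strict_mono r" and lim: "(\<lambda>j. f (r j) 0 k) \<longlonglongrightarrow> a 0 k"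
      using shift_compactD(2)[OF \<F>, of f, OF f] k by blast
    have "Bseq (\<lambda>j. f (r j) 0 k)" using lim convergentI convergent_imp_Bseq by blast
    then obtain C where C: "\<And>j. cmod (f (r j) 0 k) \<le> C" by (auto simp: Bseq_def)
    obtain j :: nat where "C < real j" using reals_Archimedean2 by blast
    moreover have "real j \<le> real (r j)" using seq_suble[OF r, of j] by simp
    ultimately show False using big[of "r j"] C[of j] by linarith
  qed
  then obtain M where M: "\<And>k a. k \<in> K \<Longrightarrow> a \<in> \<F> \<Longrightarrow> cmod (a 0 k) \<le> M k" by metis
  have "cmod (a n k) \<le> (\<Sum>k\<in>K. \<bar>M k\<bar>)" if "a \<in> \<F>" "k \<in> K" for a n k
  proof -
    have "cmod (a n k) \<le> M k" using M[OF that(2) shift_compactD(1)[OF \<F>, OF that(1), of n]] by simp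
    also have "\<dots> \<le> \<bar>M k\<bar>" by simp
    also have "\<dots> \<le> (\<Sum>k\<in>K. \<bar>M k\<bar>)" using K that by (intro member_le_sum) auto
    finally show ?thesis .
  qed
  then show ?thesis by blast
qed

text \<open>
  The lower bound controls the supremum of a column multiplied by \<open>exp (\<gamma> * |n - m|)\<close>: its image is the
  unit vector, on which the weight is one, plus a commutator that the lower bound absorbs when \<open>\<gamma>\<close> is
  small. As \<open>\<gamma>\<close> depends only on the lower bound and the coefficient bound, it serves all members.
\<close>

lemma uniform_green:
  fixes \<F> :: "(int \<Rightarrow> int \<Rightarrow> complex) set"
  assumes K: "finite K"
    and \<F>: "shift_compact K \<F>"
    and inv: "\<And>a. a \<in> \<F> \<Longrightarrow> l2_invertible (\<lambda>_. 1) (\<lambda>_. 1) (band K a)"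
  shows "\<exists>C \<gamma>. \<gamma> > 0 \<and> (\<forall>a\<in>\<F>. \<exists>B. green K C \<gamma> a B)"
proof -
  obtain M where M: "\<And>a n k. a \<in> \<F> \<Longrightarrow> k \<in> K \<Longrightarrow> cmod (a n k) \<le> M"
    using uniform_coeff_bound[OF K \<F>] by blast
  have inj: "\<forall>n. w n = 0" if "a \<in> \<F>" "\<forall>n. cmod (w n) \<le> W" "\<forall>n. band K a w n = 0" for a w W
    using invertible_imp_injective_bounded[OF inv[OF that(1)] K M[OF that(1)], of w W] that by blast
  have "\<exists>c>0. \<forall>a\<in>\<F>. \<forall>w W \<epsilon>. (\<forall>n. cmod (w n) \<le> W) \<longrightarrow> (\<forall>n. cmod (band K a w n) \<le> \<epsilon>) \<longrightarrow>
     (\<forall>n. c * cmod (w n) \<le> \<epsilon>)"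
    using inj by (intro uniform_lower_bound[OF K \<F>]) metis
  then obtain c where c: "c > 0" and lower: "\<And>a w W \<epsilon> n. a \<in> \<F> \<Longrightarrow> (\<And>n. cmod (w n) \<le> W) \<Longrightarrow>
     (\<And>n. cmod (band K a w n) \<le> \<epsilon>) \<Longrightarrow> c * cmod (w n) \<le> \<epsilon>"
    by blast
  let ?M = "\<bar>M\<bar>"
  obtain \<gamma> where \<gamma>: "\<gamma> > 0" and tilt: "(\<Sum>k\<in>K. ?M * (exp (\<gamma> * \<bar>real_of_int k\<bar>) - 1)) < c / 2"
    using small_tilt_exists[of "c / 2"] c by force
  \<comment> \<open>The number \<open>2 / c\<close> is the largest \<open>s\<close> with \<open>c * s \<le> 1 + (c / 2) * s\<close>, where \<open>s\<close> is the supremum in question.\<close>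
  have "\<exists>B. green K (2 / c) \<gamma> a B" if a: "a \<in> \<F>" for a
  proof -
    obtain B where AB: "\<And>n m. (\<Sum>k\<in>K. a n k * B (n + k) m) = of_bool (n = m)"
      and BA: "\<And>n m. (\<Sum>k\<in>K. B n (m - k) * a (m - k) k) = of_bool (n = m)"
      and Bb: "\<And>m. \<exists>W. \<forall>n. cmod (B n m) \<le> W"
      using invertible_imp_matrix[OF inv[OF a] K] by blast
    have "cmod (B n m) \<le> 2 / c * exp (- \<gamma> * \<bar>real_of_int (n - m)\<bar>)" for n m
    proof -
      \<comment> \<open>The exponent is capped at \<open>R\<close>, so that the weighted column is bounded a priori.\<close>
      define R where "R = \<bar>real_of_int (n - m)\<bar>"
      define \<phi> where "\<phi> = (\<lambda>i. \<gamma> * min \<bar>real_of_int (i - m)\<bar> R)"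
      define u where "u = (\<lambda>i. of_real (exp (\<phi> i)) * B i m)"
      obtain W where W: "\<And>i. cmod (B i m) \<le> W" using Bb by blast
      have ub: "cmod (u i) \<le> exp (\<gamma> * R) * W" for i
        unfolding u_def norm_mult
        by (intro mult_mono W) (use \<gamma> in \<open>auto simp: \<phi>_def intro!: mult_left_mono\<close>)
      define s where "s = (SUP i. cmod (u i))"
      have bdd: "bdd_above (range (\<lambda>i. cmod (u i)))" using ub by (auto intro!: bdd_aboveI)
      have us: "cmod (u i) \<le> s" for i unfolding s_def by (rule cSUP_upper[OF _ bdd]) simp
      have s0: "0 \<le> s" using us[of 0] norm_ge_zero order_trans by blast
      have \<phi>: "\<bar>\<phi> (i + k) - \<phi> i\<bar> \<le> \<gamma> * \<bar>real_of_int k\<bar>" for i k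
      proof -
        have "\<bar>\<phi> (i + k) - \<phi> i\<bar> = \<gamma> * \<bar>min \<bar>real_of_int (i + k - m)\<bar> R - min \<bar>real_of_int (i - m)\<bar> R\<bar>"
          unfolding \<phi>_def right_diff_distrib[symmetric] abs_mult using \<gamma> by simp
        also have "\<dots> \<le> \<gamma> * \<bar>real_of_int k\<bar>"
          using \<gamma> by (intro mult_left_mono) (auto simp: min_def abs_if)
        finally show ?thesis .
      qed
      have "cmod (band K a u i) \<le> 1 + c / 2 * s" for i
      proof -
        have "cmod (band K a u i - of_real (exp (\<phi> i)) * band K a (\<lambda>i. B i m) i)
           \<le> (\<Sum>k\<in>K. ?M * (exp (\<gamma> * \<bar>real_of_int k\<bar>) - 1) * cmod (u (i + k)))"
          unfolding u_def
          by (intro band_tilt \<phi> order_trans[OF M[OF a] abs_ge_self])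
        also have "\<dots> \<le> (\<Sum>k\<in>K. ?M * (exp (\<gamma> * \<bar>real_of_int k\<bar>) - 1) * s)"
          using us \<gamma> by (intro sum_mono mult_left_mono) auto
        also have "\<dots> = (\<Sum>k\<in>K. ?M * (exp (\<gamma> * \<bar>real_of_int k\<bar>) - 1)) * s"
          by (simp add: sum_distrib_right)
        also have "\<dots> \<le> c / 2 * s" using tilt s0 by (intro mult_right_mono) auto
        finally have 1: "cmod (band K a u i - of_real (exp (\<phi> i)) * band K a (\<lambda>i. B i m) i) \<le> c / 2 * s" .
        have "band K a (\<lambda>i. B i m) i = of_bool (i = m)" using AB by (simp add: band_def)
        moreover have "m = i \<Longrightarrow> \<phi> i = 0" by (simp add: \<phi>_def R_def)
        ultimately have "cmod (of_real (exp (\<phi> i)) * band K a (\<lambda>i. B i m) i) \<le> 1" by (cases "i = m") auto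
        then show ?thesis
          using 1 norm_triangle_sub[of "band K a u i" "of_real (exp (\<phi> i)) * band K a (\<lambda>i. B i m) i"] by linarith
      qed
      then have "c * cmod (u i) \<le> 1 + c / 2 * s" for i
        by (rule lower[OF a ub])
      then have "cmod (u i) \<le> (1 + c / 2 * s) / c" for i
        using c by (simp add: field_simps)
      then have "s \<le> (1 + c / 2 * s) / c" unfolding s_def by (intro cSUP_least) auto
      then have "s \<le> 2 / c" using c by (simp add: field_simps)
      then have "cmod (u n) \<le> 2 / c" using us[of n] by linarith
      then have "exp (\<gamma> * R) * cmod (B n m) \<le> 2 / c"
        by (simp add: u_def norm_mult \<phi>_def R_def)
      then have "cmod (B n m) \<le> 2 / c / exp (\<gamma> * R)" by (simp only: pos_le_divide_eq[OF exp_gt_zero] mult.commute)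
      then show ?thesis by (simp add: R_def exp_minus divide_inverse)
    qed
    then have "green K (2 / c) \<gamma> a B" unfolding green_def using AB BA by blast
    then show ?thesis by (intro exI[of _ B])
  qed
  then show ?thesis using \<gamma> by blast
qed

subsection \<open>Inverse matrices under limits and tilts\<close>

lemma green_mono:
  assumes "green K C \<gamma> a B" "C \<le> C'" "\<gamma>' \<le> \<gamma>" "0 \<le> C"
  shows "green K C' \<gamma>' a B"
proof -
  have "C * exp (- \<gamma> * \<bar>real_of_int (n - m)\<bar>) \<le> C' * exp (- \<gamma>' * \<bar>real_of_int (n - m)\<bar>)" for n m
    using assms by (intro mult_mono) (auto intro: mult_right_mono)
  then show ?thesis using assms(1) unfolding green_def by (meson order_trans)
qed

lemma green_const_nonneg: "green K C \<gamma> a B \<Longrightarrow> 0 \<le> C"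
  unfolding green_def
  by (elim conjE allE[of _ 0]) (auto intro: order_trans[OF norm_ge_zero])

text \<open>
  The entries of the inverse matrices are bounded, so a diagonal subsequence converges.
\<close>

lemma green_limit:
  assumes K: "finite K" and \<gamma>: "\<gamma> > 0" and g: "\<And>j::nat. \<exists>B. green K C \<gamma> (f j) B"
    and lim: "\<And>n k. k \<in> K \<Longrightarrow> (\<lambda>j. f j n k) \<longlonglongrightarrow> a n k"
  shows "\<exists>B. green K C \<gamma> a B"
proof -
  obtain B where B: "\<And>j. green K C \<gamma> (f j) (B j)" using g by metis
  have C: "C \<ge> 0" using B green_const_nonneg by blast
  have bd: "cmod (B j n m) \<le> C * exp (- \<gamma> * \<bar>real_of_int (n - m)\<bar>)" for j n m
    using B unfolding green_def by blast
  have "cmod (B j n m) \<le> C" for j n m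
  proof -
    have "C * exp (- \<gamma> * \<bar>real_of_int (n - m)\<bar>) \<le> C * 1" using C \<gamma> by (intro mult_left_mono) auto
    then show ?thesis using bd[of j n m] by linarith
  qed
  note BC = this
  define F where "F = (\<lambda>j x. B j (fst x) (snd x))"
  have "\<exists>q :: nat \<Rightarrow> nat. strict_mono q \<and> (\<forall>x. \<exists>l. (\<lambda>j. F (q j) x) \<longlonglongrightarrow> l)"
  proof (rule function_convergent_subsequence[of UNIV F C])
    show "norm (F j x) \<le> C" for j x by (simp add: F_def BC)
    fix k :: "nat \<Rightarrow> nat" assume "strict_mono k" "\<And>x. x \<in> UNIV \<Longrightarrow> \<exists>l. (\<lambda>j. F (k j) x) \<longlonglongrightarrow> l"
    then show ?thesis by (intro exI[of _ k]) simp
  qed simp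
  then obtain q :: "nat \<Rightarrow> nat" where q: "strict_mono q" and ql: "\<And>x. \<exists>l. (\<lambda>j. F (q j) x) \<longlonglongrightarrow> l"
    by metis
  have "\<exists>l. (\<lambda>j. B (q j) n m) \<longlonglongrightarrow> l" for n m
    using ql[of "(n, m)"] by (simp add: F_def)
  then obtain L where L: "\<And>n m. (\<lambda>j. B (q j) n m) \<longlonglongrightarrow> L n m" by metis
  have f: "k \<in> K \<Longrightarrow> (\<lambda>j. f (q j) n k) \<longlonglongrightarrow> a n k" for n k
    using LIMSEQ_subseq_LIMSEQ[OF lim q] by (simp add: o_def)
  have "green K C \<gamma> a L"
    unfolding green_def
  proof (intro conjI allI)
    fix n m
    have "(\<lambda>j. \<Sum>k\<in>K. f (q j) n k * B (q j) (n + k) m) \<longlonglongrightarrow> (\<Sum>k\<in>K. a n k * L (n + k) m)"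
      by (intro tendsto_intros f L)
    moreover have "(\<Sum>k\<in>K. f (q j) n k * B (q j) (n + k) m) = of_bool (n = m)" for j
      using B unfolding green_def by blast
    ultimately show "(\<Sum>k\<in>K. a n k * L (n + k) m) = of_bool (n = m)"
      by (simp add: LIMSEQ_const_iff)
    have "(\<lambda>j. \<Sum>k\<in>K. B (q j) n (m - k) * f (q j) (m - k) k) \<longlonglongrightarrow> (\<Sum>k\<in>K. L n (m - k) * a (m - k) k)"
      by (intro tendsto_intros f L)
    moreover have "(\<Sum>k\<in>K. B (q j) n (m - k) * f (q j) (m - k) k) = of_bool (n = m)" for j
      using B unfolding green_def by blast
    ultimately show "(\<Sum>k\<in>K. L n (m - k) * a (m - k) k) = of_bool (n = m)"
      by (simp add: LIMSEQ_const_iff)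
    show "cmod (L n m) \<le> C * exp (- \<gamma> * \<bar>real_of_int (n - m)\<bar>)"
      by (rule tendsto_upperbound[OF tendsto_norm[OF L] always_eventually[OF allI[OF bd]]]) simp
  qed
  then show ?thesis by (intro exI[of _ L])
qed

text \<open>
  Conjugation by the multiplication with \<open>exp \<phi>\<close>.
\<close>

definition tilt :: "(int \<Rightarrow> real) \<Rightarrow> (int \<Rightarrow> int \<Rightarrow> complex) \<Rightarrow> int \<Rightarrow> int \<Rightarrow> complex" where
  "tilt \<phi> a n k = a n k * of_real (exp (\<phi> n - \<phi> (n + k)))"

lemma tilt_green:
  assumes g: "green K C \<gamma> a B"
    and bd: "\<And>n m. cmod (B n m) * exp (\<phi> n - \<phi> m) \<le> C' * exp (- \<gamma>' * \<bar>real_of_int (n - m)\<bar>)"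
  shows "green K C' \<gamma>' (tilt \<phi> a) (\<lambda>n m. B n m * of_real (exp (\<phi> n - \<phi> m)))"
  unfolding green_def
proof (intro conjI allI)
  fix n m
  have "(\<Sum>k\<in>K. tilt \<phi> a n k * (B (n + k) m * of_real (exp (\<phi> (n + k) - \<phi> m))))
     = (\<Sum>k\<in>K. a n k * B (n + k) m) * of_real (exp (\<phi> n - \<phi> m))"
    unfolding sum_distrib_right tilt_def
    by (intro sum.cong refl) (simp add: exp_diff field_simps)
  also have "\<dots> = of_bool (n = m)" using g unfolding green_def by auto
  finally show "(\<Sum>k\<in>K. tilt \<phi> a n k * (B (n + k) m * of_real (exp (\<phi> (n + k) - \<phi> m)))) = of_bool (n = m)" .
  have "(\<Sum>k\<in>K. B n (m - k) * of_real (exp (\<phi> n - \<phi> (m - k))) * tilt \<phi> a (m - k) k)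
     = (\<Sum>k\<in>K. B n (m - k) * a (m - k) k) * of_real (exp (\<phi> n - \<phi> m))"
    unfolding sum_distrib_right tilt_def
    by (intro sum.cong refl) (simp add: exp_diff field_simps)
  also have "\<dots> = of_bool (n = m)" using g unfolding green_def by auto
  finally show "(\<Sum>k\<in>K. B n (m - k) * of_real (exp (\<phi> n - \<phi> (m - k))) * tilt \<phi> a (m - k) k) = of_bool (n = m)" .
  show "cmod (B n m * of_real (exp (\<phi> n - \<phi> m))) \<le> C' * exp (- \<gamma>' * \<bar>real_of_int (n - m)\<bar>)"
    using bd by (simp add: norm_mult)
qed

subsection \<open>Action of an inverse matrix on bounded and on square-summable sequences\<close>

lemma has_sum_finite_sum:
  fixes f :: "'a \<Rightarrow> 'b \<Rightarrow> complex"
  assumes "finite K" "\<And>k. k \<in> K \<Longrightarrow> (f k has_sum s k) A"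
  shows "((\<lambda>m. \<Sum>k\<in>K. f k m) has_sum (\<Sum>k\<in>K. s k)) A"
  using assms by (induction rule: finite_induct) (auto intro!: has_sum_add)

lemma delta_has_sum: "((\<lambda>m. of_bool (n = m) * w m :: complex) has_sum w n) UNIV"
proof -
  have "((\<lambda>m. of_bool (n = m) * w m) has_sum w n) {n}"
    using has_sum_finite[of "{n}" "\<lambda>m. of_bool (n = m) * w m"] by simp
  then show ?thesis by (subst has_sum_cong_neutral[where T="{n}" and g="\<lambda>m. of_bool (n = m) * w m"]) auto
qed

definition mat_apply :: "(int \<Rightarrow> int \<Rightarrow> complex) \<Rightarrow> (int \<Rightarrow> complex) \<Rightarrow> int \<Rightarrow> complex" where
  "mat_apply B w n = (\<Sum>\<^sub>\<infinity>m. B n m * w m)"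

lemma mat_apply_has_sum:
  assumes B: "green K C \<gamma> a B" and \<gamma>: "\<gamma> > 0" and w: "\<And>n. cmod (w n) \<le> W"
  shows "((\<lambda>m. B n m * w m) has_sum mat_apply B w n) UNIV"
proof -
  have "(\<lambda>m. C * W * exp (- \<gamma> * \<bar>real_of_int (n - m)\<bar>)) summable_on UNIV"
    by (intro summable_on_cmult_right exp_decay_summable \<gamma>)
  moreover have "cmod (B n m * w m) \<le> C * W * exp (- \<gamma> * \<bar>real_of_int (n - m)\<bar>)" for m
  proof -
    have "cmod (B n m) * cmod (w m) \<le> (C * exp (- \<gamma> * \<bar>real_of_int (n - m)\<bar>)) * W"
      using B w green_const_nonneg[OF B] by (intro mult_mono) (auto simp: green_def)
    then show ?thesis by (simp add: norm_mult algebra_simps)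
  qed
  ultimately have "(\<lambda>m. cmod (B n m * w m)) summable_on UNIV"
    by (rule summable_on_comparison_test) auto
  then show ?thesis unfolding mat_apply_def by (rule has_sum_infsum[OF abs_summable_summable])
qed

text \<open>
  Exponential decay lets the matrix act on bounded sequences and justifies the rearrangement of the
  double sum, so that the algebraic left inverse is a left inverse on bounded sequences.
\<close>

lemma mat_apply_band:
  assumes K: "finite K" and B: "green K C \<gamma> a B" and \<gamma>: "\<gamma> > 0"
    and a: "\<And>n k. k \<in> K \<Longrightarrow> cmod (a n k) \<le> M" and w: "\<And>n. cmod (w n) \<le> W"
  shows "mat_apply B (band K a w) = w"
proof
  fix n
  have s': "((\<lambda>m. B n m * (a m k * w (m + k))) has_sum mat_apply B (\<lambda>m. a m k * w (m + k)) n) UNIV"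
    if k: "k \<in> K" for k
  proof -
    have "cmod (a m k * w (m + k)) \<le> M * W" for m
      unfolding norm_mult by (intro mult_mono a w k) (auto intro: order_trans[OF norm_ge_zero a[OF k]])
    from mat_apply_has_sum[OF B \<gamma> this] show ?thesis .
  qed
  have s: "((\<lambda>m. B n (m - k) * a (m - k) k * w m) has_sum mat_apply B (\<lambda>m. a m k * w (m + k)) n) UNIV"
    if k: "k \<in> K" for k
  proof -
    have "((\<lambda>m. B n (m - k) * (a (m - k) k * w (m - k + k))) has_sum mat_apply B (\<lambda>m. a m k * w (m + k)) n) UNIV"
      using s'[OF k]
      by (subst has_sum_reindex_bij_betw[of "\<lambda>m. m - k" UNIV UNIV "\<lambda>m. B n m * (a m k * w (m + k))"])
         (auto intro!: bij_betwI[where g="\<lambda>m. m + k"])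
    then show ?thesis by (simp add: mult.assoc)
  qed
  let ?S = "\<Sum>k\<in>K. mat_apply B (\<lambda>m. a m k * w (m + k)) n"
  have "((\<lambda>m. \<Sum>k\<in>K. B n m * (a m k * w (m + k))) has_sum ?S) UNIV"
    by (intro has_sum_finite_sum K s')
  then have 1: "mat_apply B (band K a w) n = ?S"
    unfolding mat_apply_def band_def by (simp add: sum_distrib_left infsumI)
  have "((\<lambda>m. \<Sum>k\<in>K. B n (m - k) * a (m - k) k * w m) has_sum ?S) UNIV"
    by (intro has_sum_finite_sum K s)
  moreover have "(\<Sum>k\<in>K. B n (m - k) * a (m - k) k * w m) = of_bool (n = m) * w m" for m
    unfolding sum_distrib_right[symmetric] using B by (simp add: green_def)
  ultimately have "((\<lambda>m. of_bool (n = m) * w m) has_sum ?S) UNIV" by simp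
  then show "mat_apply B (band K a w) n = w n" using 1 has_sum_unique[OF _ delta_has_sum] by metis
qed

lemma band_mat_apply:
  assumes K: "finite K" and B: "green K C \<gamma> a B" and \<gamma>: "\<gamma> > 0" and w: "\<And>n. cmod (w n) \<le> W"
  shows "band K a (mat_apply B w) = w"
proof
  fix n
  have "((\<lambda>m. \<Sum>k\<in>K. a n k * (B (n + k) m * w m)) has_sum (\<Sum>k\<in>K. a n k * mat_apply B w (n + k))) UNIV"
    by (intro has_sum_finite_sum K has_sum_cmult_right mat_apply_has_sum[OF B \<gamma> w])
  moreover have "(\<Sum>k\<in>K. a n k * (B (n + k) m * w m)) = of_bool (n = m) * w m" for m
    unfolding mult.assoc[symmetric] sum_distrib_right[symmetric] using B by (simp add: green_def)
  ultimately have "((\<lambda>m. of_bool (n = m) * w m) has_sum band K a (mat_apply B w) n) UNIV" by (simp add: band_def)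
  then show "band K a (mat_apply B w) n = w n" using has_sum_unique[OF _ delta_has_sum] by metis
qed

lemma green_unique:
  assumes K: "finite K" and B: "green K C \<gamma> a B" and \<gamma>: "\<gamma> > 0"
    and a: "\<And>n k. k \<in> K \<Longrightarrow> cmod (a n k) \<le> M" and w: "\<And>n. cmod (w n) \<le> W"
    and eq: "\<And>n. band K a w n = of_bool (n = m)"
  shows "w n = B n m"
proof -
  have "w n = mat_apply B (band K a w) n" using mat_apply_band[OF K B \<gamma> a w] by simp
  also have "\<dots> = (\<Sum>\<^sub>\<infinity>i. B n i * of_bool (i = m))" by (simp add: mat_apply_def eq)
  also have "\<dots> = (\<Sum>\<^sub>\<infinity>i\<in>{m}. B n i * of_bool (i = m))" by (rule infsum_cong_neutral) auto
  finally show ?thesis by simp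
qed

lemma mat_apply_l2:
  assumes B: "green K C \<gamma> a B" and \<gamma>: "\<gamma> > 0" and w: "l2_le w S"
  shows "l2_le (mat_apply B w) (C * (\<Sum>\<^sub>\<infinity>j. exp (- \<gamma> * \<bar>real_of_int (0 - j)\<bar>)) * S)"
  unfolding l2_le_def
proof (intro allI impI)
  fix F :: "int set" assume F: "finite F"
  let ?T = "C * (\<Sum>\<^sub>\<infinity>j. exp (- \<gamma> * \<bar>real_of_int (0 - j)\<bar>)) * S"
  have C: "C \<ge> 0" using B by (rule green_const_nonneg)
  have S: "S \<ge> 0" using w[unfolded l2_le_def, rule_format, of "{}"] by simp
  define v where "v = (\<lambda>J n. \<Sum>j\<in>J. B n (n + j) * w (n + j))"
  have "((\<lambda>j. B n (n + j) * w (n + j)) has_sum mat_apply B w n) UNIV" for n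
    using mat_apply_has_sum[OF B \<gamma> l2_le_bound[OF w], of n]
    by (subst has_sum_reindex_bij_betw[of "\<lambda>j. n + j" UNIV UNIV "\<lambda>m. B n m * w m"])
       (auto intro!: bij_betwI[where g="\<lambda>m. m - n"])
  then have "((\<lambda>J. v J n) \<longlongrightarrow> mat_apply B w n) (finite_subsets_at_top UNIV)" for n
    unfolding has_sum_def v_def .
  then have lim: "((\<lambda>J. L2_set (\<lambda>n. cmod (v J n)) F) \<longlongrightarrow> L2_set (\<lambda>n. cmod (mat_apply B w n)) F) (finite_subsets_at_top UNIV)"
    unfolding L2_set_def by (intro tendsto_intros)
  have "L2_set (\<lambda>n. cmod (v J n)) F \<le> ?T" if J: "finite J" for J
  proof -
    have "L2_set (\<lambda>n. cmod (v J n)) F \<le> (\<Sum>j\<in>J. C * exp (- \<gamma> * \<bar>real_of_int (0 - j)\<bar>)) * S"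
    proof (rule L2_set_diagonals_le[OF w J F])
      fix n
      show "cmod (v J n) \<le> (\<Sum>j\<in>J. C * exp (- \<gamma> * \<bar>real_of_int (0 - j)\<bar>) * cmod (w (n + j)))"
        unfolding v_def
      proof (rule sum_norm_le)
        fix j
        have "cmod (B n (n + j)) \<le> C * exp (- \<gamma> * \<bar>real_of_int (n - (n + j))\<bar>)"
          using B unfolding green_def by blast
        then show "cmod (B n (n + j) * w (n + j)) \<le> C * exp (- \<gamma> * \<bar>real_of_int (0 - j)\<bar>) * cmod (w (n + j))"
          unfolding norm_mult by (intro mult_right_mono) auto
      qed
    qed (use C in auto)
    also have "\<dots> = C * (\<Sum>j\<in>J. exp (- \<gamma> * \<bar>real_of_int (0 - j)\<bar>)) * S"
      by (simp only: sum_distrib_left)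
    also have "\<dots> \<le> ?T"
      using C S exp_decay_summable[OF \<gamma>, of 0] J
      by (intro mult_right_mono mult_left_mono finite_sum_le_infsum) auto
    finally show ?thesis .
  qed
  then show "L2_set (\<lambda>n. cmod (mat_apply B w n)) F \<le> ?T"
    by (intro tendsto_upperbound[OF lim] eventually_finite_subsets_at_top_weakI) auto
qed

lemma green_imp_invertible:
  assumes K: "finite K" and B: "green K C \<gamma> a B" and \<gamma>: "\<gamma> > 0"
    and a: "\<And>n k. k \<in> K \<Longrightarrow> cmod (a n k) \<le> M"
  shows "l2_invertible (\<lambda>_. 1) (\<lambda>_. 1) (band K a)"
proof -
  have bd: "\<And>n. cmod (w n) \<le> unit_norm w" if "w \<in> unit_l2" for w
    using l2_le_bound[OF l2_leD[OF that]] .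
  have A: "l2_le (band K a w) ((\<Sum>k\<in>K. \<bar>M\<bar>) * unit_norm w)" if "w \<in> unit_l2" for w
    unfolding l2_le_def
  proof (intro allI impI L2_set_diagonals_le[OF l2_leD[OF that] K])
    fix n
    show "cmod (band K a w n) \<le> (\<Sum>j\<in>K. \<bar>M\<bar> * cmod (w (n + j)))"
      unfolding band_def
      by (intro sum_norm_le) (auto simp: norm_mult intro!: mult_right_mono order_trans[OF a abs_ge_self])
  qed auto
  have 1: "l2_bounded (\<lambda>_. 1) (\<lambda>_. 1) (band K a)"
    unfolding l2_bounded_def
  proof (intro conjI ballI allI)
    show "band K a w \<in> unit_l2" if "w \<in> unit_l2" for w using l2_leI[OF A[OF that]] by simp
    show "band K a (\<lambda>n. \<alpha> * v n + \<beta> * w n) = (\<lambda>n. \<alpha> * band K a v n + \<beta> * band K a w n)" for v w \<alpha> \<beta>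
      by (auto simp: band_def sum_distrib_left sum.distrib[symmetric] algebra_simps intro!: sum.cong)
    show "\<exists>C. \<forall>w\<in>unit_l2. unit_norm (band K a w) \<le> C * unit_norm w"
      using l2_leI[OF A] by blast
  qed
  let ?T = "C * (\<Sum>\<^sub>\<infinity>j. exp (- \<gamma> * \<bar>real_of_int (0 - j)\<bar>))"
  note BB = l2_leI[OF mat_apply_l2[OF B \<gamma> l2_leD]]
  have 2: "l2_bounded (\<lambda>_. 1) (\<lambda>_. 1) (mat_apply B)"
    unfolding l2_bounded_def
  proof (intro conjI ballI allI)
    show "mat_apply B w \<in> unit_l2" if "w \<in> unit_l2" for w using BB[OF that] by simp
    show "mat_apply B (\<lambda>n. \<alpha> * v n + \<beta> * w n) = (\<lambda>n. \<alpha> * mat_apply B v n + \<beta> * mat_apply B w n)"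
      if "v \<in> unit_l2" "w \<in> unit_l2" for v w \<alpha> \<beta>
    proof
      fix n
      have "((\<lambda>m. \<alpha> * (B n m * v m) + \<beta> * (B n m * w m)) has_sum \<alpha> * mat_apply B v n + \<beta> * mat_apply B w n) UNIV"
        by (intro has_sum_add has_sum_cmult_right mat_apply_has_sum[OF B \<gamma> bd] that)
      then show "mat_apply B (\<lambda>n. \<alpha> * v n + \<beta> * w n) n = \<alpha> * mat_apply B v n + \<beta> * mat_apply B w n"
        unfolding mat_apply_def[of B "\<lambda>n. \<alpha> * v n + \<beta> * w n"]
        by (intro infsumI) (simp add: algebra_simps)
    qed
    show "\<exists>C. \<forall>w\<in>unit_l2. unit_norm (mat_apply B w) \<le> C * unit_norm w"
      using BB by blast
  qed
  have 3: "mat_apply B (band K a w) = w" if "w \<in> unit_l2" for w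
    by (rule mat_apply_band[OF K B \<gamma> a bd[OF that]])
  have 4: "band K a (mat_apply B w) = w" if "w \<in> unit_l2" for w
    by (rule band_mat_apply[OF K B \<gamma> bd[OF that]])
  show ?thesis unfolding l2_invertible_def using 1 2 3 4 by blast
qed

subsection \<open>Weighted and unweighted sequence spaces\<close>

lemma l2_rescale:
  assumes f: "\<And>n. f n > 0"
  shows "w \<in> l2 (\<lambda>n. m n / (f n)\<^sup>2) \<longleftrightarrow> (\<lambda>n. w n / complex_of_real (f n)) \<in> l2 m"
    and "l2_norm (\<lambda>n. m n / (f n)\<^sup>2) w = l2_norm m (\<lambda>n. w n / complex_of_real (f n))"
proof -
  have "(cmod (w n / complex_of_real (f n)))\<^sup>2 * m n = (cmod (w n))\<^sup>2 * (m n / (f n)\<^sup>2)" for n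
    using f[of n] by (simp add: norm_divide power_divide)
  then show "w \<in> l2 (\<lambda>n. m n / (f n)\<^sup>2) \<longleftrightarrow> (\<lambda>n. w n / complex_of_real (f n)) \<in> l2 m"
    "l2_norm (\<lambda>n. m n / (f n)\<^sup>2) w = l2_norm m (\<lambda>n. w n / complex_of_real (f n))"
    by (simp_all add: l2_def l2_norm_def)
qed

lemma l2_bounded_rescale:
  assumes f: "\<And>n. f n > 0" and f': "\<And>n. f' n > 0" and A: "l2_bounded m m' A"
  shows "l2_bounded (\<lambda>n. m n / (f n)\<^sup>2) (\<lambda>n. m' n / (f' n)\<^sup>2)
     (\<lambda>w n. complex_of_real (f' n) * A (\<lambda>j. w j / complex_of_real (f j)) n)"
proof -
  have c: "(\<lambda>n. complex_of_real (f' n) * v n / complex_of_real (f' n)) = v" for v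
    using f' by (simp add: fun_eq_iff less_imp_neq[THEN not_sym])
  have d: "(\<lambda>n. (\<alpha> * v n + \<beta> * w n) / complex_of_real (f n)) = (\<lambda>n. \<alpha> * (v n / complex_of_real (f n)) + \<beta> * (w n / complex_of_real (f n)))"
    for v w \<alpha> \<beta> by (simp add: add_divide_distrib)
  have linear: "A (\<lambda>n. \<alpha> * v n + \<beta> * w n) = (\<lambda>n. \<alpha> * A v n + \<beta> * A w n)"
    if "v \<in> l2 m" "w \<in> l2 m" for v w \<alpha> \<beta>
    using A that unfolding l2_bounded_def by auto
  obtain C where C: "\<forall>w\<in>l2 m. l2_norm m' (A w) \<le> C * l2_norm m w"
    using A unfolding l2_bounded_def by blast
  show ?thesis
    unfolding l2_bounded_def l2_rescale[OF f] l2_rescale[OF f'] c d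
  proof (intro conjI ballI allI)
    fix w assume "w \<in> l2 (\<lambda>n. m n / (f n)\<^sup>2)"
    then show "A (\<lambda>n. w n / complex_of_real (f n)) \<in> l2 m'"
      using A unfolding l2_bounded_def l2_rescale[OF f] by blast
  next
    fix v w \<alpha> \<beta> assume "v \<in> l2 (\<lambda>n. m n / (f n)\<^sup>2)" "w \<in> l2 (\<lambda>n. m n / (f n)\<^sup>2)"
    then have "A (\<lambda>n. \<alpha> * (v n / complex_of_real (f n)) + \<beta> * (w n / complex_of_real (f n)))
       = (\<lambda>n. \<alpha> * A (\<lambda>n. v n / complex_of_real (f n)) n + \<beta> * A (\<lambda>n. w n / complex_of_real (f n)) n)"
      unfolding l2_rescale[OF f] by (rule linear)
    then show "(\<lambda>n. complex_of_real (f' n) * A (\<lambda>n. \<alpha> * (v n / complex_of_real (f n)) + \<beta> * (w n / complex_of_real (f n))) n)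
       = (\<lambda>n. \<alpha> * (complex_of_real (f' n) * A (\<lambda>j. v j / complex_of_real (f j)) n) +
            \<beta> * (complex_of_real (f' n) * A (\<lambda>j. w j / complex_of_real (f j)) n))"
      by (simp add: algebra_simps)
  next
    show "\<exists>C. \<forall>w\<in>l2 (\<lambda>n. m n / (f n)\<^sup>2). l2_norm m' (A (\<lambda>n. w n / complex_of_real (f n)))
         \<le> C * l2_norm m (\<lambda>n. w n / complex_of_real (f n))"
      by (intro exI[of _ C] ballI bspec[OF C]) (simp only: l2_rescale[OF f])
  qed
qed

lemma l2_invertible_rescale:
  assumes f: "\<And>n. f n > 0" and f': "\<And>n. f' n > 0" and A: "l2_invertible m m' A"
  shows "l2_invertible (\<lambda>n. m n / (f n)\<^sup>2) (\<lambda>n. m' n / (f' n)\<^sup>2)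
     (\<lambda>w n. complex_of_real (f' n) * A (\<lambda>j. w j / complex_of_real (f j)) n)"
proof -
  obtain B where B: "l2_bounded m' m B" "\<forall>w\<in>l2 m. B (A w) = w" "\<forall>w\<in>l2 m'. A (B w) = w"
    and A': "l2_bounded m m' A"
    using A unfolding l2_invertible_def by blast
  have c: "(\<lambda>n. complex_of_real (f' n) * v n / complex_of_real (f' n)) = v"
    "(\<lambda>n. complex_of_real (f n) * v n / complex_of_real (f n)) = v"
    "(\<lambda>n. complex_of_real (f n) * (v n / complex_of_real (f n))) = v"
    "(\<lambda>n. complex_of_real (f' n) * (v n / complex_of_real (f' n))) = v" for v
    using f f' by (simp_all add: fun_eq_iff less_imp_neq[THEN not_sym])
  show ?thesis
    unfolding l2_invertible_def
  proof (intro conjI exI ballI)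
    show "l2_bounded (\<lambda>n. m n / (f n)\<^sup>2) (\<lambda>n. m' n / (f' n)\<^sup>2)
       (\<lambda>w n. complex_of_real (f' n) * A (\<lambda>j. w j / complex_of_real (f j)) n)"
      by (rule l2_bounded_rescale[OF f f' A'])
    show "l2_bounded (\<lambda>n. m' n / (f' n)\<^sup>2) (\<lambda>n. m n / (f n)\<^sup>2)
       (\<lambda>w n. complex_of_real (f n) * B (\<lambda>j. w j / complex_of_real (f' j)) n)"
      by (rule l2_bounded_rescale[OF f' f B(1)])
  next
    fix w assume "w \<in> l2 (\<lambda>n. m n / (f n)\<^sup>2)"
    then have "B (A (\<lambda>j. w j / complex_of_real (f j))) = (\<lambda>j. w j / complex_of_real (f j))"
      using B unfolding l2_rescale[OF f] by blast
    then show "(\<lambda>n. complex_of_real (f n) * B (\<lambda>j. complex_of_real (f' j) *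
        A (\<lambda>j. w j / complex_of_real (f j)) j / complex_of_real (f' j)) n) = w"
      by (simp only: c)
  next
    fix w assume "w \<in> l2 (\<lambda>n. m' n / (f' n)\<^sup>2)"
    then have "A (B (\<lambda>j. w j / complex_of_real (f' j))) = (\<lambda>j. w j / complex_of_real (f' j))"
      using B unfolding l2_rescale[OF f'] by blast
    then show "(\<lambda>n. complex_of_real (f' n) * A (\<lambda>j. complex_of_real (f j) *
        B (\<lambda>j. w j / complex_of_real (f' j)) j / complex_of_real (f j)) n) = w"
      by (simp only: c)
  qed
qed

text \<open>
  Multiplication by the square root of a weight is an isometry onto the unweighted space.
\<close>

lemma l2_invertible_band_normalize:
  assumes m: "\<And>n. m n > 0" and m': "\<And>n. m' n > 0"
  shows "l2_invertible m m' (band K \<sigma>) \<longleftrightarrow>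
     l2_invertible (\<lambda>_. 1) (\<lambda>_. 1) (band K (\<lambda>n k. \<sigma> n k * complex_of_real (sqrt (m' n) / sqrt (m (n + k)))))"
    (is "?L \<longleftrightarrow> l2_invertible _ _ (band K ?a)")
proof -
  have eq1: "band K ?a w n = complex_of_real (sqrt (m' n)) * band K \<sigma> (\<lambda>j. w j / complex_of_real (sqrt (m j))) n" for w n
    unfolding band_def sum_distrib_left by (intro sum.cong) (auto simp: algebra_simps)
  have eq2: "band K \<sigma> w n = complex_of_real (1 / sqrt (m' n)) * band K ?a (\<lambda>j. w j / complex_of_real (1 / sqrt (m j))) n" for w n
    unfolding band_def sum_distrib_left
    using m m' by (intro sum.cong) (auto simp: field_simps less_imp_neq[THEN not_sym])
  have one: "m n / (sqrt (m n))\<^sup>2 = 1" "m' n / (sqrt (m' n))\<^sup>2 = 1"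
    "1 / (1 / sqrt (m n))\<^sup>2 = m n" "1 / (1 / sqrt (m' n))\<^sup>2 = m' n" for n
    using m[of n] m'[of n] by (simp_all add: power_divide less_imp_le)
  show ?thesis
  proof
    assume ?L
    from l2_invertible_rescale[OF _ _ this, of "\<lambda>n. sqrt (m n)" "\<lambda>n. sqrt (m' n)"]
    show "l2_invertible (\<lambda>_. 1) (\<lambda>_. 1) (band K ?a)"
      using m m' unfolding one eq1[symmetric] by simp
  next
    assume "l2_invertible (\<lambda>_. 1) (\<lambda>_. 1) (band K ?a)"
    from l2_invertible_rescale[OF _ _ this, of "\<lambda>n. 1 / sqrt (m n)" "\<lambda>n. 1 / sqrt (m' n)"]
    show ?L using m m' unfolding one eq2[symmetric] by simp
  qed
qed

section \<open>Tilted families of band operators\<close>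

text \<open>
  Only differences of \<open>\<theta>\<close> matter, as \<open>\<theta>\<close> enters through conjugations; for the logarithms of norms of
  covectors this makes convergence insensitive to the scale of the covectors.
\<close>

definition data_tendsto ::
    "int set \<Rightarrow> ('p \<Rightarrow> int \<Rightarrow> int \<Rightarrow> complex) \<Rightarrow> ('p \<Rightarrow> int \<Rightarrow> real) \<Rightarrow> (nat \<Rightarrow> 'p) \<Rightarrow> 'p \<Rightarrow> bool" where
  "data_tendsto K \<alpha> \<theta> p q \<longleftrightarrow> (\<forall>n. \<forall>k\<in>K. (\<lambda>j. \<alpha> (p j) n k) \<longlonglongrightarrow> \<alpha> q n k) \<and>
      (\<forall>n m. (\<lambda>j. \<theta> (p j) n - \<theta> (p j) m) \<longlonglongrightarrow> \<theta> q n - \<theta> q m)"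

text \<open>
  \<open>X\<close> stands for the cotangent bundle without the zero section, \<open>\<theta>\<close> for the logarithm of the norm along
  an orbit. The last assumption approximates every parameter by those with \<open>\<theta>\<close> bounded below; it is
  what makes the set of good exponents convex.
\<close>

locale band_family =
  fixes K :: "int set" and X :: "'p set" and \<alpha> :: "'p \<Rightarrow> int \<Rightarrow> int \<Rightarrow> complex" and \<theta> :: "'p \<Rightarrow> int \<Rightarrow> real"
  assumes fin: "finite K"
    and compactness: "\<And>f :: nat \<Rightarrow> 'p. (\<And>j. f j \<in> X) \<Longrightarrow>
      \<exists>r q. strict_mono (r :: nat \<Rightarrow> nat) \<and> q \<in> X \<and> data_tendsto K \<alpha> \<theta> (\<lambda>j. f (r j)) q"
    and shift: "\<And>p i. p \<in> X \<Longrightarrow> \<exists>q\<in>X. (\<forall>n. \<alpha> q n = \<alpha> p (n + i)) \<and> (\<forall>n. \<theta> q n = \<theta> p (n + i))"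
    and dense: "\<And>p. p \<in> X \<Longrightarrow> \<exists>f. (\<forall>j. f j \<in> X \<and> (\<exists>c. \<forall>n. c \<le> \<theta> (f j) n)) \<and> data_tendsto K \<alpha> \<theta> f p"
begin

definition coef :: "real \<Rightarrow> 'p \<Rightarrow> int \<Rightarrow> int \<Rightarrow> complex" where
  "coef s p = tilt (\<lambda>i. s * \<theta> p i) (\<alpha> p)"

definition invertible_at :: "real \<Rightarrow> bool" where
  "invertible_at s \<longleftrightarrow> (\<forall>p\<in>X. l2_invertible (\<lambda>_. 1) (\<lambda>_. 1) (band K (coef s p)))"

lemma coef_tendsto:
  assumes "data_tendsto K \<alpha> \<theta> p q" "k \<in> K" shows "(\<lambda>j. coef s (p j) n k) \<longlonglongrightarrow> coef s q n k"
proof -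
  have a: "(\<lambda>j. \<alpha> (p j) n k) \<longlonglongrightarrow> \<alpha> q n k" and d: "(\<lambda>j. \<theta> (p j) n - \<theta> (p j) (n + k)) \<longlonglongrightarrow> \<theta> q n - \<theta> q (n + k)"
    using assms by (auto simp: data_tendsto_def)
  have "(\<lambda>j. \<alpha> (p j) n k * of_real (exp (s * (\<theta> (p j) n - \<theta> (p j) (n + k)))))
     \<longlonglongrightarrow> \<alpha> q n k * of_real (exp (s * (\<theta> q n - \<theta> q (n + k))))"
    by (intro tendsto_mult a tendsto_of_real tendsto_exp tendsto_const d)
  then show ?thesis by (simp add: coef_def tilt_def right_diff_distrib)
qed

lemma coef_tilt: "tilt (\<lambda>i. \<tau> * \<theta> p i) (coef s p) = coef (s + \<tau>) p"
  unfolding coef_def tilt_def by (auto simp: fun_eq_iff exp_diff exp_add algebra_simps)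

lemma shift_compact_coef: "shift_compact K (coef s ` X)"
  unfolding shift_compact_def
proof (intro conjI ballI allI impI)
  fix a j assume "a \<in> coef s ` X"
  then obtain p where p: "p \<in> X" "a = coef s p" by blast
  obtain q where "q \<in> X" "\<forall>n. \<alpha> q n = \<alpha> p (n + j)" "\<forall>n. \<theta> q n = \<theta> p (n + j)" using shift[OF p(1)] by blast
  then have "(\<lambda>n. a (n + j)) = coef s q"
    by (auto simp: p fun_eq_iff coef_def tilt_def algebra_simps)
  then show "(\<lambda>n. a (n + j)) \<in> coef s ` X" using \<open>q \<in> X\<close> by blast
next
  fix f :: "nat \<Rightarrow> int \<Rightarrow> int \<Rightarrow> complex"
  assume "\<forall>j. f j \<in> coef s ` X"
  then have "\<forall>j. \<exists>x. x \<in> X \<and> f j = coef s x" by blast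
  then obtain p where p: "\<And>j. p j \<in> X" "\<And>j. f j = coef s (p j)" by metis
  obtain r q where "strict_mono r" "q \<in> X" "data_tendsto K \<alpha> \<theta> (\<lambda>j. p (r j)) q" using compactness[of p] p(1) by blast
  then show "\<exists>r a. strict_mono r \<and> a \<in> coef s ` X \<and> (\<forall>n. \<forall>k\<in>K. (\<lambda>j. f (r j) n k) \<longlonglongrightarrow> a n k)"
    unfolding p using coef_tendsto by (intro exI[of _ r] exI[of _ "coef s q"]) auto
qed

text \<open>
  By compactness a single step of \<open>\<theta>\<close> is bounded uniformly over the family; shifts move any step to
  the origin.
\<close>

lemma lipschitz: "\<exists>\<kappa>\<ge>0. \<forall>p\<in>X. \<forall>n m. \<bar>\<theta> p n - \<theta> p m\<bar> \<le> \<kappa> * \<bar>real_of_int (n - m)\<bar>"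
proof -
  have "\<exists>\<kappa>. \<forall>p\<in>X. \<bar>\<theta> p 1 - \<theta> p 0\<bar> \<le> \<kappa>"
  proof (rule ccontr)
    assume "\<not> ?thesis"
    then have "\<forall>j::nat. \<exists>p. p \<in> X \<and> \<not> \<bar>\<theta> p 1 - \<theta> p 0\<bar> \<le> real j" by blast
    then obtain p where p: "\<And>j::nat. p j \<in> X" and big: "\<And>j. \<not> \<bar>\<theta> (p j) 1 - \<theta> (p j) 0\<bar> \<le> real j" by metis
    obtain r q where r: "strict_mono r" and "data_tendsto K \<alpha> \<theta> (\<lambda>j. p (r j)) q" using compactness[of p] p by blast
    then have "(\<lambda>j. \<theta> (p (r j)) 1 - \<theta> (p (r j)) 0) \<longlonglongrightarrow> \<theta> q 1 - \<theta> q 0" by (simp add: data_tendsto_def)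
    then have "Bseq (\<lambda>j. \<theta> (p (r j)) 1 - \<theta> (p (r j)) 0)" using convergentI convergent_imp_Bseq by blast
    then obtain C where C: "\<And>j. \<bar>\<theta> (p (r j)) 1 - \<theta> (p (r j)) 0\<bar> \<le> C" by (auto simp: Bseq_def)
    obtain j :: nat where "C < real j" using reals_Archimedean2 by blast
    moreover have "real j \<le> real (r j)" using seq_suble[OF r, of j] by simp
    ultimately show False using big[of "r j"] C[of j] by linarith
  qed
  then obtain \<kappa> where \<kappa>: "\<And>p. p \<in> X \<Longrightarrow> \<bar>\<theta> p 1 - \<theta> p 0\<bar> \<le> \<kappa>" by blast
  have step: "\<bar>\<theta> p (n + 1) - \<theta> p n\<bar> \<le> \<bar>\<kappa>\<bar>" if p: "p \<in> X" for p n
  proof -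
    obtain q where "q \<in> X" "\<forall>i. \<theta> q i = \<theta> p (i + n)" using shift[OF p] by blast
    then show ?thesis using \<kappa>[of q] by (auto simp: add.commute)
  qed
  have nat: "\<bar>\<theta> p (n + int i) - \<theta> p n\<bar> \<le> \<bar>\<kappa>\<bar> * real i" if p: "p \<in> X" for p n i
  proof (induction i)
    case (Suc i)
    then show ?case using step[OF p, of "n + int i"] by (simp add: algebra_simps abs_le_iff)
  qed simp
  have "\<bar>\<theta> p n - \<theta> p m\<bar> \<le> \<bar>\<kappa>\<bar> * \<bar>real_of_int (n - m)\<bar>" if p: "p \<in> X" for p n m
  proof (cases "m \<le> n")
    case True then show ?thesis using nat[OF p, of m "nat (n - m)"] by simp
  next
    case False then show ?thesis using nat[OF p, of n "nat (m - n)"] by (simp add: abs_minus_commute)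
  qed
  then show ?thesis by (intro exI[of _ "\<bar>\<kappa>\<bar>"]) auto
qed

lemma invertible_at_iff_green:
  "invertible_at s \<longleftrightarrow> (\<exists>C \<gamma>. \<gamma> > 0 \<and> (\<forall>p\<in>X. \<exists>B. green K C \<gamma> (coef s p) B))"
proof
  assume "invertible_at s"
  then show "\<exists>C \<gamma>. \<gamma> > 0 \<and> (\<forall>p\<in>X. \<exists>B. green K C \<gamma> (coef s p) B)"
    using uniform_green[OF fin shift_compact_coef, of s] unfolding invertible_at_def by blast
next
  obtain M where M: "\<forall>a\<in>coef s ` X. \<forall>n. \<forall>k\<in>K. cmod (a n k) \<le> M"
    using uniform_coeff_bound[OF fin shift_compact_coef] by blast
  assume "\<exists>C \<gamma>. \<gamma> > 0 \<and> (\<forall>p\<in>X. \<exists>B. green K C \<gamma> (coef s p) B)"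
  then show "invertible_at s"
    using green_imp_invertible[OF fin] M unfolding invertible_at_def by blast
qed

lemma tilt_green_coef:
  assumes p: "p \<in> X" and \<kappa>: "\<forall>p\<in>X. \<forall>n m. \<bar>\<theta> p n - \<theta> p m\<bar> \<le> \<kappa> * \<bar>real_of_int (n - m)\<bar>"
    and g: "green K C \<gamma> (coef s p) B"
  shows "green K C (\<gamma> - \<kappa> * \<bar>\<tau>\<bar>) (coef (s + \<tau>) p) (\<lambda>n m. B n m * of_real (exp (\<tau> * \<theta> p n - \<tau> * \<theta> p m)))"
  unfolding coef_tilt[symmetric]
proof (rule tilt_green[OF g])
  fix n m
  have "\<tau> * \<theta> p n - \<tau> * \<theta> p m \<le> \<bar>\<tau>\<bar> * \<bar>\<theta> p n - \<theta> p m\<bar>"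
    unfolding right_diff_distrib[symmetric] abs_mult[symmetric] by (rule abs_ge_self)
  also have "\<dots> \<le> \<bar>\<tau>\<bar> * (\<kappa> * \<bar>real_of_int (n - m)\<bar>)"
    using \<kappa> p by (intro mult_left_mono) auto
  finally have *: "\<tau> * \<theta> p n - \<tau> * \<theta> p m \<le> \<kappa> * \<bar>\<tau>\<bar> * \<bar>real_of_int (n - m)\<bar>" by (simp add: algebra_simps)
  have "cmod (B n m) * exp (\<tau> * \<theta> p n - \<tau> * \<theta> p m)
      \<le> (C * exp (- \<gamma> * \<bar>real_of_int (n - m)\<bar>)) * exp (\<kappa> * \<bar>\<tau>\<bar> * \<bar>real_of_int (n - m)\<bar>)"
    using g * green_const_nonneg[OF g] by (intro mult_mono) (auto simp: green_def)
  also have "\<dots> = C * exp (- (\<gamma> - \<kappa> * \<bar>\<tau>\<bar>) * \<bar>real_of_int (n - m)\<bar>)"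
    by (simp add: exp_add[symmetric] algebra_simps)
  finally show "cmod (B n m) * exp (\<tau> * \<theta> p n - \<tau> * \<theta> p m)
      \<le> C * exp (- (\<gamma> - \<kappa> * \<bar>\<tau>\<bar>) * \<bar>real_of_int (n - m)\<bar>)" .
qed

text \<open>
  Changing the exponent by \<open>\<tau>\<close> tilts the inverse matrices, which costs at most \<open>\<kappa> * |\<tau>|\<close> of the decay
  rate \<open>\<gamma>\<close>.
\<close>

lemma open_invertible_at: "open {s. invertible_at s}"
  unfolding open_dist
proof (intro ballI)
  fix s assume "s \<in> {s. invertible_at s}"
  then obtain C \<gamma> where \<gamma>: "\<gamma> > 0" and g: "\<forall>p\<in>X. \<exists>B. green K C \<gamma> (coef s p) B"
    by (auto simp: invertible_at_iff_green)
  obtain \<kappa> where \<kappa>0: "\<kappa> \<ge> 0" and \<kappa>: "\<forall>p\<in>X. \<forall>n m. \<bar>\<theta> p n - \<theta> p m\<bar> \<le> \<kappa> * \<bar>real_of_int (n - m)\<bar>"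
    using lipschitz by blast
  have "invertible_at t" if t: "dist t s < \<gamma> / (\<kappa> + 1)" for t
  proof -
    have "(\<kappa> + 1) * \<bar>t - s\<bar> < \<gamma>"
      using t \<kappa>0 by (simp add: dist_real_def pos_less_divide_eq mult.commute)
    then have "\<gamma> - \<kappa> * \<bar>t - s\<bar> > 0" by (simp add: algebra_simps)
    moreover have "\<forall>p\<in>X. \<exists>B. green K C (\<gamma> - \<kappa> * \<bar>t - s\<bar>) (coef t p) B"
      using tilt_green_coef[OF _ \<kappa>, of _ C \<gamma> s _ "t - s"] g by fastforce
    ultimately show ?thesis unfolding invertible_at_iff_green by blast
  qed
  then show "\<exists>e>0. \<forall>t. dist t s < e \<longrightarrow> t \<in> {s. invertible_at s}"
    using \<gamma> \<kappa>0 by (intro exI[of _ "\<gamma> / (\<kappa> + 1)"]) auto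
qed

text \<open>
  A lower bound of \<open>\<theta>\<close> makes the columns of \<open>B'\<close>, tilted back from \<open>s'\<close> to \<open>s\<close>, bounded, so by
  uniqueness among bounded sequences they are the columns of \<open>B\<close>. Thus \<open>B\<close> and \<open>B'\<close> are tilts of each
  other, and a tilt between them is entrywise at most the larger of the two.
\<close>

lemma green_between:
  assumes st: "s \<le> t" "t \<le> s'" and p: "p \<in> X" and c: "\<And>n. c \<le> \<theta> p n"
    and \<gamma>: "\<gamma> > 0" and B: "green K C \<gamma> (coef s p) B" and B': "green K C \<gamma> (coef s' p) B'"
  shows "\<exists>B. green K C \<gamma> (coef t p) B"
proof -
  obtain \<kappa> where \<kappa>0: "\<kappa> \<ge> 0" and \<kappa>: "\<forall>p\<in>X. \<forall>n m. \<bar>\<theta> p n - \<theta> p m\<bar> \<le> \<kappa> * \<bar>real_of_int (n - m)\<bar>"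
    using lipschitz by blast
  obtain M where M: "\<forall>a\<in>coef s ` X. \<forall>n. \<forall>k\<in>K. cmod (a n k) \<le> M"
    using uniform_coeff_bound[OF fin shift_compact_coef] by blast
  have C: "C \<ge> 0" using B by (rule green_const_nonneg)
  let ?\<tau> = "s' - s"
  define W where "W = (\<lambda>n m. B' n m * of_real (exp ((s - s') * \<theta> p n - (s - s') * \<theta> p m)))"
  have W: "green K C (\<gamma> - \<kappa> * \<bar>s - s'\<bar>) (coef s p) W"
    using tilt_green_coef[OF p \<kappa> B', of "s - s'"] by (simp add: W_def)
  \<comment> \<open>When \<open>s' - s\<close> is large, the decay rate of \<open>W\<close> may be negative; its columns are bounded because of \<open>c\<close>.\<close>
  have eq: "W n m = B n m" for n m
  proof (rule green_unique[OF fin B \<gamma>, of M "\<lambda>n. W n m" "C * exp (?\<tau> * (\<theta> p m - c))"])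
    show "cmod (coef s p n k) \<le> M" if "k \<in> K" for n k using M p that by blast
    show "band K (coef s p) (\<lambda>n. W n m) n = of_bool (n = m)" for n
      using W unfolding green_def band_def by blast
    show "cmod (W n m) \<le> C * exp (?\<tau> * (\<theta> p m - c))" for n
    proof -
      have "cmod (B' n m) \<le> C * exp (- \<gamma> * \<bar>real_of_int (n - m)\<bar>)" using B' unfolding green_def by blast
      also have "\<dots> \<le> C * 1" using C \<gamma> by (intro mult_left_mono) auto
      finally have 1: "cmod (B' n m) \<le> C" by simp
      have "?\<tau> * c \<le> ?\<tau> * \<theta> p n" using st c by (intro mult_left_mono) auto
      then have "(s - s') * \<theta> p n - (s - s') * \<theta> p m \<le> ?\<tau> * (\<theta> p m - c)"
        by (simp add: algebra_simps)
      then show ?thesis unfolding W_def norm_mult using 1 C by (intro mult_mono) auto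
    qed
  qed
  have "green K C \<gamma> (tilt (\<lambda>i. (t - s) * \<theta> p i) (coef s p))
     (\<lambda>n m. B n m * of_real (exp ((t - s) * \<theta> p n - (t - s) * \<theta> p m)))"
  proof (rule tilt_green[OF B])
    fix n m
    let ?D = "C * exp (- \<gamma> * \<bar>real_of_int (n - m)\<bar>)" and ?y = "\<theta> p n - \<theta> p m"
    have b: "cmod (B n m) \<le> ?D" using B unfolding green_def by blast
    have "B' n m = B n m * of_real (exp (?\<tau> * ?y))"
    proof -
      have "B n m * of_real (exp (?\<tau> * ?y)) = B' n m * (of_real (exp ((s - s') * \<theta> p n - (s - s') * \<theta> p m)) * of_real (exp (?\<tau> * ?y)))"
        unfolding eq[symmetric] W_def by simp
      also have "\<dots> = B' n m * of_real (exp ((s - s') * \<theta> p n - (s - s') * \<theta> p m + ?\<tau> * ?y))"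
        by (simp only: exp_add of_real_mult)
      also have "(s - s') * \<theta> p n - (s - s') * \<theta> p m + ?\<tau> * ?y = 0" by (simp add: algebra_simps)
      finally show ?thesis by simp
    qed
    moreover have "cmod (B' n m) \<le> ?D" using B' unfolding green_def by blast
    ultimately have b': "cmod (B n m) * exp (?\<tau> * ?y) \<le> ?D" by (simp add: norm_mult)
    show "cmod (B n m) * exp ((t - s) * \<theta> p n - (t - s) * \<theta> p m) \<le> ?D"
    proof (cases "?y \<le> 0")
      case True
      then have "(t - s) * ?y \<le> 0" using st by (intro mult_nonneg_nonpos) auto
      then have "exp ((t - s) * \<theta> p n - (t - s) * \<theta> p m) \<le> 1" by (simp add: algebra_simps)
      then have "cmod (B n m) * exp ((t - s) * \<theta> p n - (t - s) * \<theta> p m) \<le> cmod (B n m) * 1" by (intro mult_left_mono) auto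
      then show ?thesis using b by linarith
    next
      case False
      then have "(t - s) * ?y \<le> ?\<tau> * ?y" using st by (intro mult_right_mono) auto
      then have "exp ((t - s) * \<theta> p n - (t - s) * \<theta> p m) \<le> exp (?\<tau> * ?y)" by (simp add: algebra_simps)
      then have "cmod (B n m) * exp ((t - s) * \<theta> p n - (t - s) * \<theta> p m) \<le> cmod (B n m) * exp (?\<tau> * ?y)" by (intro mult_left_mono) auto
      then show ?thesis using b' by linarith
    qed
  qed
  then show ?thesis unfolding coef_tilt by auto
qed

text \<open>
  The constants of \<open>green_between\<close> do not depend on the parameter, so its conclusion passes from a
  dense set of parameters to all of them.
\<close>

lemma invertible_at_between:
  assumes s: "invertible_at s" and s': "invertible_at s'" and st: "s \<le> t" "t \<le> s'"
  shows "invertible_at t"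
proof -
  obtain C1 \<gamma>1 where g1: "\<gamma>1 > 0" "\<forall>p\<in>X. \<exists>B. green K C1 \<gamma>1 (coef s p) B"
    using s by (auto simp: invertible_at_iff_green)
  obtain C2 \<gamma>2 where g2: "\<gamma>2 > 0" "\<forall>p\<in>X. \<exists>B. green K C2 \<gamma>2 (coef s' p) B"
    using s' by (auto simp: invertible_at_iff_green)
  let ?C = "max C1 C2" and ?\<gamma> = "min \<gamma>1 \<gamma>2"
  have \<gamma>: "?\<gamma> > 0" using g1 g2 by simp
  have "\<exists>B. green K ?C ?\<gamma> (coef t p) B" if p: "p \<in> X" for p
  proof -
    obtain q where q: "\<forall>j. q j \<in> X \<and> (\<exists>c. \<forall>n. c \<le> \<theta> (q j) n)" and "data_tendsto K \<alpha> \<theta> q p" using dense[OF p] by blast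
    have "\<exists>B. green K ?C ?\<gamma> (coef t (q j)) B" for j
    proof -
      obtain c where c: "\<And>n. c \<le> \<theta> (q j) n" using q by blast
      have qj: "q j \<in> X" using q by blast
      obtain B1 where B1: "green K C1 \<gamma>1 (coef s (q j)) B1" using g1 qj by blast
      obtain B2 where B2: "green K C2 \<gamma>2 (coef s' (q j)) B2" using g2 qj by blast
      have "green K ?C ?\<gamma> (coef s (q j)) B1" by (rule green_mono[OF B1]) (auto intro: green_const_nonneg[OF B1])
      moreover have "green K ?C ?\<gamma> (coef s' (q j)) B2" by (rule green_mono[OF B2]) (auto intro: green_const_nonneg[OF B2])
      ultimately show ?thesis using green_between[OF st qj c \<gamma>] by blast
    qed
    then show ?thesis
      by (rule green_limit[OF fin \<gamma>, of ?C "\<lambda>j. coef t (q j)"]) (rule coef_tendsto[OF \<open>data_tendsto K \<alpha> \<theta> q p\<close>])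
  qed
  then show ?thesis unfolding invertible_at_iff_green using \<gamma> by blast
qed

end

section \<open>Open convex sets of reals\<close>

lemma open_interval_of_open_convex:
  fixes S :: "real set"
  assumes "open S" and conv: "\<And>s s' t. s \<in> S \<Longrightarrow> s' \<in> S \<Longrightarrow> s \<le> t \<Longrightarrow> t \<le> s' \<Longrightarrow> t \<in> S"
  shows "\<exists>s0 s1 :: ereal. s0 \<le> s1 \<and> (\<forall>s. s0 < ereal s \<and> ereal s < s1 \<longleftrightarrow> s \<in> S)"
proof (cases "S = {}")
  case True then show ?thesis by (intro exI[of _ "0 :: ereal"]) auto
next
  case False
  let ?a = "INF s\<in>S. ereal s" and ?b = "SUP s\<in>S. ereal s"
  have "?a \<le> ?b" using False by (rule INF_le_SUP)
  moreover have "?a < ereal s \<and> ereal s < ?b \<longleftrightarrow> s \<in> S" for s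
  proof
    assume "?a < ereal s \<and> ereal s < ?b"
    then obtain x y where "x \<in> S" "x < s" "y \<in> S" "s < y"
      by (auto simp: INF_less_iff less_SUP_iff)
    then show "s \<in> S" using conv[of x y s] by simp
  next
    assume "s \<in> S"
    then obtain e where e: "e > 0" "ball s e \<subseteq> S" using \<open>open S\<close> open_contains_ball by blast
    have "s - e / 2 \<in> S" "s + e / 2 \<in> S" using e by (auto simp: subset_iff dist_real_def)
    then have "?a \<le> ereal (s - e / 2)" "ereal (s + e / 2) \<le> ?b" by (auto intro: INF_lower SUP_upper)
    moreover have "ereal (s - e / 2) < ereal s" "ereal s < ereal (s + e / 2)" using e by simp_all
    ultimately show "?a < ereal s \<and> ereal s < ?b" by (meson order_le_less_trans order_less_le_trans)
  qed
  ultimately show ?thesis by blast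
qed

section \<open>Smooth cutoff functions\<close>

text \<open>
  The functions \<open>exp (- 1 / t) / t\<^sup>j\<close>, extended by zero to \<open>t \<le> 0\<close>. For \<open>j = 0\<close> this is the standard smooth
  function that is flat at the origin; the others are what its derivatives are made of.
\<close>

definition flat :: "nat \<Rightarrow> real \<Rightarrow> real" where
  "flat j t = (if t > 0 then exp (- (1 / t)) / t ^ j else 0)"

lemma flat_quotient_tendsto: "((\<lambda>t. flat j t / t) \<longlongrightarrow> 0) (at 0)"
  unfolding filterlim_split_at
proof (rule filterlim_split_at)
  show "((\<lambda>t. flat j t / t) \<longlongrightarrow> 0) (at_left 0)"
    by (rule tendsto_eventually) (auto simp: eventually_at_filter flat_def)
  have "((\<lambda>t::real. (inverse t) ^ Suc j / exp (inverse t)) \<longlongrightarrow> 0) (at_right 0)"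
    by (rule filterlim_compose[OF tendsto_power_div_exp_0 filterlim_inverse_at_top_right])
  then show "((\<lambda>t. flat j t / t) \<longlongrightarrow> 0) (at_right 0)"
  proof (rule Lim_transform_eventually)
    show "\<forall>\<^sub>F t in at_right 0. inverse t ^ Suc j / exp (inverse t) = flat j t / t"
      by (auto simp: eventually_at_filter flat_def exp_minus field_simps)
  qed
qed

lemma flat_has_derivative:
  "(flat j has_real_derivative (flat (j + 2) t - real j * flat (j + 1) t)) (at t)"
proof -
  consider "t > 0" | "t < 0" | "t = 0" by linarith
  then show ?thesis
  proof cases
    case 1
    have "((\<lambda>t. exp (- (1 / t)) / t ^ j) has_real_derivative
        (exp (- (1 / t)) * (1 / t\<^sup>2) * t ^ j - exp (- (1 / t)) * (real j * t ^ (j - 1))) / (t ^ j * t ^ j)) (at t)"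
      using 1 by (auto intro!: derivative_eq_intros simp: power2_eq_square)
    also have "(exp (- (1 / t)) * (1 / t\<^sup>2) * t ^ j - exp (- (1 / t)) * (real j * t ^ (j - 1))) / (t ^ j * t ^ j)
       = flat (j + 2) t - real j * flat (j + 1) t"
      using 1 by (cases j) (auto simp: flat_def field_simps power2_eq_square)
    finally show ?thesis
      by (rule has_field_derivative_transform_within_open[of _ _ _ "{0<..}"]) (use 1 in \<open>auto simp: flat_def\<close>)
  next
    case 2
    have "((\<lambda>_. 0) has_real_derivative 0) (at t)" by simp
    then have "(flat j has_real_derivative 0) (at t)"
      by (rule has_field_derivative_transform_within_open[of _ _ _ "{..<0}"]) (use 2 in \<open>auto simp: flat_def\<close>)
    then show ?thesis using 2 by (simp add: flat_def)
  next
    case 3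
    have "(flat j has_real_derivative 0) (at 0)"
      using flat_quotient_tendsto[of j] by (simp add: has_field_derivative_iff flat_def)
    then show ?thesis using 3 by (simp add: flat_def)
  qed
qed

text \<open>
  An algebra of functions that contains the bump functions and is closed under directional
  derivatives. Every element is therefore smooth, without a formula for its higher derivatives.
\<close>

inductive cutoff_algebra :: "('a::real_inner \<Rightarrow> complex) \<Rightarrow> bool" where
  const: "cutoff_algebra (\<lambda>_. c)"
| linear: "cutoff_algebra (\<lambda>y. of_real (y \<bullet> v))"
| flat: "cutoff_algebra (\<lambda>y. of_real (flat j (R - (y - a) \<bullet> (y - a))))"
| add: "cutoff_algebra f \<Longrightarrow> cutoff_algebra g \<Longrightarrow> cutoff_algebra (\<lambda>y. f y + g y)"
| mult: "cutoff_algebra f \<Longrightarrow> cutoff_algebra g \<Longrightarrow> cutoff_algebra (\<lambda>y. f y * g y)"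

lemma cutoff_algebra_derivative:
  assumes "cutoff_algebra f"
  shows "\<exists>f'. (\<forall>x. (f has_derivative f' x) (at x)) \<and> (\<forall>v. cutoff_algebra (\<lambda>x. f' x v))"
  using assms
proof induction
  case (const c)
  show ?case by (intro exI[of _ "\<lambda>_ _. 0"]) (auto intro: cutoff_algebra.const)
next
  case (linear v)
  have "((\<lambda>y. complex_of_real (y \<bullet> v)) has_derivative (\<lambda>h. of_real (h \<bullet> v))) (at x)" for x :: 'a
    by (auto intro!: derivative_eq_intros)
  then show ?case by (intro exI[of _ "\<lambda>_ h. of_real (h \<bullet> v)"]) (auto intro: cutoff_algebra.const)
next
  case (flat j R a)
  let ?q = "\<lambda>y. R - (y - a) \<bullet> (y - a)"
  let ?D = "\<lambda>x. flat (j + 2) (?q x) - real j * flat (j + 1) (?q x)"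
  have "((\<lambda>y. complex_of_real (flat j (?q y))) has_derivative
      (\<lambda>h. of_real ((- 2 * ((x - a) \<bullet> h)) * ?D x))) (at x)" for x :: 'a
  proof -
    have "(?q has_derivative (\<lambda>h. - 2 * ((x - a) \<bullet> h))) (at x)"
      by (auto intro!: derivative_eq_intros simp: inner_commute)
    from has_derivative_compose[OF this flat_has_derivative[of j "?q x", unfolded has_field_derivative_def]]
    have "((\<lambda>y. flat j (?q y)) has_derivative (\<lambda>h. ?D x * (- 2 * ((x - a) \<bullet> h)))) (at x)" .
    from has_derivative_of_real[OF this] show ?thesis by (simp only: mult.commute)
  qed
  moreover have "cutoff_algebra (\<lambda>x. complex_of_real ((- 2 * ((x - a) \<bullet> h)) * ?D x))" for h
  proof -
    have "cutoff_algebra (\<lambda>x. ((- 2) * of_real (x \<bullet> h) + of_real (2 * (a \<bullet> h))) *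
       (of_real (flat (j + 2) (?q x)) + (- of_real (real j)) * of_real (flat (j + 1) (?q x))))"
      by (intro cutoff_algebra.intros)
    moreover have "(\<lambda>x. ((- 2) * of_real (x \<bullet> h) + of_real (2 * (a \<bullet> h))) *
       (of_real (flat (j + 2) (?q x)) + (- of_real (real j)) * of_real (flat (j + 1) (?q x))))
      = (\<lambda>x. complex_of_real ((- 2 * ((x - a) \<bullet> h)) * ?D x))"
      by (simp add: fun_eq_iff inner_diff_left algebra_simps)
    ultimately show ?thesis by simp
  qed
  ultimately show ?case by (intro exI[of _ "\<lambda>x h. of_real ((- 2 * ((x - a) \<bullet> h)) * ?D x)"]) blast
next
  case (add f g)
  then obtain f' g' where "\<And>x. (f has_derivative f' x) (at x)" "\<And>v. cutoff_algebra (\<lambda>x. f' x v)"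
    "\<And>x. (g has_derivative g' x) (at x)" "\<And>v. cutoff_algebra (\<lambda>x. g' x v)" by blast
  then show ?case
    by (intro exI[of _ "\<lambda>x h. f' x h + g' x h"]) (auto intro: has_derivative_add cutoff_algebra.add)
next
  case (mult f g)
  then obtain f' g' where "\<And>x. (f has_derivative f' x) (at x)" "\<And>v. cutoff_algebra (\<lambda>x. f' x v)"
    "\<And>x. (g has_derivative g' x) (at x)" "\<And>v. cutoff_algebra (\<lambda>x. g' x v)" by blast
  then show ?case using mult.hyps
    by (intro exI[of _ "\<lambda>x h. f x * g' x h + f' x h * g x"])
       (auto intro!: has_derivative_mult cutoff_algebra.add cutoff_algebra.mult)
qed

lemma cutoff_algebra_smooth:
  assumes "cutoff_algebra f" shows "smooth_on UNIV f"
proof -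
  have "Ck_on k UNIV f" if "cutoff_algebra f" for k and f :: "'a \<Rightarrow> complex"
    using that
  proof (induction k arbitrary: f)
    case 0
    then obtain f' where "\<And>x. (f has_derivative f' x) (at x)" using cutoff_algebra_derivative by blast
    then show ?case by (auto intro!: continuous_at_imp_continuous_on has_derivative_continuous)
  next
    case (Suc k)
    then obtain f' where f': "\<And>x. (f has_derivative f' x) (at x)" "\<And>v. cutoff_algebra (\<lambda>x. f' x v)"
      using cutoff_algebra_derivative by blast
    have "frechet_derivative f (at x) = f' x" for x using frechet_derivative_at[OF f'(1)] by simp
    then show ?case using f' Suc.IH by (auto simp: differentiable_def)
  qed
  then show ?thesis using assms unfolding smooth_on_def by blast
qed

lemma test_fun_exists:
  fixes a :: "real^2"
  assumes "open V" "a \<in> V"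
  shows "\<exists>\<phi> r. r > 0 \<and> test_fun V \<phi> \<and> (\<forall>y\<in>ball a r. \<phi> y \<noteq> 0)"
proof -
  obtain r where r: "r > 0" "cball a r \<subseteq> V" using assms open_contains_cball by blast
  define \<phi> where "\<phi> = (\<lambda>y. complex_of_real (flat 0 (r\<^sup>2 - (y - a) \<bullet> (y - a))))"
  have \<phi>: "\<phi> y \<noteq> 0 \<longleftrightarrow> y \<in> ball a r" for y
  proof -
    have "(y - a) \<bullet> (y - a) = (dist a y)\<^sup>2" by (metis dist_norm dist_commute power2_norm_eq_inner)
    moreover have "(dist a y)\<^sup>2 < r\<^sup>2 \<longleftrightarrow> dist a y < r"
      using power_strict_mono[of "dist a y" r 2] power2_less_imp_less[of "dist a y" r] r(1) by auto
    ultimately show ?thesis by (auto simp: \<phi>_def flat_def)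
  qed
  have "smooth_on UNIV \<phi>" unfolding \<phi>_def by (intro cutoff_algebra_smooth cutoff_algebra.flat)
  moreover have "{y. \<phi> y \<noteq> 0} = ball a r" using \<phi> by blast
  then have "closure {y. \<phi> y \<noteq> 0} = cball a r" using r(1) by simp
  ultimately have "test_fun V \<phi>" using r by (simp add: test_fun_def)
  then show ?thesis using r(1) \<phi> by blast
qed

section \<open>Continuity and homogeneity of principal symbols\<close>

lemma smooth_on_imp_continuous_on: "smooth_on S f \<Longrightarrow> continuous_on S f"
  unfolding smooth_on_def by (metis Ck_on.simps(1))

text \<open>
  Localizing with a cutoff that does not vanish near \<open>x\<close> exhibits the principal symbol as the quotient
  of a continuous homogeneous function on the chart by a nonvanishing factor.
\<close>

lemma principal_symbol_local:
  assumes A: "pseudodifferential \<A> d A" and c: "c \<in> \<A>" "is_chart c" "x \<in> fst c"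
  shows "\<exists>b f r. r > 0 \<and> continuous_on {(y, \<eta>). \<eta> \<noteq> 0} b \<and> continuous_on UNIV f \<and>
     (\<forall>y\<in>ball (snd c x) r. f y \<noteq> (0::complex)) \<and>
     (\<forall>y \<eta> t. \<eta> \<noteq> 0 \<and> t > 0 \<longrightarrow> b (y, t *\<^sub>R \<eta>) = complex_of_real (t powr d) * b (y, \<eta>)) \<and>
     (\<forall>(x, \<xi>)\<in>cotangent0 \<A>. x \<in> fst c \<longrightarrow> b (snd c x, \<xi> c) = f (snd c x) * principal_symbol \<A> d A (x, \<xi>))"
proof -
  have s: "has_principal_symbol \<A> d A (principal_symbol \<A> d A)"
    unfolding principal_symbol_def using A unfolding pseudodifferential_def by (metis someI_ex)
  have "open (snd c ` fst c)" "snd c x \<in> snd c ` fst c" using c by (auto simp: is_chart_def)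
  then obtain \<phi> r where \<phi>: "r > 0" "test_fun (snd c ` fst c) \<phi>" "\<forall>y\<in>ball (snd c x) r. \<phi> y \<noteq> 0"
    using test_fun_exists by blast
  obtain a b where ab: "classical_symbol d a b"
    "\<forall>(x, \<xi>)\<in>cotangent0 \<A>. x \<in> fst c \<longrightarrow> b 0 (snd c x, \<xi> c) = \<phi> (snd c x) * \<phi> (snd c x) * principal_symbol \<A> d A (x, \<xi>)"
    using s[unfolded has_principal_symbol_def, rule_format, OF c(1), of \<phi> \<phi>] \<phi>(2) by blast
  have "smooth_on {(y, \<eta>). \<eta> \<noteq> 0} (b 0)"
    and hom: "\<forall>y \<eta> t. \<eta> \<noteq> 0 \<and> t > 0 \<longrightarrow> b 0 (y, t *\<^sub>R \<eta>) = complex_of_real (t powr (d - real 0)) * b 0 (y, \<eta>)"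
    using ab(1) unfolding classical_symbol_def by blast+
  then have "continuous_on {(y, \<eta>). \<eta> \<noteq> 0} (b 0)" using smooth_on_imp_continuous_on by blast
  moreover have "continuous_on UNIV (\<lambda>y. \<phi> y * \<phi> y)"
    using \<phi>(2) unfolding test_fun_def by (intro continuous_on_mult) (auto dest: smooth_on_imp_continuous_on)
  ultimately show ?thesis
    using \<phi>(1,3) ab(2) hom by (intro exI[of _ "b 0"] exI[of _ "\<lambda>y. \<phi> y * \<phi> y"] exI[of _ r]) simp
qed

lemma principal_symbol_tendsto:
  assumes A: "pseudodifferential \<A> d A" and c: "c \<in> \<A>" "is_chart c" "fst p \<in> fst c"
    and p: "p \<in> cotangent0 \<A>" "snd p c \<noteq> 0"
    and f: "\<forall>\<^sub>F j in F. f j \<in> cotangent0 \<A>" "\<forall>\<^sub>F j in F. fst (f j) \<in> fst c"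
    and lim: "((\<lambda>j. snd c (fst (f j))) \<longlongrightarrow> snd c (fst p)) F" "((\<lambda>j. snd (f j) c) \<longlongrightarrow> snd p c) F"
  shows "((\<lambda>j. principal_symbol \<A> d A (f j)) \<longlongrightarrow> principal_symbol \<A> d A p) F"
proof -
  let ?\<sigma> = "principal_symbol \<A> d A"
  obtain b h r where r: "r > 0" and b: "continuous_on {(y, \<eta>). \<eta> \<noteq> 0} b" and h: "continuous_on UNIV h"
    and h0: "\<And>y. y\<in>ball (snd c (fst p)) r \<Longrightarrow> h y \<noteq> (0::complex)"
    and eq: "\<And>q. q\<in>cotangent0 \<A> \<Longrightarrow> fst q \<in> fst c \<Longrightarrow> b (snd c (fst q), snd q c) = h (snd c (fst q)) * ?\<sigma> q"
    using principal_symbol_local[OF A c] by fastforce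
  have "open {(y :: real^2, \<eta> :: real^2). \<eta> \<noteq> 0}"
  proof -
    have "{(y :: real^2, \<eta> :: real^2). \<eta> \<noteq> 0} = UNIV \<times> (- {0})" by auto
    then show ?thesis by (simp add: open_Times open_Compl)
  qed
  then have "isCont b (snd c (fst p), snd p c)"
    using b p(2) by (simp add: continuous_on_eq_continuous_at)
  then have "((\<lambda>j. b (snd c (fst (f j)), snd (f j) c)) \<longlongrightarrow> b (snd c (fst p), snd p c)) F"
    by (rule isCont_tendsto_compose) (intro tendsto_Pair lim)
  moreover have "((\<lambda>j. h (snd c (fst (f j)))) \<longlongrightarrow> h (snd c (fst p))) F"
    using h lim(1) by (metis continuous_on_tendsto_compose UNIV_I always_eventually)
  moreover have hp: "h (snd c (fst p)) \<noteq> 0" using h0 r by simp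
  ultimately have "((\<lambda>j. b (snd c (fst (f j)), snd (f j) c) / h (snd c (fst (f j)))) \<longlongrightarrow> b (snd c (fst p), snd p c) / h (snd c (fst p))) F"
    by (intro tendsto_divide)
  moreover have "b (snd c (fst p), snd p c) / h (snd c (fst p)) = ?\<sigma> p" using eq[OF p(1) c(3)] hp by simp
  moreover have "\<forall>\<^sub>F j in F. snd c (fst (f j)) \<in> ball (snd c (fst p)) r"
    by (rule topological_tendstoD[OF lim(1)]) (use r in auto)
  then have "\<forall>\<^sub>F j in F. b (snd c (fst (f j)), snd (f j) c) / h (snd c (fst (f j))) = ?\<sigma> (f j)"
    using f by eventually_elim (use eq h0 in auto)
  ultimately show ?thesis by (simp add: tendsto_cong)
qed

lemma principal_symbol_homogeneous:
  assumes A: "pseudodifferential \<A> d A" and c: "c \<in> \<A>" "is_chart c" "x \<in> fst c"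
    and p: "(x, \<xi>) \<in> cotangent0 \<A>" "\<xi> c \<noteq> 0" and q: "(x, \<lambda>c. t *\<^sub>R \<xi> c) \<in> cotangent0 \<A>" and t: "t > 0"
  shows "principal_symbol \<A> d A (x, \<lambda>c. t *\<^sub>R \<xi> c) = complex_of_real (t powr d) * principal_symbol \<A> d A (x, \<xi>)"
proof -
  let ?\<sigma> = "principal_symbol \<A> d A"
  obtain b h r where r: "r > 0" and h0': "\<forall>y\<in>ball (snd c x) r. h y \<noteq> (0::complex)"
    and hom: "\<forall>y \<eta> t. \<eta> \<noteq> 0 \<and> t > 0 \<longrightarrow> b (y, t *\<^sub>R \<eta>) = complex_of_real (t powr d) * b (y, \<eta>)"
    and eq': "\<forall>(x, \<xi>)\<in>cotangent0 \<A>. x \<in> fst c \<longrightarrow> b (snd c x, \<xi> c) = h (snd c x) * ?\<sigma> (x, \<xi>)"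
    using principal_symbol_local[OF A c] by (elim exE conjE)
  have h0: "h (snd c x) \<noteq> 0" using h0' r by simp
  have eq: "b (snd c x, \<xi> c) = h (snd c x) * ?\<sigma> (x, \<xi>)" if "(x, \<xi>)\<in>cotangent0 \<A>" "x \<in> fst c" for x \<xi>
    using eq' that by auto
  have "h (snd c x) * ?\<sigma> (x, \<lambda>c. t *\<^sub>R \<xi> c) = complex_of_real (t powr d) * (h (snd c x) * ?\<sigma> (x, \<xi>))"
    using eq[OF p(1) c(3)] eq[OF q c(3)] hom p(2) t by auto
  then show ?thesis using h0 by auto
qed

section \<open>Charts and derivatives\<close>

lemma is_chartD:
  assumes "is_chart c"
  shows "open (fst c)" "open (snd c ` fst c)" "continuous_on (fst c) (snd c)" "inj_on (snd c) (fst c)"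
    "continuous_on (snd c ` fst c) (inv_into (fst c) (snd c))"
    "\<And>U. open U \<Longrightarrow> U \<subseteq> fst c \<Longrightarrow> open (snd c ` U)"
proof -
  have h: "homeomorphism (fst c) (snd c ` fst c) (snd c) (inv_into (fst c) (snd c))"
    and o: "open (fst c)" "open (snd c ` fst c)"
    using assms by (auto simp: is_chart_def)
  show "open (fst c)" "open (snd c ` fst c)" by fact+
  show "continuous_on (fst c) (snd c)" "continuous_on (snd c ` fst c) (inv_into (fst c) (snd c))"
    using h by (auto simp: homeomorphism_def)
  show "inj_on (snd c) (fst c)" using h by (metis homeomorphism_def inj_on_inverseI)
  fix U assume U: "open U" "U \<subseteq> fst c"
  then have "openin (top_of_set (fst c)) U" by (simp add: openin_open_eq o)
  then have "openin (top_of_set (snd c ` fst c)) (snd c ` U)"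
    by (rule homeomorphism_imp_open_map[OF h])
  then show "open (snd c ` U)" using o(2) openin_open_trans by blast
qed

text \<open>
  Continuously differentiable maps. The symbol of a nonlocal operator involves first derivatives of
  the iterates of \<open>g\<close> only, and this class is closed under composition by the chain rule.
\<close>

definition diff_map :: "'m::t2_space chart set \<Rightarrow> ('m \<Rightarrow> 'm) \<Rightarrow> bool" where
  "diff_map \<A> h \<longleftrightarrow> continuous_on UNIV h \<and>
     (\<forall>c\<in>\<A>. \<forall>c'\<in>\<A>. \<forall>x. x \<in> fst c \<and> h x \<in> fst c' \<longrightarrow>
        in_charts c c' h differentiable at (snd c x) \<and> isCont (dmat c c' h) x)"

lemma matrix_apply_isCont:
  fixes f :: "'a::t2_space \<Rightarrow> real^'n \<Rightarrow> real^'m"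
  assumes "\<And>v. isCont (\<lambda>x. f x v) x"
  shows "isCont (\<lambda>x. matrix (f x)) x"
  unfolding isCont_def matrix_def
  by (intro tendsto_vec_lambda tendsto_vec_nth assms[unfolded isCont_def])

lemma tendsto_matrix_mult [tendsto_intros]:
  fixes A :: "'a \<Rightarrow> real^'n^'k" and B :: "'a \<Rightarrow> real^'l^'n"
  assumes "(A \<longlongrightarrow> a) F" "(B \<longlongrightarrow> b) F"
  shows "((\<lambda>x. A x ** B x) \<longlongrightarrow> a ** b) F"
  unfolding matrix_matrix_mult_def
  by (intro tendsto_vec_lambda tendsto_sum tendsto_mult tendsto_vec_nth assms)

lemma tendsto_matrix_vector_mult [tendsto_intros]:
  fixes A :: "'a \<Rightarrow> real^'n^'k" and v :: "'a \<Rightarrow> real^'n"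
  assumes "(A \<longlongrightarrow> a) F" "(v \<longlongrightarrow> w) F"
  shows "((\<lambda>x. A x *v v x) \<longlongrightarrow> a *v w) F"
  unfolding matrix_vector_mult_def
  by (intro tendsto_vec_lambda tendsto_sum tendsto_mult tendsto_vec_nth assms)

lemma tendsto_transpose [tendsto_intros]:
  fixes A :: "'a \<Rightarrow> real^'n^'k"
  assumes "(A \<longlongrightarrow> a) F"
  shows "((\<lambda>x. transpose (A x)) \<longlongrightarrow> transpose a) F"
  unfolding transpose_def
  by (intro tendsto_vec_lambda tendsto_vec_nth assms)

locale surface =
  fixes \<A> :: "'m::t2_space chart set"
  assumes smooth_structure: "smooth_structure \<A>"
begin

lemma is_chart: "c \<in> \<A> \<Longrightarrow> is_chart c"
  using smooth_structure by (auto simp: smooth_structure_def)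

lemmas chartD = is_chartD[OF is_chart]

lemma chart_at: "chart_at \<A> x \<in> \<A>" "x \<in> fst (chart_at \<A> x)"
proof -
  have "x \<in> (\<Union>c\<in>\<A>. fst c)" using smooth_structure by (auto simp: smooth_structure_def)
  then have "\<exists>c. c \<in> \<A> \<and> x \<in> fst c" by blast
  from someI_ex[OF this] show "chart_at \<A> x \<in> \<A>" "x \<in> fst (chart_at \<A> x)"
    by (auto simp: chart_at_def)
qed

lemma chart_isCont: "c \<in> \<A> \<Longrightarrow> x \<in> fst c \<Longrightarrow> isCont (snd c) x"
  using chartD(1,3) by (metis continuous_on_eq_continuous_at)

lemma smooth_map_imp_diff_map:
  assumes "smooth_map \<A> h" shows "diff_map \<A> h"
  unfolding diff_map_def
proof (intro conjI ballI allI impI)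
  show h: "continuous_on UNIV h" using assms by (simp add: smooth_map_def)
  fix c c' x assume c: "c \<in> \<A>" "c' \<in> \<A>" and x: "x \<in> fst c \<and> h x \<in> fst c'"
  let ?U = "fst c \<inter> h -` fst c'" and ?f = "in_charts c c' h"
  have oU: "open ?U" using chartD(1)[OF c(1)] chartD(1)[OF c(2)] h by (auto intro!: open_Int open_vimage)
  have o: "open (snd c ` ?U)" by (rule chartD(6)[OF c(1) oU]) auto
  have "smooth_on (snd c ` ?U) ?f" using assms c by (auto simp: smooth_map_def)
  then have "Ck_on (Suc 0) (snd c ` ?U) ?f" by (simp add: smooth_on_def del: Ck_on.simps)
  then have d: "\<And>y. y \<in> snd c ` ?U \<Longrightarrow> ?f differentiable at y"
    and cont: "\<And>v. continuous_on (snd c ` ?U) (\<lambda>y. frechet_derivative ?f (at y) v)" by auto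
  show "?f differentiable at (snd c x)" using d x by blast
  have "isCont (\<lambda>x. frechet_derivative ?f (at (snd c x)) v) x" for v
  proof (rule isCont_o2[OF chart_isCont])
    show "isCont (\<lambda>y. frechet_derivative ?f (at y) v) (snd c x)"
      using cont[of v] o x by (metis (no_types, lifting) IntI continuous_on_eq_continuous_at imageI vimageI)
  qed (use c x in auto)
  then show "isCont (dmat c c' h) x"
    unfolding dmat_def jacobian_def by (rule matrix_apply_isCont)
qed

lemma diff_map_id: "diff_map \<A> (\<lambda>x. x)"
proof (rule smooth_map_imp_diff_map)
  show "smooth_map \<A> (\<lambda>x. x)"
    using smooth_structure by (auto simp: smooth_map_def smooth_structure_def compatible_def vimage_def)
qed

lemma dmat_has_derivative:
  assumes "diff_map \<A> h" "c \<in> \<A>" "c' \<in> \<A>" "x \<in> fst c" "h x \<in> fst c'"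
  shows "(in_charts c c' h has_derivative (\<lambda>v. dmat c c' h x *v v)) (at (snd c x))"
  using assms unfolding diff_map_def dmat_def jacobian_works[symmetric] by blast

lemma dmatI:
  assumes "(in_charts c c' h has_derivative (\<lambda>v. M *v v)) (at (snd c x))"
  shows "dmat c c' h x = M"
  unfolding dmat_def jacobian_def frechet_derivative_at[OF assms, symmetric]
  by (rule matrix_of_matrix_vector_mul)

lemma dmat_compose_derivative:
  assumes h1: "diff_map \<A> h1" and h2: "diff_map \<A> h2"
    and c: "c \<in> \<A>" "c' \<in> \<A>" "c'' \<in> \<A>" and x: "x \<in> fst c" "h1 x \<in> fst c'" "h2 (h1 x) \<in> fst c''"
  shows "(in_charts c c'' (\<lambda>x. h2 (h1 x)) has_derivative
      (\<lambda>v. (dmat c' c'' h2 (h1 x) ** dmat c c' h1 x) *v v)) (at (snd c x))"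
proof -
  have inv: "inv_into (fst e) (snd e) (snd e y) = y" if "e \<in> \<A>" "y \<in> fst e" for e y
    using chartD(4)[OF that(1)] that(2) by simp
  let ?U = "fst c \<inter> h1 -` fst c'"
  have "continuous_on UNIV h1" using h1 by (simp add: diff_map_def)
  then have oU: "open ?U" using chartD(1)[OF c(1)] chartD(1)[OF c(2)] by (auto intro!: open_Int open_vimage)
  have o: "open (snd c ` ?U)" by (rule chartD(6)[OF c(1) oU]) auto
  have d1: "(in_charts c c' h1 has_derivative (\<lambda>v. dmat c c' h1 x *v v)) (at (snd c x))"
    by (rule dmat_has_derivative[OF h1 c(1,2) x(1,2)])
  have v: "in_charts c c' h1 (snd c x) = snd c' (h1 x)" by (simp add: in_charts_def inv c x)
  have d2: "(in_charts c' c'' h2 has_derivative (\<lambda>v. dmat c' c'' h2 (h1 x) *v v)) (at (in_charts c c' h1 (snd c x)))"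
    unfolding v by (rule dmat_has_derivative[OF h2 c(2,3) x(2,3)])
  have "((\<lambda>y. in_charts c' c'' h2 (in_charts c c' h1 y)) has_derivative
     (\<lambda>v. dmat c' c'' h2 (h1 x) *v (dmat c c' h1 x *v v))) (at (snd c x))"
    by (rule has_derivative_compose[OF d1 d2])
  then have "((\<lambda>y. in_charts c' c'' h2 (in_charts c c' h1 y)) has_derivative
     (\<lambda>v. (dmat c' c'' h2 (h1 x) ** dmat c c' h1 x) *v v)) (at (snd c x))"
    by (simp add: matrix_vector_mul_assoc)
  then show ?thesis
  proof (rule has_derivative_transform_within_open[OF _ o])
    show "snd c x \<in> snd c ` ?U" using x by blast
    fix y assume "y \<in> snd c ` ?U"
    then obtain z where "y = snd c z" "z \<in> fst c" "h1 z \<in> fst c'" by blast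
    then show "in_charts c' c'' h2 (in_charts c c' h1 y) = in_charts c c'' (\<lambda>x. h2 (h1 x)) y"
      by (simp add: in_charts_def inv c)
  qed
qed

lemma dmat_compose:
  assumes "diff_map \<A> h1" "diff_map \<A> h2"
    "c \<in> \<A>" "c' \<in> \<A>" "c'' \<in> \<A>" "x \<in> fst c" "h1 x \<in> fst c'" "h2 (h1 x) \<in> fst c''"
  shows "dmat c c'' (\<lambda>x. h2 (h1 x)) x = dmat c' c'' h2 (h1 x) ** dmat c c' h1 x"
  by (rule dmatI[OF dmat_compose_derivative[OF assms]])

lemma diff_map_compose:
  assumes h1: "diff_map \<A> h1" and h2: "diff_map \<A> h2"
  shows "diff_map \<A> (\<lambda>x. h2 (h1 x))"
  unfolding diff_map_def
proof (intro conjI ballI allI impI)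
  have c1: "continuous_on UNIV h1" and c2: "continuous_on UNIV h2" using h1 h2 by (auto simp: diff_map_def)
  then show "continuous_on UNIV (\<lambda>x. h2 (h1 x))"
    by (auto intro: continuous_on_compose2)
  fix c c'' x assume c: "c \<in> \<A>" "c'' \<in> \<A>" and x: "x \<in> fst c \<and> h2 (h1 x) \<in> fst c''"
  define c' where "c' = chart_at \<A> (h1 x)"
  have c': "c' \<in> \<A>" "h1 x \<in> fst c'" using chart_at by (auto simp: c'_def)
  show "in_charts c c'' (\<lambda>x. h2 (h1 x)) differentiable at (snd c x)"
    using dmat_compose_derivative[OF h1 h2 c(1) c'(1) c(2) _ c'(2)] x unfolding differentiable_def by blast
  let ?U = "fst c \<inter> h1 -` fst c' \<inter> (\<lambda>x. h2 (h1 x)) -` fst c''"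
  have "open ?U"
    using chartD(1) c c' c1 \<open>continuous_on UNIV (\<lambda>x. h2 (h1 x))\<close> by (intro open_Int open_vimage) auto
  then have ev: "\<forall>\<^sub>F y in nhds x. y \<in> ?U" using x c' by (intro eventually_nhds_in_open) auto
  have "isCont (\<lambda>x. dmat c' c'' h2 (h1 x) ** dmat c c' h1 x) x"
    unfolding isCont_def
  proof (intro tendsto_matrix_mult)
    have "isCont (\<lambda>x. dmat c' c'' h2 (h1 x)) x"
      by (rule isCont_o2[of x h1 "dmat c' c'' h2"]) (use c1 h2 c c' x in \<open>auto simp: continuous_on_eq_continuous_at diff_map_def\<close>)
    then show "((\<lambda>x. dmat c' c'' h2 (h1 x)) \<longlongrightarrow> dmat c' c'' h2 (h1 x)) (at x)"
      by (simp add: isCont_def)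
    show "(dmat c c' h1 \<longlongrightarrow> dmat c c' h1 x) (at x)"
      using h1 c c' x by (auto simp: diff_map_def isCont_def)
  qed
  moreover have "\<forall>\<^sub>F y in nhds x. dmat c c'' (\<lambda>x. h2 (h1 x)) y = dmat c' c'' h2 (h1 y) ** dmat c c' h1 y"
    using ev by eventually_elim (use dmat_compose[OF h1 h2 c(1) c'(1) c(2)] in auto)
  ultimately show "isCont (dmat c c'' (\<lambda>x. h2 (h1 x))) x"
    by (simp add: isCont_cong)
qed

lemma dmat_id:
  assumes "c \<in> \<A>" "x \<in> fst c"
  shows "dmat c c (\<lambda>x. x) x = mat 1"
proof (rule dmatI, rule has_derivative_transform_within_open[of "\<lambda>x. x" _ _ _ "snd c ` fst c"])
  show "((\<lambda>x. x) has_derivative (\<lambda>v. mat 1 *v v)) (at (snd c x))"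
    by (simp add: has_derivative_ident)
  show "open (snd c ` fst c)" by (rule chartD(2)[OF assms(1)])
  show "y \<in> snd c ` fst c \<Longrightarrow> y = in_charts c c (\<lambda>x. x) y" for y
    by (simp add: in_charts_def f_inv_into_f)
qed (use assms in auto)

definition diff_iso :: "('m \<Rightarrow> 'm) \<Rightarrow> bool" where
  "diff_iso h \<longleftrightarrow> bij h \<and> diff_map \<A> h \<and> diff_map \<A> (inv h)"

lemma diff_iso_inv: "diff_iso h \<Longrightarrow> diff_iso (inv h)"
  by (simp add: diff_iso_def bij_imp_bij_inv inv_inv_eq)

lemma diff_iso_inv_apply: "diff_iso h \<Longrightarrow> inv h (h x) = x" "diff_iso h \<Longrightarrow> h (inv h x) = x"
  by (simp_all add: diff_iso_def bij_is_inj bij_is_surj surj_f_inv_f)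

lemma diff_iso_id: "diff_iso (\<lambda>x. x)"
  using diff_map_id by (simp add: diff_iso_def inv_id[unfolded id_def] bij_id[unfolded id_def])

lemma diff_iso_compose:
  assumes "diff_iso h1" "diff_iso h2" shows "diff_iso (\<lambda>x. h2 (h1 x))"
proof -
  have b: "bij (\<lambda>x. h2 (h1 x))"
    using assms bij_comp[of h1 h2] by (simp add: diff_iso_def o_def)
  have "inv (\<lambda>x. h2 (h1 x)) = (\<lambda>x. inv h1 (inv h2 x))"
    using assms o_inv_distrib[of h2 h1] by (simp add: diff_iso_def o_def)
  then show ?thesis using assms b by (simp add: diff_iso_def diff_map_compose)
qed

lemma diffeo_imp_diff_iso: "diffeo \<A> h \<Longrightarrow> diff_iso h"
  by (simp add: diffeo_def diff_iso_def smooth_map_imp_diff_map)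

text \<open>
  The codifferential is expressed below by the derivative of the inverse map instead of the inverse
  matrix of the derivative; continuity is then immediate, and composition is the chain rule.
\<close>

lemma dmat_inverse:
  assumes h: "diff_iso h" and c: "c \<in> \<A>" "c' \<in> \<A>" "x \<in> fst c" "h x \<in> fst c'"
  shows "dmat c' c (inv h) (h x) ** dmat c c' h x = mat 1"
    and "dmat c c' h x ** dmat c' c (inv h) (h x) = mat 1"
proof -
  have "dmat c' c (inv h) (h x) ** dmat c c' h x = dmat c c (\<lambda>x. inv h (h x)) x"
    using h c by (intro dmat_compose[symmetric]) (auto simp: diff_iso_def diff_iso_inv_apply[OF h])
  then show 1: "dmat c' c (inv h) (h x) ** dmat c c' h x = mat 1"
    using c by (simp add: diff_iso_inv_apply[OF h] dmat_id)
  then show "dmat c c' h x ** dmat c' c (inv h) (h x) = mat 1"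
    using matrix_left_right_inverse by blast
qed

end

section \<open>Integer iterates\<close>

context
  fixes S :: "'a set" and f :: "'a \<Rightarrow> 'a"
  assumes bij: "bij_betw f S S"
begin

lemma int_iter_in: "x \<in> S \<Longrightarrow> int_iter S f n x \<in> S"
proof -
  assume x: "x \<in> S"
  have "(f ^^ k) x \<in> S" for k using x bij by (induction k) (auto simp: bij_betw_def)
  moreover have "(inv_into S f ^^ k) x \<in> S" for k
    using x bij by (induction k) (auto simp: bij_betw_def intro: inv_into_into)
  ultimately show ?thesis by (simp add: int_iter_def)
qed

lemma int_iter_succ:
  assumes x: "x \<in> S" shows "int_iter S f (n + 1) x = f (int_iter S f n x)"
proof (cases "0 \<le> n")
  case True
  then have "nat (n + 1) = Suc (nat n)" by simp
  then show ?thesis using True by (simp add: int_iter_def)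
next
  case False
  then obtain k where k: "n = - int (Suc k)" by (metis int_cases not_le of_nat_0_le_iff)
  have in': "(inv_into S f ^^ k) x \<in> S" for k
    using x bij by (induction k) (auto simp: bij_betw_def intro: inv_into_into)
  have "int_iter S f (n + 1) x = (inv_into S f ^^ k) x" unfolding k by (cases k) (auto simp: int_iter_def nat_add_distrib)
  also have "\<dots> = f (inv_into S f ((inv_into S f ^^ k) x))"
    using in'[of k] bij by (simp add: bij_betw_def f_inv_into_f)
  also have "inv_into S f ((inv_into S f ^^ k) x) = int_iter S f n x"
    unfolding k by (simp add: int_iter_def nat_add_distrib)
  finally show ?thesis .
qed

lemma int_iter_0: "int_iter S f 0 x = x"
  by (simp add: int_iter_def)

lemma int_iter_pred:
  assumes x: "x \<in> S" shows "int_iter S f (n - 1) x = inv_into S f (int_iter S f n x)"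
  using int_iter_succ[OF x, of "n - 1"] int_iter_in[OF x, of "n - 1"] bij
  by (simp add: bij_betw_def)

lemma int_iter_add:
  assumes x: "x \<in> S" shows "int_iter S f (n + m) x = int_iter S f n (int_iter S f m x)"
proof (induction n rule: int_induct[where k=0])
  case base then show ?case by (simp add: int_iter_0)
next
  case (step1 i)
  have eq: "i + 1 + m = i + m + 1" by simp
  show ?case unfolding eq using step1 int_iter_succ[OF x, of "i + m"] int_iter_succ[OF int_iter_in[OF x], of i m] by simp
next
  case (step2 i)
  have eq: "i - 1 + m = i + m - 1" by simp
  show ?case unfolding eq using step2 int_iter_pred[OF x, of "i + m"] int_iter_pred[OF int_iter_in[OF x], of i m] by simp
qed

end

section \<open>The cotangent bundle and the codifferential\<close>

text \<open>
  This rule would replace products with transposed matrices by row-vector products, for which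
  composition laws are less convenient.
\<close>

declare transpose_matrix_vector [simp del]

lemma matrix_inv_unique:
  fixes A :: "real^'n^'n"
  assumes "A ** B = mat 1" "B ** A = mat 1"
  shows "matrix_inv A = B"
proof -
  have "A ** matrix_inv A = mat 1 \<and> matrix_inv A ** A = mat 1"
    unfolding matrix_inv_def using assms by (rule_tac someI[of "\<lambda>A'. A ** A' = mat 1 \<and> A' ** A = mat 1" B]) simp
  then have inv: "A ** matrix_inv A = mat 1" ..
  have "matrix_inv A = (B ** A) ** matrix_inv A" unfolding assms(2) by simp
  also have "\<dots> = B ** (A ** matrix_inv A)" by (rule matrix_mul_assoc[symmetric])
  also have "\<dots> = B" unfolding inv by simp
  finally show ?thesis .
qed

context surface
begin

lemma cotangent_coord:
  assumes "\<xi> \<in> cotangent \<A> x" "c \<in> \<A>" "c' \<in> \<A>" "x \<in> fst c" "x \<in> fst c'"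
  shows "\<xi> c' = transpose (dmat c' c (\<lambda>y. y) x) *v \<xi> c"
  using assms unfolding cotangent_def by blast

lemma cotangent_eqI:
  assumes \<xi>: "\<xi> \<in> cotangent \<A> x" and \<eta>: "\<eta> \<in> cotangent \<A> x" and c: "c \<in> \<A>" "x \<in> fst c" and eq: "\<xi> c = \<eta> c"
  shows "\<xi> = \<eta>"
proof
  fix c'
  show "\<xi> c' = \<eta> c'"
  proof (cases "c' \<in> \<A> \<and> x \<in> fst c'")
    case True
    then show ?thesis using cotangent_coord[OF \<xi> c(1) _ c(2)] cotangent_coord[OF \<eta> c(1) _ c(2)] eq by simp
  next
    case False
    have "\<xi> c' = 0" using \<xi> False unfolding cotangent_def by blast
    moreover have "\<eta> c' = 0" using \<eta> False unfolding cotangent_def by blast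
    ultimately show ?thesis by simp
  qed
qed

lemma zero_cotangent: "(\<lambda>_. 0) \<in> cotangent \<A> x"
  unfolding cotangent_def by simp

lemma cotangent0_iff_coord:
  assumes c: "c \<in> \<A>" "x \<in> fst c"
  shows "(x, \<xi>) \<in> cotangent0 \<A> \<longleftrightarrow> \<xi> \<in> cotangent \<A> x \<and> \<xi> c \<noteq> 0"
proof -
  have "\<xi> c = 0 \<longleftrightarrow> \<xi> = (\<lambda>_. 0)" if "\<xi> \<in> cotangent \<A> x"
    using cotangent_eqI[OF that zero_cotangent c] by auto
  then show ?thesis by (auto simp: cotangent0_def)
qed

text \<open>
  The covector at \<open>x\<close> with given coordinates in one chart; the transformation law dictates its
  coordinates in the others.
\<close>

definition covector :: "'m chart \<Rightarrow> 'm \<Rightarrow> real^2 \<Rightarrow> 'm covector" where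
  "covector c x \<eta> = (\<lambda>c'. if c' \<in> \<A> \<and> x \<in> fst c' then transpose (dmat c' c (\<lambda>y. y) x) *v \<eta> else 0)"

lemma covector:
  assumes c: "c \<in> \<A>" "x \<in> fst c"
  shows "covector c x \<eta> \<in> cotangent \<A> x" "covector c x \<eta> c = \<eta>"
proof -
  show "covector c x \<eta> c = \<eta>" using c by (simp add: covector_def dmat_id transpose_mat)
  have law: "transpose (dmat c2 c (\<lambda>y. y) x) *v \<eta> = transpose (dmat c2 c1 (\<lambda>y. y) x) *v (transpose (dmat c1 c (\<lambda>y. y) x) *v \<eta>)"
    if "c1 \<in> \<A>" "c2 \<in> \<A>" "x \<in> fst c1" "x \<in> fst c2" for c1 c2
    using dmat_compose[OF diff_map_id diff_map_id that(2,1) c(1) that(4) that(3) c(2)]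
    by (simp add: matrix_transpose_mul matrix_vector_mul_assoc)
  show "covector c x \<eta> \<in> cotangent \<A> x"
    unfolding cotangent_def
  proof (intro CollectI conjI ballI allI impI)
    fix c1 c2 assume "c1 \<in> \<A>" "c2 \<in> \<A>" "x \<in> fst c1 \<and> x \<in> fst c2"
    then show "covector c x \<eta> c2 = transpose (dmat c2 c1 (\<lambda>y. y) x) *v covector c x \<eta> c1"
      using law[of c1 c2] by (simp only: covector_def simp_thms if_True)
  next
    fix c' assume "\<not> (c' \<in> \<A> \<and> x \<in> fst c')"
    then show "covector c x \<eta> c' = 0" by (simp only: covector_def if_False)
  qed
qed

text \<open>
  The coordinates of the image covector do not depend on the chart that is used at the source. This
  form is the basis for all further computations with the codifferential.
\<close>

lemma codiff_coord:
  assumes h: "diff_iso h" and \<xi>: "\<xi> \<in> cotangent \<A> x"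
    and c: "c \<in> \<A>" "c' \<in> \<A>" "x \<in> fst c" "h x \<in> fst c'"
  shows "snd (codiff \<A> h (x, \<xi>)) c' = transpose (dmat c' c (inv h) (h x)) *v \<xi> c"
proof -
  let ?c = "chart_at \<A> x"
  let ?A = "transpose (dmat ?c c' h x)" and ?B = "transpose (dmat c' ?c (inv h) (h x))"
  have "?A ** ?B = mat 1" "?B ** ?A = mat 1"
    unfolding matrix_transpose_mul[symmetric] using dmat_inverse[OF h chart_at(1) c(2) chart_at(2) c(4)]
    by (simp_all add: transpose_mat)
  then have 1: "matrix_inv ?A = ?B" by (rule matrix_inv_unique)
  have "dmat c' c (\<lambda>x. inv h x) (h x) = dmat ?c c (\<lambda>y. y) (inv h (h x)) ** dmat c' ?c (inv h) (h x)"
    using h c chart_at[of x] by (intro dmat_compose[of "inv h" "\<lambda>y. y"]) (auto simp: diff_iso_def diff_map_id diff_iso_inv_apply[OF h])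
  then have 2: "transpose (dmat c' c (inv h) (h x)) = ?B ** transpose (dmat ?c c (\<lambda>y. y) x)"
    by (simp add: matrix_transpose_mul diff_iso_inv_apply[OF h])
  have "snd (codiff \<A> h (x, \<xi>)) c' = ?B *v \<xi> ?c"
    using c by (simp add: codiff_def 1)
  also have "\<xi> ?c = transpose (dmat ?c c (\<lambda>y. y) x) *v \<xi> c"
    by (rule cotangent_coord[OF \<xi> c(1) chart_at(1) c(3) chart_at(2)])
  finally show ?thesis unfolding 2 by (simp add: matrix_vector_mul_assoc)
qed

lemma fst_codiff [simp]: "fst (codiff \<A> h p) = h (fst p)"
  by (simp add: codiff_def split: prod.split)

lemma codiff_cotangent:
  assumes h: "diff_iso h" and \<xi>: "\<xi> \<in> cotangent \<A> x"
  shows "snd (codiff \<A> h (x, \<xi>)) \<in> cotangent \<A> (h x)"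
  unfolding cotangent_def
proof (intro CollectI conjI ballI allI impI)
  fix c c' assume c: "c \<in> \<A>" "c' \<in> \<A>" and x: "h x \<in> fst c \<and> h x \<in> fst c'"
  let ?c = "chart_at \<A> x"
  have "dmat c' ?c (\<lambda>y. inv h y) (h x) = dmat c ?c (inv h) (h x) ** dmat c' c (\<lambda>y. y) (h x)"
    using h c x chart_at[of x] by (intro dmat_compose[of "\<lambda>y. y" "inv h"]) (auto simp: diff_iso_def diff_map_id diff_iso_inv_apply[OF h])
  then have "transpose (dmat c' ?c (inv h) (h x)) = transpose (dmat c' c (\<lambda>y. y) (h x)) ** transpose (dmat c ?c (inv h) (h x))"
    by (simp add: matrix_transpose_mul)
  then show "snd (codiff \<A> h (x, \<xi>)) c' = transpose (dmat c' c (\<lambda>y. y) (h x)) *v snd (codiff \<A> h (x, \<xi>)) c"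
    using codiff_coord[OF h \<xi> chart_at(1) c(2) chart_at(2)] codiff_coord[OF h \<xi> chart_at(1) c(1) chart_at(2)] x
    by (simp add: matrix_vector_mul_assoc)
next
  fix c assume "\<not> (c \<in> \<A> \<and> h x \<in> fst c)"
  then show "snd (codiff \<A> h (x, \<xi>)) c = 0" by (auto simp: codiff_def)
qed

lemma codiff_compose:
  assumes h1: "diff_iso h1" and h2: "diff_iso h2" and p: "snd p \<in> cotangent \<A> (fst p)"
  shows "codiff \<A> (\<lambda>x. h2 (h1 x)) p = codiff \<A> h2 (codiff \<A> h1 p)"
proof -
  obtain x \<xi> where px: "p = (x, \<xi>)" by (cases p)
  with p have \<xi>: "\<xi> \<in> cotangent \<A> x" by simp
  let ?c = "chart_at \<A> x" and ?c' = "chart_at \<A> (h1 x)" and ?c'' = "chart_at \<A> (h2 (h1 x))"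
  have h: "diff_iso (\<lambda>x. h2 (h1 x))" by (rule diff_iso_compose[OF h1 h2])
  note \<xi>1 = codiff_cotangent[OF h1 \<xi>]
  have e: "codiff \<A> h1 (x, \<xi>) = (h1 x, snd (codiff \<A> h1 (x, \<xi>)))" by (simp add: prod_eq_iff)
  have inv: "inv (\<lambda>x. h2 (h1 x)) = (\<lambda>x. inv h1 (inv h2 x))"
    using h1 h2 o_inv_distrib[of h2 h1] by (simp add: diff_iso_def o_def)
  have "snd (codiff \<A> (\<lambda>x. h2 (h1 x)) (x, \<xi>)) = snd (codiff \<A> h2 (h1 x, snd (codiff \<A> h1 (x, \<xi>))))"
  proof (rule cotangent_eqI[OF codiff_cotangent[OF h \<xi>] codiff_cotangent[OF h2 \<xi>1] chart_at])
    have "dmat ?c'' ?c (\<lambda>x. inv h1 (inv h2 x)) (h2 (h1 x)) = dmat ?c' ?c (inv h1) (inv h2 (h2 (h1 x))) ** dmat ?c'' ?c' (inv h2) (h2 (h1 x))"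
      using h1 h2 chart_at by (intro dmat_compose) (auto simp: diff_iso_def diff_iso_inv_apply[OF h1] diff_iso_inv_apply[OF h2])
    then have "dmat ?c'' ?c (inv (\<lambda>x. h2 (h1 x))) (h2 (h1 x)) = dmat ?c' ?c (inv h1) (h1 x) ** dmat ?c'' ?c' (inv h2) (h2 (h1 x))"
      unfolding inv by (simp add: diff_iso_inv_apply[OF h2])
    then show "snd (codiff \<A> (\<lambda>x. h2 (h1 x)) (x, \<xi>)) ?c'' = snd (codiff \<A> h2 (h1 x, snd (codiff \<A> h1 (x, \<xi>)))) ?c''"
      using codiff_coord[OF h \<xi> chart_at(1) chart_at(1) chart_at(2) chart_at(2)]
        codiff_coord[OF h2 \<xi>1 chart_at(1) chart_at(1) chart_at(2) chart_at(2)]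
        codiff_coord[OF h1 \<xi> chart_at(1) chart_at(1) chart_at(2) chart_at(2)]
      by (simp add: matrix_transpose_mul matrix_vector_mul_assoc)
  qed
  then show ?thesis unfolding px by (simp add: prod_eq_iff flip: e)
qed

lemma codiff_id:
  assumes p: "snd p \<in> cotangent \<A> (fst p)"
  shows "codiff \<A> (\<lambda>x. x) p = p"
proof -
  obtain x \<xi> where px: "p = (x, \<xi>)" by (cases p)
  with p have \<xi>: "\<xi> \<in> cotangent \<A> x" by simp
  have inv: "inv (\<lambda>x::'m. x) = (\<lambda>x. x)" by (simp add: inv_id[unfolded id_def])
  have "snd (codiff \<A> (\<lambda>x. x) (x, \<xi>)) = \<xi>"
    by (rule cotangent_eqI[OF codiff_cotangent[OF diff_iso_id \<xi>] \<xi> chart_at])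
       (use codiff_coord[OF diff_iso_id \<xi> chart_at(1) chart_at(1) chart_at(2) chart_at(2)] in
         \<open>simp add: inv dmat_id chart_at transpose_mat\<close>)
  then show ?thesis by (simp add: px prod_eq_iff)
qed

lemma cotangent0D: "p \<in> cotangent0 \<A> \<Longrightarrow> snd p \<in> cotangent \<A> (fst p)"
  by (auto simp: cotangent0_def)

lemma codiff_inverse:
  assumes h: "diff_iso h" and p: "p \<in> cotangent0 \<A>"
  shows "codiff \<A> (inv h) (codiff \<A> h p) = p" "codiff \<A> h (codiff \<A> (inv h) p) = p"
  using codiff_compose[OF h diff_iso_inv[OF h] cotangent0D[OF p]] codiff_compose[OF diff_iso_inv[OF h] h cotangent0D[OF p]]
    codiff_id[OF cotangent0D[OF p]] by (simp_all add: diff_iso_inv_apply[OF h])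

lemma codiff_cotangent0:
  assumes h: "diff_iso h" and p: "p \<in> cotangent0 \<A>"
  shows "codiff \<A> h p \<in> cotangent0 \<A>"
proof -
  obtain x \<xi> where px: "p = (x, \<xi>)" by (cases p)
  have \<xi>: "\<xi> \<in> cotangent \<A> x" using cotangent0D[OF p] px by simp
  let ?c = "chart_at \<A> x" and ?c' = "chart_at \<A> (h x)"
  have "snd (codiff \<A> h (x, \<xi>)) \<noteq> (\<lambda>_. 0)"
  proof
    assume z: "snd (codiff \<A> h (x, \<xi>)) = (\<lambda>_. 0)"
    have "transpose (dmat ?c ?c' h x) ** transpose (dmat ?c' ?c (inv h) (h x)) = mat 1"
      unfolding matrix_transpose_mul[symmetric] using dmat_inverse[OF h chart_at(1) chart_at(1) chart_at(2) chart_at(2), of x]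
      by (simp add: transpose_mat)
    then have "\<xi> ?c = transpose (dmat ?c ?c' h x) *v (transpose (dmat ?c' ?c (inv h) (h x)) *v \<xi> ?c)"
      by (simp add: matrix_vector_mul_assoc)
    also have "\<dots> = 0"
      using codiff_coord[OF h \<xi> chart_at(1) chart_at(1) chart_at(2) chart_at(2)] z by simp
    finally show False using p cotangent0_iff_coord[OF chart_at] px by blast
  qed
  then have "(h x, snd (codiff \<A> h (x, \<xi>))) \<in> cotangent0 \<A>"
    using codiff_cotangent[OF h \<xi>] by (simp add: cotangent0_def)
  then show ?thesis unfolding px by (metis fst_codiff fst_conv prod.collapse)
qed

lemma codiff_bij:
  assumes h: "diff_iso h" shows "bij_betw (codiff \<A> h) (cotangent0 \<A>) (cotangent0 \<A>)"
  by (rule bij_betwI[where g="codiff \<A> (inv h)"])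
     (auto simp: codiff_inverse[OF h] codiff_cotangent0[OF h] codiff_cotangent0[OF diff_iso_inv[OF h]])

lemma int_iter_diff_iso:
  assumes g: "diff_iso g" shows "diff_iso (int_iter UNIV g n)"
proof (induction n rule: int_induct[where k=0])
  have b: "bij_betw g UNIV UNIV" using g by (simp add: diff_iso_def)
  {
    case base then show ?case using diff_iso_id by (simp add: int_iter_def id_def)
  next
    case (step1 i)
    have "int_iter UNIV g (i + 1) = (\<lambda>x. g (int_iter UNIV g i x))"
      using int_iter_succ[OF b] by (simp add: fun_eq_iff)
    then show ?case using diff_iso_compose[OF step1(2) g] by simp
  next
    case (step2 i)
    have "int_iter UNIV g (i - 1) = (\<lambda>x. inv g (int_iter UNIV g i x))"
      using int_iter_pred[OF b] by (simp add: fun_eq_iff)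
    then show ?case using diff_iso_compose[OF step2(2) diff_iso_inv[OF g]] by simp
  }
qed

text \<open>
  By functoriality the iterates of the codifferential, forward and backward, are codifferentials of
  iterates. So \<open>codiff_coord\<close> describes all of them at once.
\<close>

lemma codiff_iter_eq:
  assumes g: "diff_iso g" and p: "p \<in> cotangent0 \<A>"
  shows "codiff_iter \<A> g n p = codiff \<A> (int_iter UNIV g n) p"
proof (induction n rule: int_induct[where k=0])
  have b: "bij_betw g UNIV UNIV" using g by (simp add: diff_iso_def)
  note B = codiff_bij[OF g]
  {
    case base then show ?case using codiff_id[OF cotangent0D[OF p]] by (simp add: codiff_iter_def int_iter_def id_def)
  next
    case (step1 i)
    have "int_iter UNIV g (i + 1) = (\<lambda>x. g (int_iter UNIV g i x))"
      using int_iter_succ[OF b] by (simp add: fun_eq_iff)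
    then show ?case using step1 int_iter_succ[OF B p, of i] codiff_compose[OF int_iter_diff_iso[OF g] g cotangent0D[OF p]]
      by (simp add: codiff_iter_def)
  next
    case (step2 i)
    have e: "int_iter UNIV g (i - 1) = (\<lambda>x. inv g (int_iter UNIV g i x))"
      using int_iter_pred[OF b] by (simp add: fun_eq_iff)
    have q: "codiff \<A> (int_iter UNIV g i) p \<in> cotangent0 \<A>" by (rule codiff_cotangent0[OF int_iter_diff_iso[OF g] p])
    have "codiff_iter \<A> g (i - 1) p = inv_into (cotangent0 \<A>) (codiff \<A> g) (codiff \<A> (int_iter UNIV g i) p)"
      using step2 int_iter_pred[OF B p, of i] by (simp add: codiff_iter_def)
    also have "\<dots> = codiff \<A> (inv g) (codiff \<A> (int_iter UNIV g i) p)"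
      using B q by (intro inv_into_f_eq) (auto simp: bij_betw_def codiff_inverse[OF g] codiff_cotangent0[OF diff_iso_inv[OF g]])
    also have "\<dots> = codiff \<A> (int_iter UNIV g (i - 1)) p"
      unfolding e by (rule codiff_compose[OF int_iter_diff_iso[OF g] diff_iso_inv[OF g] cotangent0D[OF p], symmetric])
    finally show ?case .
  }
qed

lemma codiff_iter_cotangent0: "diff_iso g \<Longrightarrow> p \<in> cotangent0 \<A> \<Longrightarrow> codiff_iter \<A> g n p \<in> cotangent0 \<A>"
  by (simp add: codiff_iter_eq codiff_cotangent0 int_iter_diff_iso)

lemma codiff_iter_add:
  "diff_iso g \<Longrightarrow> p \<in> cotangent0 \<A> \<Longrightarrow> codiff_iter \<A> g (n + m) p = codiff_iter \<A> g n (codiff_iter \<A> g m p)"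
  unfolding codiff_iter_def by (rule int_iter_add[OF codiff_bij])

lemma fst_codiff_iter: "diff_iso g \<Longrightarrow> p \<in> cotangent0 \<A> \<Longrightarrow> fst (codiff_iter \<A> g n p) = int_iter UNIV g n (fst p)"
  by (simp add: codiff_iter_eq)

subsection \<open>Convergence of covectors\<close>

text \<open>
  Convergence in the cotangent bundle without the zero section: convergence of the base points and of
  the coordinates in every chart at the limit.
\<close>

definition cov_tendsto :: "('i \<Rightarrow> 'm \<times> 'm covector) \<Rightarrow> 'm \<times> 'm covector \<Rightarrow> 'i filter \<Rightarrow> bool" where
  "cov_tendsto f p F \<longleftrightarrow> p \<in> cotangent0 \<A> \<and> (\<forall>\<^sub>F j in F. f j \<in> cotangent0 \<A>) \<and>
     ((\<lambda>j. fst (f j)) \<longlongrightarrow> fst p) F \<and>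
     (\<forall>c\<in>\<A>. fst p \<in> fst c \<longrightarrow> ((\<lambda>j. snd (f j) c) \<longlongrightarrow> snd p c) F)"

lemma eventually_in_chart:
  assumes "((\<lambda>j. x j) \<longlongrightarrow> x0) F" "c \<in> \<A>" "x0 \<in> fst c"
  shows "\<forall>\<^sub>F j in F. x j \<in> fst c"
  using topological_tendstoD[OF assms(1) chartD(1)[OF assms(2)] assms(3)] .

lemma diff_map_tendsto:
  assumes "diff_map \<A> h" "(x \<longlongrightarrow> x0) F" shows "((\<lambda>j. h (x j)) \<longlongrightarrow> h x0) F"
  by (rule continuous_on_tendsto_compose[of UNIV h]) (use assms in \<open>auto simp: diff_map_def\<close>)

lemma dmat_tendsto:
  assumes "diff_map \<A> h" "(x \<longlongrightarrow> x0) F" "c \<in> \<A>" "c' \<in> \<A>" "x0 \<in> fst c" "h x0 \<in> fst c'"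
  shows "((\<lambda>j. dmat c c' h (x j)) \<longlongrightarrow> dmat c c' h x0) F"
  by (rule isCont_tendsto_compose[of x0 "dmat c c' h"]) (use assms in \<open>auto simp: diff_map_def\<close>)

lemma codiff_coord_tendsto:
  assumes h: "diff_iso h" and lim: "((\<lambda>j. fst (f j)) \<longlongrightarrow> fst p) F" "((\<lambda>j. snd (f j) c) \<longlongrightarrow> snd p c) F"
    and ev: "\<forall>\<^sub>F j in F. f j \<in> cotangent0 \<A>" and p: "p \<in> cotangent0 \<A>"
    and c: "c \<in> \<A>" "c' \<in> \<A>" "fst p \<in> fst c" "h (fst p) \<in> fst c'"
  shows "((\<lambda>j. snd (codiff \<A> h (f j)) c') \<longlongrightarrow> snd (codiff \<A> h p) c') F"
proof -
  have h1: "diff_map \<A> h" and h2: "diff_map \<A> (inv h)" using h by (auto simp: diff_iso_def)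
  have co: "snd (codiff \<A> h q) c' = transpose (dmat c' c (inv h) (h (fst q))) *v snd q c"
    if "q \<in> cotangent0 \<A>" "fst q \<in> fst c" "h (fst q) \<in> fst c'" for q
    using codiff_coord[OF h cotangent0D[OF that(1)] c(1,2) that(2,3)] by simp
  note hl = diff_map_tendsto[OF h1 lim(1)]
  have "((\<lambda>j. transpose (dmat c' c (inv h) (h (fst (f j)))) *v snd (f j) c) \<longlongrightarrow>
       transpose (dmat c' c (inv h) (h (fst p))) *v snd p c) F"
    by (intro tendsto_matrix_vector_mult tendsto_transpose dmat_tendsto[OF h2 hl] lim(2))
       (use c in \<open>auto simp: diff_iso_inv_apply[OF h]\<close>)
  moreover have "\<forall>\<^sub>F j in F. snd (codiff \<A> h (f j)) c' = transpose (dmat c' c (inv h) (h (fst (f j)))) *v snd (f j) c"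
    using ev eventually_in_chart[OF lim(1) c(1,3)] eventually_in_chart[OF hl c(2,4)]
    by eventually_elim (rule co)
  ultimately show ?thesis by (simp add: co[OF p c(3,4)] tendsto_cong)
qed

text \<open>
  One chart suffices, by continuity of the coordinate changes.
\<close>

lemma cov_tendstoI:
  assumes c: "c \<in> \<A>" "fst p \<in> fst c" and p: "p \<in> cotangent0 \<A>" and ev: "\<forall>\<^sub>F j in F. f j \<in> cotangent0 \<A>"
    and lim: "((\<lambda>j. fst (f j)) \<longlongrightarrow> fst p) F" "((\<lambda>j. snd (f j) c) \<longlongrightarrow> snd p c) F"
  shows "cov_tendsto f p F"
  unfolding cov_tendsto_def
proof (intro conjI ballI impI)
  fix c' assume c': "c' \<in> \<A>" "fst p \<in> fst c'"
  have "((\<lambda>j. snd (codiff \<A> (\<lambda>x. x) (f j)) c') \<longlongrightarrow> snd (codiff \<A> (\<lambda>x. x) p) c') F"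
    by (rule codiff_coord_tendsto[OF diff_iso_id lim ev p c(1) c'(1) c(2) c'(2)])
  moreover have "\<forall>\<^sub>F j in F. snd (codiff \<A> (\<lambda>x. x) (f j)) c' = snd (f j) c'"
    using ev by eventually_elim (simp add: codiff_id cotangent0D)
  ultimately show "((\<lambda>j. snd (f j) c') \<longlongrightarrow> snd p c') F"
    by (simp add: codiff_id cotangent0D p tendsto_cong)
qed (use p ev lim in auto)

lemma codiff_tendsto:
  assumes h: "diff_iso h" and f: "cov_tendsto f p F"
  shows "cov_tendsto (\<lambda>j. codiff \<A> h (f j)) (codiff \<A> h p) F"
proof -
  from f have p: "p \<in> cotangent0 \<A>" and ev: "\<forall>\<^sub>F j in F. f j \<in> cotangent0 \<A>"
    and lim: "((\<lambda>j. fst (f j)) \<longlongrightarrow> fst p) F" "((\<lambda>j. snd (f j) (chart_at \<A> (fst p))) \<longlongrightarrow> snd p (chart_at \<A> (fst p))) F"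
    using chart_at by (auto simp: cov_tendsto_def)
  show ?thesis
  proof (rule cov_tendstoI[of "chart_at \<A> (h (fst p))"])
    show "\<forall>\<^sub>F j in F. codiff \<A> h (f j) \<in> cotangent0 \<A>"
      using ev by eventually_elim (rule codiff_cotangent0[OF h])
    show "((\<lambda>j. fst (codiff \<A> h (f j))) \<longlongrightarrow> fst (codiff \<A> h p)) F"
      using diff_map_tendsto[OF _ lim(1), of h] h by (simp add: diff_iso_def)
    show "((\<lambda>j. snd (codiff \<A> h (f j)) (chart_at \<A> (h (fst p)))) \<longlongrightarrow> snd (codiff \<A> h p) (chart_at \<A> (h (fst p)))) F"
      by (rule codiff_coord_tendsto[OF h lim ev p chart_at(1) chart_at(1) chart_at(2) chart_at(2)])
  qed (use chart_at codiff_cotangent0[OF h p] in auto)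
qed

lemma codiff_iter_tendsto:
  assumes g: "diff_iso g" and f: "cov_tendsto f p F"
  shows "cov_tendsto (\<lambda>j. codiff_iter \<A> g n (f j)) (codiff_iter \<A> g n p) F"
proof -
  from f have p: "p \<in> cotangent0 \<A>" and ev: "\<forall>\<^sub>F j in F. f j \<in> cotangent0 \<A>" by (auto simp: cov_tendsto_def)
  let ?h = "int_iter UNIV g n"
  have t: "cov_tendsto (\<lambda>j. codiff \<A> ?h (f j)) (codiff \<A> ?h p) F"
    by (rule codiff_tendsto[OF int_iter_diff_iso[OF g] f])
  have ev': "\<forall>\<^sub>F j in F. codiff_iter \<A> g n (f j) = codiff \<A> ?h (f j)"
    using ev by eventually_elim (rule codiff_iter_eq[OF g])
  have "((\<lambda>j. fst (codiff_iter \<A> g n (f j))) \<longlongrightarrow> l) F \<longleftrightarrow> ((\<lambda>j. fst (codiff \<A> ?h (f j))) \<longlongrightarrow> l) F" for l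
    by (rule tendsto_cong) (use ev' in eventually_elim, simp)
  moreover have "((\<lambda>j. snd (codiff_iter \<A> g n (f j)) c) \<longlongrightarrow> l) F \<longleftrightarrow> ((\<lambda>j. snd (codiff \<A> ?h (f j)) c) \<longlongrightarrow> l) F" for l c
    by (rule tendsto_cong) (use ev' in eventually_elim, simp)
  moreover have "\<forall>\<^sub>F j in F. codiff_iter \<A> g n (f j) \<in> cotangent0 \<A>"
    using ev by eventually_elim (rule codiff_iter_cotangent0[OF g])
  ultimately show ?thesis using t codiff_iter_eq[OF g p, of n] unfolding cov_tendsto_def by simp
qed

end

section \<open>Norms of covectors, Jacobians and weights\<close>

lemma adjoint_dot:
  fixes A :: "real^'n^'m"
  shows "(transpose A *v x) \<bullet> y = x \<bullet> (A *v y)"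
  by (simp add: transpose_matrix_vector dot_lmul_matrix)

text \<open>
  The adjugate formula, which makes the continuity of inversion evident. The indices are those of a
  two-element type with \<open>3 - 1 = 2\<close> and \<open>3 - 2 = 1\<close>.
\<close>

lemma matrix_inv_2:
  fixes A :: "real^2^2"
  assumes "det A \<noteq> 0"
  shows "matrix_inv A = (1 / det A) *\<^sub>R (\<chi> i j. if i = j then A $ (3 - i) $ (3 - j) else - A $ i $ j)"
    (is "_ = _ *\<^sub>R ?B")
proof (rule matrix_inv_unique)
  have i: "(3 :: 2) - 1 = 2" "(3 :: 2) - 2 = 1" by simp_all
  have "A ** ?B = det A *\<^sub>R mat 1" "?B ** A = det A *\<^sub>R mat 1"
    by (simp_all add: vec_eq_iff forall_2 matrix_matrix_mult_def sum_2 mat_def det_2 i)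
  then show "A ** ((1 / det A) *\<^sub>R ?B) = mat 1" "((1 / det A) *\<^sub>R ?B) ** A = mat 1"
    using assms by (simp_all add: matrix_scalar_ac scalar_matrix_assoc[symmetric])
qed

lemma tendsto_matrix_inv_2:
  fixes A :: "'a \<Rightarrow> real^2^2"
  assumes A: "(A \<longlongrightarrow> a) F" and a: "det a \<noteq> 0"
  shows "((\<lambda>x. matrix_inv (A x)) \<longlongrightarrow> matrix_inv a) F"
proof -
  have d: "((\<lambda>x. det (A x)) \<longlongrightarrow> det a) F"
    unfolding det_2 by (intro tendsto_intros A)
  let ?B = "\<lambda>A :: real^2^2. (1 / det A) *\<^sub>R (\<chi> i j. if i = j then A $ (3 - i) $ (3 - j) else - A $ i $ j)"
  have "((\<lambda>x. if i = j then A x $ (3 - i) $ (3 - j) else - A x $ i $ j) \<longlongrightarrow> (if i = j then a $ (3 - i) $ (3 - j) else - a $ i $ j)) F" for i j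
    by (cases "i = j") (auto intro!: tendsto_intros A)
  then have "((\<lambda>x. ?B (A x)) \<longlongrightarrow> ?B a) F"
    using a by (intro tendsto_scaleR tendsto_divide tendsto_const d tendsto_vec_lambda) auto
  moreover have "\<forall>\<^sub>F x in F. det (A x) \<noteq> 0" by (rule tendsto_imp_eventually_ne[OF d a])
  then have "\<forall>\<^sub>F x in F. ?B (A x) = matrix_inv (A x)" by eventually_elim (rule matrix_inv_2[symmetric])
  ultimately have "((\<lambda>x. matrix_inv (A x)) \<longlongrightarrow> ?B a) F" by (rule Lim_transform_eventually)
  then show ?thesis using matrix_inv_2[OF a] by simp
qed

definition scale_covector :: "real \<Rightarrow> 'm \<times> 'm covector \<Rightarrow> 'm \<times> 'm covector" where
  "scale_covector t p = (fst p, \<lambda>c. t *\<^sub>R snd p c)"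

lemma fst_scale_covector [simp]: "fst (scale_covector t p) = fst p"
  and snd_scale_covector [simp]: "snd (scale_covector t p) = (\<lambda>c. t *\<^sub>R snd p c)"
  by (simp_all add: scale_covector_def)

context surface
begin

lemma scale_covector_cotangent0:
  assumes "p \<in> cotangent0 \<A>" "t > 0" shows "scale_covector t p \<in> cotangent0 \<A>"
proof -
  note p = cotangent0D[OF assms(1)]
  have "(\<lambda>c. t *\<^sub>R snd p c) \<in> cotangent \<A> (fst p)"
    unfolding cotangent_def
  proof (intro CollectI conjI ballI allI impI)
    fix c c' assume "c \<in> \<A>" "c' \<in> \<A>" "fst p \<in> fst c \<and> fst p \<in> fst c'"
    then have "snd p c' = transpose (dmat c' c (\<lambda>y. y) (fst p)) *v snd p c"
      using cotangent_coord[OF p] by blast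
    then show "t *\<^sub>R snd p c' = transpose (dmat c' c (\<lambda>y. y) (fst p)) *v (t *\<^sub>R snd p c)"
      by (simp only: matrix_vector_mult_scaleR)
  next
    fix c assume "\<not> (c \<in> \<A> \<and> fst p \<in> fst c)"
    then have "snd p c = 0" using p unfolding cotangent_def by blast
    then show "t *\<^sub>R snd p c = 0" by simp
  qed
  moreover have "(\<lambda>c. t *\<^sub>R snd p c) \<noteq> (\<lambda>_. 0)"
  proof
    assume "(\<lambda>c. t *\<^sub>R snd p c) = (\<lambda>_. 0)"
    then have "snd p c = 0" for c using assms(2) by (metis less_irrefl scaleR_eq_0_iff)
    then have "snd p = (\<lambda>_. 0)" by blast
    then show False using assms(1) by (auto simp: cotangent0_def)
  qed
  ultimately show ?thesis by (simp add: scale_covector_def cotangent0_def)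
qed

lemma codiff_scale: "codiff \<A> h (scale_covector t p) = scale_covector t (codiff \<A> h p)"
  by (auto simp: scale_covector_def codiff_def fun_eq_iff matrix_vector_mult_scaleR split: prod.split)

lemma codiff_iter_scale:
  "diff_iso g \<Longrightarrow> p \<in> cotangent0 \<A> \<Longrightarrow> t > 0 \<Longrightarrow>
    codiff_iter \<A> g n (scale_covector t p) = scale_covector t (codiff_iter \<A> g n p)"
  by (simp add: codiff_iter_eq scale_covector_cotangent0 codiff_scale)

end

locale weighted_surface = surface \<A> for \<A> :: "'m::t2_space chart set" +
  fixes \<rho> :: "'m chart \<Rightarrow> 'm \<Rightarrow> real" and G :: "'m chart \<Rightarrow> 'm \<Rightarrow> real^2^2"
  assumes measure: "smooth_measure \<A> \<rho>" and metric: "riemannian_metric \<A> G"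
begin

lemma chart_continuous:
  assumes c: "c \<in> \<A>" "x \<in> fst c" and s: "smooth_on (snd c ` fst c) (\<lambda>y. f (inv_into (fst c) (snd c) y))"
  shows "isCont f x"
proof -
  have "continuous_on (fst c) (\<lambda>x. f (inv_into (fst c) (snd c) (snd c x)))"
    by (rule continuous_on_compose2[OF smooth_on_imp_continuous_on[OF s] chartD(3)[OF c(1)]]) simp
  moreover have "continuous_on (fst c) (\<lambda>x. f (inv_into (fst c) (snd c) (snd c x))) \<longleftrightarrow> continuous_on (fst c) f"
    by (rule continuous_on_cong) (use chartD(4)[OF c(1)] in auto)
  ultimately show ?thesis using chartD(1)[OF c(1)] c(2) continuous_on_eq_continuous_at by blast
qed

lemma metric_isCont: "c \<in> \<A> \<Longrightarrow> x \<in> fst c \<Longrightarrow> isCont (G c) x"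
  using chart_continuous metric unfolding riemannian_metric_def by blast

lemma density_isCont: "c \<in> \<A> \<Longrightarrow> x \<in> fst c \<Longrightarrow> isCont (\<rho> c) x"
  using chart_continuous measure unfolding smooth_measure_def by blast

lemma density_pos: "c \<in> \<A> \<Longrightarrow> x \<in> fst c \<Longrightarrow> \<rho> c x > 0"
  using measure unfolding smooth_measure_def by blast

lemma metric_pos: "c \<in> \<A> \<Longrightarrow> x \<in> fst c \<Longrightarrow> v \<noteq> 0 \<Longrightarrow> v \<bullet> (G c x *v v) > 0"
  using metric unfolding riemannian_metric_def by blast

lemma metric_inverse:
  assumes c: "c \<in> \<A>" "x \<in> fst c"
  shows "G c x ** matrix_inv (G c x) = mat 1" "matrix_inv (G c x) ** G c x = mat 1" "det (G c x) \<noteq> 0"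
proof -
  have "\<forall>v. G c x *v v = 0 \<longrightarrow> v = 0" using metric_pos[OF c] by fastforce
  then obtain B where B: "B ** G c x = mat 1" using matrix_left_invertible_ker by blast
  then have B': "G c x ** B = mat 1" using matrix_left_right_inverse by blast
  then show "G c x ** matrix_inv (G c x) = mat 1" "matrix_inv (G c x) ** G c x = mat 1"
    using matrix_inv_unique[OF B' B] B by simp_all
  have "det (G c x) * det B = 1" using det_mul[of "G c x" B] B' by simp
  then show "det (G c x) \<noteq> 0" by auto
qed

lemma dmat_id_inverse:
  assumes "c \<in> \<A>" "c' \<in> \<A>" "x \<in> fst c" "x \<in> fst c'"
  shows "dmat c' c (\<lambda>y. y) x ** dmat c c' (\<lambda>y. y) x = mat 1"
  using dmat_inverse(1)[OF diff_iso_id assms] by (simp add: inv_id[unfolded id_def])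

text \<open>
  The norm on covectors is independent of the chart, because the inverse Gram matrix transforms
  contravariantly to covectors.
\<close>

lemma covector_norm_coord:
  assumes \<xi>: "snd p \<in> cotangent \<A> (fst p)" and c: "c \<in> \<A>" "fst p \<in> fst c"
  shows "covector_norm \<A> G p = sqrt (snd p c \<bullet> (matrix_inv (G c (fst p)) *v snd p c))"
proof -
  define x where "x = fst p"
  define c0 where "c0 = chart_at \<A> x"
  define \<eta> where "\<eta> = snd p c"
  have c0: "c0 \<in> \<A>" "x \<in> fst c0" using chart_at by (auto simp: c0_def)
  have x: "x \<in> fst c" using c by (simp add: x_def)
  let ?T = "dmat c0 c (\<lambda>y. y) x" and ?S = "dmat c c0 (\<lambda>y. y) x"
  let ?H = "matrix_inv (G c x)"
  have TS: "?T ** ?S = mat 1" and ST: "?S ** ?T = mat 1" using dmat_id_inverse c(1) c0 x by auto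
  have G0: "G c0 x = transpose ?T ** G c x ** ?T"
    using metric c(1) c0 x unfolding riemannian_metric_def by blast
  note GH = metric_inverse(1,2)[OF c(1) x]
  have t1: "transpose ?T ** transpose ?S = mat 1" and t2: "transpose ?S ** transpose ?T = mat 1"
    unfolding matrix_transpose_mul[symmetric] using TS ST by simp_all
  have "matrix_inv (G c0 x) = ?S ** ?H ** transpose ?S"
  proof (rule matrix_inv_unique)
    have "G c0 x ** (?S ** ?H ** transpose ?S) = transpose ?T ** G c x ** (?T ** ?S) ** ?H ** transpose ?S"
      unfolding G0 by (simp only: matrix_mul_assoc)
    also have "\<dots> = transpose ?T ** (G c x ** ?H) ** transpose ?S"
      unfolding TS by (simp only: matrix_mul_assoc matrix_mul_rid)
    also have "\<dots> = mat 1" unfolding GH by (simp add: t1)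
    finally show "G c0 x ** (?S ** ?H ** transpose ?S) = mat 1" .
    have "?S ** ?H ** transpose ?S ** G c0 x = ?S ** ?H ** (transpose ?S ** transpose ?T) ** G c x ** ?T"
      unfolding G0 by (simp only: matrix_mul_assoc)
    also have "\<dots> = ?S ** (?H ** G c x) ** ?T"
      unfolding t2 by (simp only: matrix_mul_assoc matrix_mul_rid)
    also have "\<dots> = mat 1" unfolding GH by (simp add: ST)
    finally show "?S ** ?H ** transpose ?S ** G c0 x = mat 1" .
  qed
  moreover have \<xi>0: "snd p c0 = transpose ?T *v \<eta>"
    using cotangent_coord[OF \<xi> c(1) c0(1) c(2)] c0 by (simp add: x_def \<eta>_def)
  ultimately have "snd p c0 \<bullet> (matrix_inv (G c0 x) *v snd p c0)
     = (transpose ?T *v \<eta>) \<bullet> ((?S ** ?H ** (transpose ?S ** transpose ?T)) *v \<eta>)"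
    by (simp only: matrix_vector_mul_assoc matrix_mul_assoc)
  also have "\<dots> = \<eta> \<bullet> ((?T ** ?S ** ?H) *v \<eta>)"
    unfolding t2 adjoint_dot by (simp only: matrix_vector_mul_assoc matrix_mul_assoc matrix_mul_rid)
  also have "\<dots> = \<eta> \<bullet> (?H *v \<eta>)" unfolding TS by simp
  finally show ?thesis
    unfolding \<eta>_def x_def c0_def by (simp add: covector_norm_def Let_def case_prod_beta)
qed

lemma covector_norm_pos:
  assumes p: "p \<in> cotangent0 \<A>" shows "covector_norm \<A> G p > 0"
proof -
  let ?c = "chart_at \<A> (fst p)" and ?x = "fst p"
  let ?G = "G ?c ?x" and ?\<eta> = "snd p ?c"
  have "?\<eta> \<noteq> 0" using p cotangent0_iff_coord[OF chart_at, of ?x "snd p"] by simp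
  define w where "w = matrix_inv ?G *v ?\<eta>"
  have \<eta>: "?\<eta> = ?G *v w" unfolding w_def by (simp add: matrix_vector_mul_assoc metric_inverse chart_at)
  then have "w \<noteq> 0" using \<open>?\<eta> \<noteq> 0\<close> by auto
  then have "w \<bullet> (?G *v w) > 0" by (rule metric_pos[OF chart_at])
  then have "?\<eta> \<bullet> w > 0" using \<eta> by (simp add: inner_commute)
  then show ?thesis using covector_norm_coord[OF cotangent0D[OF p] chart_at] by (simp add: w_def)
qed

lemma covector_norm_scale:
  assumes "t > 0" shows "covector_norm \<A> G (scale_covector t p) = t * covector_norm \<A> G p"
  using assms by (auto simp: covector_norm_def scale_covector_def Let_def matrix_vector_mult_scaleR
      real_sqrt_mult mult.assoc[symmetric] split: prod.split)

lemma covector_norm_tendsto: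
  assumes f: "cov_tendsto f p F"
  shows "((\<lambda>j. covector_norm \<A> G (f j)) \<longlongrightarrow> covector_norm \<A> G p) F"
proof -
  let ?c = "chart_at \<A> (fst p)"
  from f have p: "p \<in> cotangent0 \<A>" and ev: "\<forall>\<^sub>F j in F. f j \<in> cotangent0 \<A>"
    and lim: "((\<lambda>j. fst (f j)) \<longlongrightarrow> fst p) F" "((\<lambda>j. snd (f j) ?c) \<longlongrightarrow> snd p ?c) F"
    using chart_at by (auto simp: cov_tendsto_def)
  have "((\<lambda>j. G ?c (fst (f j))) \<longlongrightarrow> G ?c (fst p)) F"
    by (rule isCont_tendsto_compose[OF metric_isCont[OF chart_at] lim(1)])
  then have "((\<lambda>j. sqrt (snd (f j) ?c \<bullet> (matrix_inv (G ?c (fst (f j))) *v snd (f j) ?c))) \<longlongrightarrow>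
     sqrt (snd p ?c \<bullet> (matrix_inv (G ?c (fst p)) *v snd p ?c))) F"
    by (intro tendsto_real_sqrt tendsto_inner tendsto_matrix_vector_mult tendsto_matrix_inv_2 lim(2) metric_inverse(3) chart_at)
  moreover have "\<forall>\<^sub>F j in F. covector_norm \<A> G (f j) = sqrt (snd (f j) ?c \<bullet> (matrix_inv (G ?c (fst (f j))) *v snd (f j) ?c))"
    using ev eventually_in_chart[OF lim(1) chart_at]
    by eventually_elim (rule covector_norm_coord[OF cotangent0D chart_at(1)])
  ultimately show ?thesis
    using covector_norm_coord[OF cotangent0D[OF p] chart_at] by (simp add: tendsto_cong)
qed

text \<open>
  The Jacobian of a map with respect to the measure is independent of the charts: the densities
  transform by the same determinants as the derivative of the map.
\<close>

lemma measure_jacobian_coord: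
  assumes h: "diff_map \<A> h" and c: "c \<in> \<A>" "x \<in> fst c" and c': "c' \<in> \<A>" "h x \<in> fst c'"
  shows "measure_jacobian \<A> \<rho> h x = \<rho> c' (h x) * \<bar>det (dmat c c' h x)\<bar> / \<rho> c x"
proof -
  define d where "d = chart_at \<A> x"
  define d' where "d' = chart_at \<A> (h x)"
  have d: "d \<in> \<A>" "x \<in> fst d" "d' \<in> \<A>" "h x \<in> fst d'" using chart_at by (auto simp: d_def d'_def)
  have "dmat d d' h x = dmat c d' h x ** dmat d c (\<lambda>y. y) x"
    by (rule dmat_compose[OF diff_map_id h d(1) c(1) d(3) d(2) c(2) d(4)])
  also have "dmat c d' h x = dmat c' d' (\<lambda>y. y) (h x) ** dmat c c' h x"
    by (rule dmat_compose[OF h diff_map_id c(1) c'(1) d(3) c(2) c'(2) d(4)])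
  finally have 1: "\<bar>det (dmat d d' h x)\<bar> = \<bar>det (dmat c' d' (\<lambda>y. y) (h x))\<bar> * \<bar>det (dmat c c' h x)\<bar> * \<bar>det (dmat d c (\<lambda>y. y) x)\<bar>"
    by (simp add: det_mul abs_mult)
  have "det (dmat c' d' (\<lambda>y. y) (h x)) * det (dmat d' c' (\<lambda>y. y) (h x)) = 1"
    unfolding det_mul[symmetric] using dmat_id_inverse[OF d(3) c'(1) d(4) c'(2)] by simp
  then have 2: "\<bar>det (dmat c' d' (\<lambda>y. y) (h x))\<bar> * \<bar>det (dmat d' c' (\<lambda>y. y) (h x))\<bar> = 1"
    unfolding abs_mult[symmetric] by simp
  have 3: "\<rho> d x = \<bar>det (dmat d c (\<lambda>y. y) x)\<bar> * \<rho> c x"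
    and 4: "\<rho> d' (h x) = \<bar>det (dmat d' c' (\<lambda>y. y) (h x))\<bar> * \<rho> c' (h x)"
    using measure c c' d unfolding smooth_measure_def by blast+
  have "\<rho> d x > 0" "\<rho> c x > 0" by (intro density_pos d c)+
  then have 5: "\<bar>det (dmat d c (\<lambda>y. y) x)\<bar> \<noteq> 0" using 3 by auto
  have "measure_jacobian \<A> \<rho> h x = \<rho> d' (h x) * \<bar>det (dmat d d' h x)\<bar> / \<rho> d x"
    by (simp add: measure_jacobian_def Let_def d_def d'_def)
  also have "\<dots> = (\<bar>det (dmat c' d' (\<lambda>y. y) (h x))\<bar> * \<bar>det (dmat d' c' (\<lambda>y. y) (h x))\<bar>) *
      (\<rho> c' (h x) * \<bar>det (dmat c c' h x)\<bar> * \<bar>det (dmat d c (\<lambda>y. y) x)\<bar> / (\<bar>det (dmat d c (\<lambda>y. y) x)\<bar> * \<rho> c x))"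
    unfolding 1 3 4 by (simp add: mult_ac)
  also have "\<dots> = \<rho> c' (h x) * \<bar>det (dmat c c' h x)\<bar> / \<rho> c x"
    unfolding 2 using 5 by simp
  finally show ?thesis .
qed

lemma measure_jacobian_compose:
  assumes h1: "diff_map \<A> h1" and h2: "diff_map \<A> h2"
  shows "measure_jacobian \<A> \<rho> (\<lambda>x. h2 (h1 x)) x = measure_jacobian \<A> \<rho> h2 (h1 x) * measure_jacobian \<A> \<rho> h1 x"
proof -
  let ?c = "chart_at \<A> x" and ?c' = "chart_at \<A> (h1 x)" and ?c'' = "chart_at \<A> (h2 (h1 x))"
  have pos: "\<rho> ?c' (h1 x) > 0" by (rule density_pos[OF chart_at])
  show ?thesis
    using dmat_compose[OF h1 h2 chart_at(1) chart_at(1) chart_at(1) chart_at(2) chart_at(2) chart_at(2), of x] pos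
    by (simp add: measure_jacobian_def Let_def det_mul abs_mult)
qed

lemma measure_jacobian_pos:
  assumes h: "diff_iso h" shows "measure_jacobian \<A> \<rho> h x > 0"
proof -
  have "det (dmat (chart_at \<A> (h x)) (chart_at \<A> x) (inv h) (h x)) * det (dmat (chart_at \<A> x) (chart_at \<A> (h x)) h x) = 1"
    unfolding det_mul[symmetric] using dmat_inverse(1)[OF h chart_at(1) chart_at(1) chart_at(2) chart_at(2)] by simp
  then have "det (dmat (chart_at \<A> x) (chart_at \<A> (h x)) h x) \<noteq> 0" by auto
  then show ?thesis using density_pos[OF chart_at] by (simp add: measure_jacobian_def Let_def)
qed

lemma measure_jacobian_tendsto:
  assumes h: "diff_map \<A> h" and x: "(x \<longlongrightarrow> x0) F"
  shows "((\<lambda>j. measure_jacobian \<A> \<rho> h (x j)) \<longlongrightarrow> measure_jacobian \<A> \<rho> h x0) F"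
proof -
  let ?c = "chart_at \<A> x0" and ?c' = "chart_at \<A> (h x0)"
  note hx = diff_map_tendsto[OF h x]
  have "((\<lambda>j. det (dmat ?c ?c' h (x j))) \<longlongrightarrow> det (dmat ?c ?c' h x0)) F"
    unfolding det_2 by (intro tendsto_intros dmat_tendsto[OF h x] chart_at)
  then have "((\<lambda>j. \<rho> ?c' (h (x j)) * \<bar>det (dmat ?c ?c' h (x j))\<bar> / \<rho> ?c (x j)) \<longlongrightarrow>
      \<rho> ?c' (h x0) * \<bar>det (dmat ?c ?c' h x0)\<bar> / \<rho> ?c x0) F"
    by (intro tendsto_divide tendsto_mult tendsto_rabs
        isCont_tendsto_compose[OF density_isCont[OF chart_at] x] isCont_tendsto_compose[OF density_isCont[OF chart_at] hx])
       (use density_pos[OF chart_at, of x0] in auto)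
  moreover have "\<forall>\<^sub>F j in F. measure_jacobian \<A> \<rho> h (x j) = \<rho> ?c' (h (x j)) * \<bar>det (dmat ?c ?c' h (x j))\<bar> / \<rho> ?c (x j)"
    using eventually_in_chart[OF x chart_at] eventually_in_chart[OF hx chart_at]
    by eventually_elim (rule measure_jacobian_coord[OF h chart_at(1) _ chart_at(1)])
  ultimately show ?thesis
    using measure_jacobian_coord[OF h chart_at chart_at, of x0] by (simp add: tendsto_cong)
qed

end

locale weighted_diffeo = weighted_surface \<A> \<rho> G for \<A> :: "'m::t2_space chart set" and \<rho> G +
  fixes g :: "'m \<Rightarrow> 'm"
  assumes g: "diff_iso g"
begin

lemma g_bij: "bij_betw g UNIV UNIV"
  using g by (simp add: diff_iso_def)

abbreviation "iter \<equiv> int_iter UNIV g"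
abbreviation "cov_iter \<equiv> codiff_iter \<A> g"

definition log_norm :: "'m \<times> 'm covector \<Rightarrow> int \<Rightarrow> real" where
  "log_norm p n = ln (covector_norm \<A> G (cov_iter n p))"

lemma iter_diff_map: "diff_map \<A> (iter n)"
  using int_iter_diff_iso[OF g] by (simp add: diff_iso_def)

lemma weight_eq:
  assumes "p \<in> cotangent0 \<A>"
  shows "weight \<A> g \<rho> G p s n = measure_jacobian \<A> \<rho> (iter n) (fst p) * exp (2 * s * log_norm p n)"
  using covector_norm_pos[OF codiff_iter_cotangent0[OF g assms], of n]
  by (simp add: weight_def log_norm_def powr_def)

lemma weight_pos: "p \<in> cotangent0 \<A> \<Longrightarrow> weight \<A> g \<rho> G p s n > 0"
  by (simp add: weight_eq measure_jacobian_pos int_iter_diff_iso[OF g])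

lemma sqrt_weight_add:
  assumes "p \<in> cotangent0 \<A>"
  shows "sqrt (weight \<A> g \<rho> G p (s + t) n) = sqrt (weight \<A> g \<rho> G p t n) * exp (s * log_norm p n)"
proof -
  have "exp (2 * (s + t) * log_norm p n) = exp (2 * t * log_norm p n) * (exp (s * log_norm p n))\<^sup>2"
    by (simp add: power2_eq_square exp_add[symmetric] algebra_simps)
  then have "weight \<A> g \<rho> G p (s + t) n = weight \<A> g \<rho> G p t n * (exp (s * log_norm p n))\<^sup>2"
    by (simp only: weight_eq[OF assms] mult.assoc)
  then show ?thesis by (simp add: real_sqrt_mult)
qed

lemma log_norm_shift:
  "p \<in> cotangent0 \<A> \<Longrightarrow> log_norm (cov_iter i p) n = log_norm p (n + i)"
  by (simp add: log_norm_def codiff_iter_add[OF g])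

text \<open>
  Moving along the orbit changes the weights, for all \<open>s\<close>, by one common factor: the Jacobian is a
  cocycle. Such a factor cancels in the normalized coefficients below.
\<close>

lemma weight_shift:
  assumes p: "p \<in> cotangent0 \<A>"
  shows "weight \<A> g \<rho> G p s (n + i) = weight \<A> g \<rho> G (cov_iter i p) s n * measure_jacobian \<A> \<rho> (iter i) (fst p)"
proof -
  have "iter (n + i) = (\<lambda>x. iter n (iter i x))" using int_iter_add[OF g_bij] by (simp add: fun_eq_iff)
  then have "measure_jacobian \<A> \<rho> (iter (n + i)) (fst p)
      = measure_jacobian \<A> \<rho> (iter n) (iter i (fst p)) * measure_jacobian \<A> \<rho> (iter i) (fst p)"
    using measure_jacobian_compose[OF iter_diff_map iter_diff_map] by simp
  then show ?thesis
    using p by (simp add: weight_eq codiff_iter_cotangent0[OF g] log_norm_shift fst_codiff_iter[OF g])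
qed

lemma log_norm_tendsto:
  assumes "cov_tendsto f p F"
  shows "((\<lambda>j. log_norm (f j) n) \<longlongrightarrow> log_norm p n) F"
proof -
  have "p \<in> cotangent0 \<A>" using assms by (simp add: cov_tendsto_def)
  then show ?thesis unfolding log_norm_def
    by (intro tendsto_ln covector_norm_tendsto codiff_iter_tendsto[OF g assms])
       (use covector_norm_pos[OF codiff_iter_cotangent0[OF g], of p n] in simp)
qed

lemma weight_tendsto:
  assumes "cov_tendsto f p F"
  shows "((\<lambda>j. weight \<A> g \<rho> G (f j) s n) \<longlongrightarrow> weight \<A> g \<rho> G p s n) F"
proof -
  have p: "p \<in> cotangent0 \<A>" and ev: "\<forall>\<^sub>F j in F. f j \<in> cotangent0 \<A>" and lim: "((\<lambda>j. fst (f j)) \<longlongrightarrow> fst p) F"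
    using assms by (auto simp: cov_tendsto_def)
  have "((\<lambda>j. measure_jacobian \<A> \<rho> (iter n) (fst (f j)) * exp (2 * s * log_norm (f j) n)) \<longlongrightarrow>
     measure_jacobian \<A> \<rho> (iter n) (fst p) * exp (2 * s * log_norm p n)) F"
    by (intro tendsto_mult tendsto_exp tendsto_const log_norm_tendsto[OF assms] measure_jacobian_tendsto[OF iter_diff_map lim])
  moreover have "\<forall>\<^sub>F j in F. measure_jacobian \<A> \<rho> (iter n) (fst (f j)) * exp (2 * s * log_norm (f j) n) = weight \<A> g \<rho> G (f j) s n"
    using ev by eventually_elim (rule weight_eq[symmetric])
  ultimately show ?thesis unfolding weight_eq[OF p] by (rule Lim_transform_eventually)
qed

lemma log_norm_scale:
  assumes "p \<in> cotangent0 \<A>" "t > 0"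
  shows "log_norm (scale_covector t p) n = ln t + log_norm p n"
  using assms covector_norm_pos[OF codiff_iter_cotangent0[OF g assms(1)], of n]
  by (simp add: log_norm_def codiff_iter_scale[OF g] covector_norm_scale ln_mult)

lemma sqrt_weight_scale:
  assumes p: "p \<in> cotangent0 \<A>" and t: "t > 0"
  shows "sqrt (weight \<A> g \<rho> G (scale_covector t p) s n) = t powr s * sqrt (weight \<A> g \<rho> G p s n)"
proof -
  have "exp (2 * s * (ln t + log_norm p n)) = (t powr s)\<^sup>2 * exp (2 * s * log_norm p n)"
    using t by (simp add: power2_eq_square powr_def exp_add[symmetric] algebra_simps)
  then have "weight \<A> g \<rho> G (scale_covector t p) s n = (t powr s)\<^sup>2 * weight \<A> g \<rho> G p s n"
    using p t by (simp add: weight_eq scale_covector_cotangent0 log_norm_scale)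
  then show ?thesis using t by (simp add: real_sqrt_mult)
qed

end

section \<open>Compactness of the cosphere bundle\<close>

context surface
begin

lemma coordinate_disc_exists:
  "\<exists>c\<in>\<A>. \<exists>e>0. x \<in> fst c \<and> cball (snd c x) e \<subseteq> snd c ` fst c"
proof -
  let ?c = "chart_at \<A> x"
  have "open (snd ?c ` fst ?c)" "snd ?c x \<in> snd ?c ` fst ?c" using chartD(2)[OF chart_at(1)] chart_at(2) by auto
  then obtain e where "e > 0" "cball (snd ?c x) e \<subseteq> snd ?c ` fst ?c" using open_contains_cball by blast
  then show ?thesis using chart_at by blast
qed

lemma open_coordinate_disc:
  assumes "c \<in> \<A>" shows "open {y \<in> fst c. snd c y \<in> ball a e}"
proof -
  have "open (snd c -` ball a e \<inter> fst c)"
    using continuous_open_vimage chartD(1,3)[OF assms] by (metis continuous_on_open_vimage open_ball)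
  moreover have "snd c -` ball a e \<inter> fst c = {y \<in> fst c. snd c y \<in> ball a e}" by auto
  ultimately show ?thesis by simp
qed

text \<open>
  Rescaling replaces the cosphere bundle: finitely many closed coordinate discs cover the surface, one
  of them contains infinitely many base points, and there the coordinates of the covectors may be
  scaled to length one.
\<close>

lemma rays_compact:
  fixes f :: "nat \<Rightarrow> 'm \<times> 'm covector"
  assumes comp: "compact (UNIV :: 'm set)" and f: "\<And>j. f j \<in> cotangent0 \<A>"
  shows "\<exists>r t q. strict_mono (r :: nat \<Rightarrow> nat) \<and> (\<forall>j. t j > 0) \<and>
     cov_tendsto (\<lambda>j. scale_covector (t j) (f (r j))) q sequentially"
proof -
  have "\<forall>x. \<exists>c e. c \<in> \<A> \<and> e > 0 \<and> x \<in> fst c \<and> cball (snd c x) e \<subseteq> snd c ` fst c"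
    using coordinate_disc_exists by blast
  then obtain C e where C: "\<And>x. C x \<in> \<A>" "\<And>x. x \<in> fst (C x)" and e: "\<And>x. e x > 0"
    and cb: "\<And>x. cball (snd (C x) x) (e x) \<subseteq> snd (C x) ` fst (C x)" by metis
  define U where "U = (\<lambda>x. {y \<in> fst (C x). snd (C x) y \<in> ball (snd (C x) x) (e x)})"
  have "open (U x)" "x \<in> U x" for x
    using open_coordinate_disc[OF C(1)] C(2) e by (auto simp: U_def)
  then obtain I where I: "finite I" "UNIV \<subseteq> (\<Union>x\<in>I. U x)"
    using compactE_image[OF comp, of UNIV U] by (metis UNIV_I UN_I subsetI)
  have "\<exists>x\<in>I. infinite {j. fst (f j) \<in> U x}"
  proof (rule ccontr)
    assume "\<not> ?thesis"
    then have "finite (\<Union>x\<in>I. {j. fst (f j) \<in> U x})" using I(1) by blast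
    moreover have "(\<Union>x\<in>I. {j. fst (f j) \<in> U x}) = UNIV" using I(2) by blast
    ultimately show False by simp
  qed
  then obtain x where inf: "infinite {j. fst (f j) \<in> U x}" by blast
  obtain r1 :: "nat \<Rightarrow> nat" where r1: "strict_mono r1" "\<And>j. r1 j \<in> {j. fst (f j) \<in> U x}"
    using infinite_enumerate[OF inf] by blast
  define c where "c = C x"
  have c: "c \<in> \<A>" by (simp add: c_def C)
  have cball: "cball (snd c x) (e x) \<subseteq> snd c ` fst c" by (simp add: c_def cb)
  have fU: "fst (f (r1 j)) \<in> fst c" "snd c (fst (f (r1 j))) \<in> cball (snd c x) (e x)" for j
    using r1(2)[of j] by (auto simp: U_def c_def)
  define \<tau> where "\<tau> = (\<lambda>j. 1 / norm (snd (f (r1 j)) c))"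
  have nz: "snd (f (r1 j)) c \<noteq> 0" for j
    using f[of "r1 j"] cotangent0_iff_coord[OF c fU(1)[of j], of "snd (f (r1 j))"] by simp
  define s where "s = (\<lambda>j. (snd c (fst (f (r1 j))), \<tau> j *\<^sub>R snd (f (r1 j)) c))"
  have "compact (cball (snd c x) (e x) \<times> sphere (0 :: real^2) 1)"
    by (intro compact_Times) auto
  moreover have "\<forall>j. s j \<in> cball (snd c x) (e x) \<times> sphere 0 1"
    using fU(2) nz by (auto simp: s_def \<tau>_def)
  ultimately obtain l r2 where l: "l \<in> cball (snd c x) (e x) \<times> sphere 0 1" and r2: "strict_mono (r2 :: nat \<Rightarrow> nat)"
    and lim: "(s \<circ> r2) \<longlonglongrightarrow> l"
    unfolding compact_def by blast
  define y where "y = inv_into (fst c) (snd c) (fst l)"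
  have ly: "fst l \<in> snd c ` fst c" using l cball by auto
  then have y: "y \<in> fst c" "snd c y = fst l" by (auto simp: y_def inv_into_into f_inv_into_f)
  define q where "q = (y, covector c y (snd l))"
  have "snd l \<noteq> 0" using l by auto
  then have q: "q \<in> cotangent0 \<A>" using cotangent0_iff_coord[OF c y(1)] covector[OF c y(1)] by (simp add: q_def)
  have "((\<lambda>j. fst (s (r2 j))) \<longlongrightarrow> fst l) sequentially" using tendsto_fst[OF lim] by (simp add: o_def)
  then have "((\<lambda>j. inv_into (fst c) (snd c) (fst (s (r2 j)))) \<longlongrightarrow> y) sequentially"
    unfolding y_def
    by (rule continuous_on_tendsto_compose[OF chartD(5)[OF c] _ ly]) (auto simp: s_def intro!: always_eventually imageI fU)
  moreover have "inv_into (fst c) (snd c) (fst (s j)) = fst (f (r1 j))" for j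
    using chartD(4)[OF c] fU(1) by (simp add: s_def)
  ultimately have lim1: "(\<lambda>j. fst (f (r1 (r2 j)))) \<longlonglongrightarrow> y" by simp
  have lim2: "(\<lambda>j. \<tau> (r2 j) *\<^sub>R snd (f (r1 (r2 j))) c) \<longlonglongrightarrow> snd l"
    using tendsto_snd[OF lim] by (simp add: o_def s_def)
  have \<tau>: "\<tau> j > 0" for j using nz by (simp add: \<tau>_def)
  have "cov_tendsto (\<lambda>j. scale_covector (\<tau> (r2 j)) (f (r1 (r2 j)))) q sequentially"
    by (rule cov_tendstoI[OF c])
       (use y q lim1 lim2 covector[OF c y(1)] scale_covector_cotangent0[OF f \<tau>] in \<open>auto simp: q_def\<close>)
  moreover have "strict_mono (\<lambda>j. r1 (r2 j))" using r1(1) r2 by (simp add: strict_mono_def)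
  ultimately show ?thesis using \<tau>
    by (intro exI[of _ "\<lambda>j. r1 (r2 j)"] exI[of _ "\<lambda>j. \<tau> (r2 j)"] exI[of _ q]) simp
qed

end

section \<open>Ellipticity as invertibility of a family of band operators\<close>

locale nonlocal_symbol = weighted_diffeo \<A> \<rho> G g for \<A> :: "'m::t2_space chart set" and \<rho> G g +
  fixes d :: real and K :: "int set" and Dk :: "int \<Rightarrow> ('m \<Rightarrow> complex) \<Rightarrow> 'm \<Rightarrow> complex"
  assumes K: "finite K" and Dk: "\<And>k. k \<in> K \<Longrightarrow> pseudodifferential \<A> d (Dk k)"
begin

text \<open>
  The coefficients of the symbol at exponent \<open>0\<close> after normalization of the weights; those at other
  exponents are tilts of them.
\<close>

definition normal_coef :: "'m \<times> 'm covector \<Rightarrow> int \<Rightarrow> int \<Rightarrow> complex" where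
  "normal_coef p n k = principal_symbol \<A> d (Dk k) (cov_iter n p) *
     complex_of_real (sqrt (weight \<A> g \<rho> G p (- d) n) / sqrt (weight \<A> g \<rho> G p 0 (n + k)))"

lemma symbol_tendsto:
  assumes k: "k \<in> K" and f: "cov_tendsto f p F"
  shows "((\<lambda>j. principal_symbol \<A> d (Dk k) (f j)) \<longlongrightarrow> principal_symbol \<A> d (Dk k) p) F"
proof (rule principal_symbol_tendsto[OF Dk[OF k] chart_at(1) is_chart[OF chart_at(1)] chart_at(2)])
  let ?c = "chart_at \<A> (fst p)"
  from f have p: "p \<in> cotangent0 \<A>" and ev: "\<forall>\<^sub>F j in F. f j \<in> cotangent0 \<A>"
    and lim: "((\<lambda>j. fst (f j)) \<longlongrightarrow> fst p) F" "((\<lambda>j. snd (f j) ?c) \<longlongrightarrow> snd p ?c) F"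
    using chart_at by (auto simp: cov_tendsto_def)
  show "p \<in> cotangent0 \<A>" "\<forall>\<^sub>F j in F. f j \<in> cotangent0 \<A>" "((\<lambda>j. snd (f j) ?c) \<longlongrightarrow> snd p ?c) F" by fact+
  show "snd p ?c \<noteq> 0" using p cotangent0_iff_coord[OF chart_at, of "fst p" "snd p"] by simp
  show "\<forall>\<^sub>F j in F. fst (f j) \<in> fst ?c" by (rule eventually_in_chart[OF lim(1) chart_at])
  show "((\<lambda>j. snd ?c (fst (f j))) \<longlongrightarrow> snd ?c (fst p)) F"
    by (rule isCont_tendsto_compose[OF chart_isCont[OF chart_at] lim(1)])
qed

lemma symbol_scale:
  assumes k: "k \<in> K" and p: "p \<in> cotangent0 \<A>" and t: "t > 0"
  shows "principal_symbol \<A> d (Dk k) (scale_covector t p) = complex_of_real (t powr d) * principal_symbol \<A> d (Dk k) p"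
proof -
  let ?c = "chart_at \<A> (fst p)"
  have 1: "(fst p, snd p) \<in> cotangent0 \<A>" using p by simp
  have 2: "(fst p, \<lambda>c. t *\<^sub>R snd p c) \<in> cotangent0 \<A>" using scale_covector_cotangent0[OF p t] by (simp add: scale_covector_def)
  have 3: "snd p ?c \<noteq> 0" using 1 cotangent0_iff_coord[OF chart_at] by blast
  show ?thesis
    using principal_symbol_homogeneous[OF Dk[OF k] chart_at(1) is_chart[OF chart_at(1)] chart_at(2) 1 3 2 t]
    by (simp add: scale_covector_def)
qed

lemma normal_coef_tendsto:
  assumes k: "k \<in> K" and f: "cov_tendsto f p F"
  shows "((\<lambda>j. normal_coef (f j) n k) \<longlongrightarrow> normal_coef p n k) F"
proof -
  have p: "p \<in> cotangent0 \<A>" using f by (simp add: cov_tendsto_def)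
  have "sqrt (weight \<A> g \<rho> G p 0 (n + k)) \<noteq> 0" using weight_pos[OF p, of 0 "n + k"] by simp
  then show ?thesis unfolding normal_coef_def
    by (intro tendsto_mult tendsto_of_real tendsto_divide tendsto_real_sqrt weight_tendsto[OF f]
        symbol_tendsto[OF k codiff_iter_tendsto[OF g f]])
qed

text \<open>
  Homogeneity of degree \<open>d\<close> of the principal symbols balances that of the weight at exponent \<open>- d\<close>.
\<close>

lemma normal_coef_scale:
  assumes k: "k \<in> K" and p: "p \<in> cotangent0 \<A>" and t: "t > 0"
  shows "normal_coef (scale_covector t p) n k = normal_coef p n k"
proof -
  have "t powr d * t powr (- d) = 1" using t by (simp add: powr_minus)
  then have "complex_of_real (t powr d) * complex_of_real (t powr (- d)) = 1"
    unfolding of_real_mult[symmetric] by simp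
  then show ?thesis
    using t symbol_scale[OF k codiff_iter_cotangent0[OF g p, of n] t]
    by (simp add: normal_coef_def codiff_iter_scale[OF g p t] sqrt_weight_scale[OF p t] mult_ac)
qed

lemma normal_coef_shift:
  assumes p: "p \<in> cotangent0 \<A>"
  shows "normal_coef (cov_iter i p) n = normal_coef p (n + i)"
proof
  fix k
  let ?J = "measure_jacobian \<A> \<rho> (iter i) (fst p)"
  have J: "?J > 0" by (rule measure_jacobian_pos[OF int_iter_diff_iso[OF g]])
  have e: "n + i + k = n + k + i" by simp
  have "sqrt (weight \<A> g \<rho> G p (- d) (n + i)) / sqrt (weight \<A> g \<rho> G p 0 (n + i + k))
     = sqrt (weight \<A> g \<rho> G (cov_iter i p) (- d) n) / sqrt (weight \<A> g \<rho> G (cov_iter i p) 0 (n + k))"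
    unfolding e weight_shift[OF p] real_sqrt_mult using J by simp
  then show "normal_coef (cov_iter i p) n k = normal_coef p (n + i) k"
    by (simp add: normal_coef_def codiff_iter_add[OF g p])
qed

lemma data_tendstoI:
  assumes f: "cov_tendsto f p sequentially"
  shows "data_tendsto K normal_coef log_norm f p"
  unfolding data_tendsto_def
  by (intro conjI allI ballI normal_coef_tendsto[OF _ f] tendsto_diff log_norm_tendsto[OF f])

lemma elliptic_iff:
  "elliptic \<A> g \<rho> G d K Dk s \<longleftrightarrow>
     (\<forall>p\<in>cotangent0 \<A>. l2_invertible (\<lambda>_. 1) (\<lambda>_. 1) (band K (tilt (\<lambda>i. s * log_norm p i) (normal_coef p))))"
  unfolding elliptic_def
proof (rule ball_cong[OF refl])
  fix p assume p: "p \<in> cotangent0 \<A>"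
  let ?\<sigma> = "\<lambda>n k. principal_symbol \<A> d (Dk k) (cov_iter n p)"
  have op: "operator_symbol \<A> g d K Dk p = band K ?\<sigma>"
    by (simp add: fun_eq_iff operator_symbol_def band_def)
  have "?\<sigma> n k * complex_of_real (sqrt (weight \<A> g \<rho> G p (s - d) n) / sqrt (weight \<A> g \<rho> G p s (n + k)))
      = tilt (\<lambda>i. s * log_norm p i) (normal_coef p) n k" for n k
    using sqrt_weight_add[OF p, of s "- d" n] sqrt_weight_add[OF p, of s 0 "n + k"]
    by (simp add: tilt_def normal_coef_def exp_diff)
  then show "l2_invertible (weight \<A> g \<rho> G p s) (weight \<A> g \<rho> G p (s - d)) (operator_symbol \<A> g d K Dk p) \<longleftrightarrow>
     l2_invertible (\<lambda>_. 1) (\<lambda>_. 1) (band K (tilt (\<lambda>i. s * log_norm p i) (normal_coef p)))"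
    unfolding op l2_invertible_band_normalize[OF weight_pos[OF p] weight_pos[OF p]] by simp
qed

lemma elliptic_interval:
  assumes comp: "compact (UNIV :: 'm set)"
    and dense: "\<And>p. p \<in> cotangent0 \<A> \<Longrightarrow> \<exists>f. (\<forall>j. f j \<in> cotangent0 \<A> \<and> (\<exists>c. \<forall>n. c \<le> log_norm (f j) n)) \<and>
       cov_tendsto f p sequentially"
  shows "\<exists>s0 s1 :: ereal. s0 \<le> s1 \<and> (\<forall>s. s0 < ereal s \<and> ereal s < s1 \<longleftrightarrow> elliptic \<A> g \<rho> G d K Dk s)"
proof -
  interpret band_family K "cotangent0 \<A>" normal_coef log_norm
  proof
    show "finite K" by (rule K)
  next
    fix f :: "nat \<Rightarrow> 'm \<times> 'm covector" assume f: "\<And>j. f j \<in> cotangent0 \<A>"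
    obtain r t q where r: "strict_mono (r :: nat \<Rightarrow> nat)" and t: "\<And>j. t j > 0"
      and lim: "cov_tendsto (\<lambda>j. scale_covector (t j) (f (r j))) q sequentially"
      using rays_compact[OF comp, of f] f by blast
    have "data_tendsto K normal_coef log_norm (\<lambda>j. scale_covector (t j) (f (r j))) q"
      by (rule data_tendstoI[OF lim])
    then have "data_tendsto K normal_coef log_norm (\<lambda>j. f (r j)) q"
      unfolding data_tendsto_def using normal_coef_scale[OF _ f t] log_norm_scale[OF f t] by simp
    moreover have "q \<in> cotangent0 \<A>" using lim by (simp add: cov_tendsto_def)
    ultimately show "\<exists>r q. strict_mono (r :: nat \<Rightarrow> nat) \<and> q \<in> cotangent0 \<A> \<and> data_tendsto K normal_coef log_norm (\<lambda>j. f (r j)) q"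
      using r by blast
  next
    fix p i assume p: "p \<in> cotangent0 \<A>"
    show "\<exists>q\<in>cotangent0 \<A>. (\<forall>n. normal_coef q n = normal_coef p (n + i)) \<and> (\<forall>n. log_norm q n = log_norm p (n + i))"
      using codiff_iter_cotangent0[OF g p, of i] normal_coef_shift[OF p] log_norm_shift[OF p] by blast
  next
    fix p assume "p \<in> cotangent0 \<A>"
    then show "\<exists>f. (\<forall>j. f j \<in> cotangent0 \<A> \<and> (\<exists>c. \<forall>n. c \<le> log_norm (f j) n)) \<and> data_tendsto K normal_coef log_norm f p"
      using dense data_tendstoI by blast
  qed
  have eq: "elliptic \<A> g \<rho> G d K Dk s \<longleftrightarrow> s \<in> {s. invertible_at s}" for s
    by (simp add: elliptic_iff invertible_at_def coef_def)
  show ?thesis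
    unfolding eq
  proof (rule open_interval_of_open_convex[OF open_invertible_at])
    fix s s' t assume "s \<in> {s. invertible_at s}" "s' \<in> {s. invertible_at s}" "s \<le> t" "t \<le> s'"
    then show "t \<in> {s. invertible_at s}" using invertible_at_between[of s s' t] by simp
  qed
qed

end

section \<open>Hyperbolic linear dynamics in the plane\<close>

text \<open>
  The eigenvalues are ordered. Passing to the inverse matrix preserves the property but reverses the
  order; this is how statements about forward orbits yield those about backward orbits.
\<close>

definition hyperbolic :: "real^2^2 \<Rightarrow> bool" where
  "hyperbolic A \<longleftrightarrow> (\<exists>v1 v2 l1 l2. v1 \<noteq> 0 \<and> v2 \<noteq> 0 \<and> A *v v1 = l1 *\<^sub>R v1 \<and> A *v v2 = l2 *\<^sub>R v2 \<and>
     0 < l1 \<and> l1 < l2 \<and> l1 \<noteq> 1 \<and> l2 \<noteq> 1)"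

definition diag :: "real \<Rightarrow> real \<Rightarrow> real^2^2" where
  "diag a b = (\<chi> i j. if i = j then (if i = 1 then a else b) else 0)"

lemma diag_apply: "(diag a b *v w) $ 1 = a * w $ 1" "(diag a b *v w) $ 2 = b * w $ 2"
  by (simp_all add: diag_def matrix_vector_mult_def sum_2)

lemma transpose_diag: "transpose (diag a b) = diag a b"
  by (auto simp: transpose_def diag_def vec_eq_iff)

lemma hyperbolic_inverse:
  assumes "hyperbolic A" and BA: "B ** A = mat 1" shows "hyperbolic B"
proof -
  obtain v1 v2 l1 l2 where v: "v1 \<noteq> 0" "v2 \<noteq> 0" "A *v v1 = l1 *\<^sub>R v1" "A *v v2 = l2 *\<^sub>R v2"
    and l: "0 < l1" "l1 < l2" "l1 \<noteq> 1" "l2 \<noteq> 1"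
    using assms(1) unfolding hyperbolic_def by blast
  have inv: "B *v v = (1 / l) *\<^sub>R v" if "A *v v = l *\<^sub>R v" "l > 0" for v l
  proof -
    have "v = B *v (A *v v)" using BA by (simp add: matrix_vector_mul_assoc)
    also have "\<dots> = l *\<^sub>R (B *v v)" using that by (simp add: matrix_vector_mult_scaleR)
    finally have "(1 / l) *\<^sub>R v = (1 / l) *\<^sub>R (l *\<^sub>R (B *v v))" by (rule arg_cong)
    then show ?thesis using that(2) by simp
  qed
  have "1 / l2 < 1 / l1" "0 < 1 / l2" "1 / l1 \<noteq> 1" "1 / l2 \<noteq> 1" using l by (auto simp: field_simps)
  then show ?thesis unfolding hyperbolic_def
    using v inv[OF v(3)] inv[OF v(4)] l
    by (intro exI[of _ v2] exI[of _ v1] exI[of _ "1 / l2"] exI[of _ "1 / l1"]) auto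
qed

lemma hyperbolic_diagonalize:
  assumes "hyperbolic A"
  obtains P Q l1 l2 where "P ** Q = mat 1" "Q ** P = mat 1" "A ** P = P ** diag l1 l2"
    "0 < l1" "l1 < l2" "l1 \<noteq> 1" "l2 \<noteq> 1"
proof -
  obtain v1 v2 l1 l2 where v: "v1 \<noteq> 0" "v2 \<noteq> 0" "A *v v1 = l1 *\<^sub>R v1" "A *v v2 = l2 *\<^sub>R v2"
    and l: "0 < l1" "l1 < l2" "l1 \<noteq> 1" "l2 \<noteq> 1"
    using assms unfolding hyperbolic_def by blast
  define P :: "real^2^2" where "P = (\<chi> i j. if j = 1 then v1 $ i else v2 $ i)"
  have Pw: "P *v w = (w $ 1) *\<^sub>R v1 + (w $ 2) *\<^sub>R v2" for w
    by (simp add: P_def matrix_vector_mult_def sum_2 vec_eq_iff)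
  have APw: "A *v (P *v w) = P *v (diag l1 l2 *v w)" for w
    by (simp add: Pw matrix_vector_right_distrib matrix_vector_mult_scaleR v diag_apply mult.commute)
  then have AP: "A ** P = P ** diag l1 l2"
    by (simp add: matrix_eq matrix_vector_mul_assoc[symmetric])
  have "w = 0" if w: "P *v w = 0" for w
  proof -
    have "P *v (diag l1 l2 *v w) - l1 *\<^sub>R (P *v w) = 0" using w by (simp add: APw[symmetric])
    then have "((l2 - l1) * w $ 2) *\<^sub>R v2 = 0" by (simp add: Pw diag_apply algebra_simps)
    then have "w $ 2 = 0" using v l by simp
    moreover then have "(w $ 1) *\<^sub>R v1 = 0" using w by (simp add: Pw)
    then have "w $ 1 = 0" using v by simp
    ultimately show ?thesis by (simp add: vec_eq_iff forall_2)
  qed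
  then obtain Q where Q: "Q ** P = mat 1" using matrix_left_invertible_ker by blast
  then have "P ** Q = mat 1" using matrix_left_right_inverse by blast
  from that[OF this Q AP l] show thesis .
qed

text \<open>
  The real or the imaginary part of a complex eigenvector does not vanish and is an eigenvector.
\<close>

lemma eigenvalue_real_eigenvector:
  assumes "complex_of_real l \<in> eigenvalues A"
  shows "\<exists>v. v \<noteq> 0 \<and> A *v v = l *\<^sub>R v"
proof -
  obtain v :: "complex^2" where v: "v \<noteq> 0"
    and eq: "(\<chi> i j. complex_of_real (A $ i $ j)) *v v = complex_of_real l *s v"
    using assms unfolding eigenvalues_def by blast
  have c: "(\<Sum>j\<in>UNIV. complex_of_real (A $ i $ j) * v $ j) = complex_of_real l * v $ i" for i
    using arg_cong[OF eq, of "\<lambda>w. w $ i"] by (simp add: matrix_vector_mult_def)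
  define a :: "real^2" where "a = (\<chi> i. Re (v $ i))"
  define b :: "real^2" where "b = (\<chi> i. Im (v $ i))"
  have "A *v a = l *\<^sub>R a"
    using arg_cong[OF c, of Re] by (simp add: a_def matrix_vector_mult_def vec_eq_iff)
  moreover have "A *v b = l *\<^sub>R b"
    using arg_cong[OF c, of Im] by (simp add: b_def matrix_vector_mult_def vec_eq_iff)
  moreover have "a \<noteq> 0 \<or> b \<noteq> 0"
    using v by (auto simp: a_def b_def vec_eq_iff complex_eq_iff)
  ultimately show ?thesis by blast
qed

lemma eigenvalues_hyperbolic:
  fixes l1 l2 :: real
  assumes "eigenvalues A = {complex_of_real l1, complex_of_real l2}"
    and "0 < l1" "0 < l2" "l1 \<noteq> l2" "l1 \<noteq> 1" "l2 \<noteq> 1"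
  shows "hyperbolic A"
proof -
  obtain v1 where v1: "v1 \<noteq> 0" "A *v v1 = l1 *\<^sub>R v1" using eigenvalue_real_eigenvector[of l1 A] assms by auto
  obtain v2 where v2: "v2 \<noteq> 0" "A *v v2 = l2 *\<^sub>R v2" using eigenvalue_real_eigenvector[of l2 A] assms by auto
  show ?thesis
  proof (cases "l1 < l2")
    case True then show ?thesis unfolding hyperbolic_def using v1 v2 assms by blast
  next
    case False
    then have "l2 < l1" using assms by simp
    then show ?thesis unfolding hyperbolic_def using v1 v2 assms by blast
  qed
qed

text \<open>
  In coordinates that diagonalize the derivative, it expands Euclidean lengths by at least \<open>l1 > 1\<close>. The
  nonlinear error is relatively small near the fixed point, so distances to it eventually do not decrease.
\<close>

lemma no_convergence_to_source:
  fixes y :: "nat \<Rightarrow> real^2" and l1 l2 :: real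
  assumes PQ: "P ** Q = mat 1" "Q ** P = mat 1" and AP: "A ** P = P ** diag l1 l2"
    and l: "1 < l1" "l1 < l2"
    and F: "(F has_derivative (\<lambda>v. A *v v)) (at y0)" "F y0 = y0"
    and y: "y \<longlonglongrightarrow> y0" "\<And>n. n \<ge> n0 \<Longrightarrow> y (Suc n) = F (y n)" "\<And>n. n \<ge> n0 \<Longrightarrow> y n \<noteq> y0"
  shows False
proof -
  obtain a where a: "a > 0" "\<And>v. norm (Q *v v) \<le> a * norm v"
    using bounded_linear.pos_bounded[OF matrix_vector_mul_bounded_linear, of Q] by (metis mult.commute)
  obtain b where b: "b > 0" "\<And>v. norm (P *v v) \<le> b * norm v"
    using bounded_linear.pos_bounded[OF matrix_vector_mul_bounded_linear, of P] by (metis mult.commute)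
  \<comment> \<open>The relative error that uses up exactly the excess of the expansion over one.\<close>
  define e where "e = (l1 - 1) / (a * b)"
  have e: "e > 0" using a b l by (simp add: e_def)
  obtain \<delta> where \<delta>: "\<delta> > 0" and F': "\<And>z. norm (z - y0) < \<delta> \<Longrightarrow> norm (F z - F y0 - A *v (z - y0)) \<le> e * norm (z - y0)"
    using F(1) e unfolding has_derivative_at_alt by blast
  obtain n1 where n1: "\<And>n. n \<ge> n1 \<Longrightarrow> norm (y n - y0) < \<delta>"
    using LIMSEQ_D[OF y(1) \<delta>] by blast
  define N where "N = max n0 n1"
  define u where "u = (\<lambda>n. Q *v (y n - y0))"
  have Pu: "P *v u n = y n - y0" for n by (simp add: u_def matrix_vector_mul_assoc PQ)
  have QA: "Q *v (A *v (y n - y0)) = diag l1 l2 *v u n" for n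
  proof -
    have "Q *v (A *v (P *v u n)) = (Q ** P) *v (diag l1 l2 *v u n)"
      unfolding matrix_vector_mul_assoc AP[symmetric] by (simp only: matrix_mul_assoc AP)
    then show ?thesis unfolding Pu PQ by simp
  qed
  have diag: "norm (diag l1 l2 *v w) \<ge> l1 * norm w" for w
  proof -
    have "(l1 * norm w)\<^sup>2 = l1\<^sup>2 * (w $ 1)\<^sup>2 + l1\<^sup>2 * (w $ 2)\<^sup>2"
      by (simp add: power_mult_distrib norm_vec_def L2_set_def sum_2 distrib_left)
    also have "\<dots> \<le> l1\<^sup>2 * (w $ 1)\<^sup>2 + l2\<^sup>2 * (w $ 2)\<^sup>2"
      using l by (intro add_left_mono mult_right_mono power_mono) auto
    also have "\<dots> = (norm (diag l1 l2 *v w))\<^sup>2"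
      by (simp add: norm_vec_def L2_set_def sum_2 diag_apply power_mult_distrib)
    finally show ?thesis by (rule power2_le_imp_le) simp
  qed
  have mono: "norm (u n) \<le> norm (u (Suc n))" if n: "n \<ge> N" for n
  proof -
    let ?r = "y (Suc n) - y0 - A *v (y n - y0)"
    have r: "norm ?r \<le> e * norm (y n - y0)" using F'[OF n1] y(2) n F(2) by (simp add: N_def)
    have "Q *v ?r = u (Suc n) - diag l1 l2 *v u n"
      unfolding QA[symmetric] unfolding u_def by (rule matrix_vector_mult_diff_distrib)
    then have "u (Suc n) = diag l1 l2 *v u n + Q *v ?r" by simp
    then have "norm (u (Suc n)) \<ge> norm (diag l1 l2 *v u n) - norm (Q *v ?r)"
      by (simp add: norm_diff_ineq)
    moreover have "norm (Q *v ?r) \<le> a * (e * norm (P *v u n))"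
      using a(2)[of ?r] mult_left_mono[OF r, of a] a(1) unfolding Pu by linarith
    moreover have "a * (e * norm (P *v u n)) \<le> a * (e * (b * norm (u n)))"
      using a(1) e b(2) by (intro mult_left_mono) auto
    moreover have "a * (e * (b * norm (u n))) = (l1 - 1) * norm (u n)"
      using a(1) b(1) by (simp add: e_def)
    ultimately show ?thesis using diag[of "u n"] by (simp add: algebra_simps)
  qed
  have "norm (u N) \<le> norm (u (N + k))" for k
    by (induction k) (auto intro: order_trans[OF _ mono])
  moreover have "u \<longlonglongrightarrow> Q *v (y0 - y0)" unfolding u_def
    by (intro tendsto_matrix_vector_mult tendsto_const tendsto_diff y(1))
  then have "u \<longlonglongrightarrow> 0" by simp
  then have "(\<lambda>k. norm (u (N + k))) \<longlonglongrightarrow> 0"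
    using LIMSEQ_ignore_initial_segment[of u 0 N] by (simp add: tendsto_norm_zero add.commute)
  ultimately have "norm (u N) \<le> 0" by (intro LIMSEQ_le_const) auto
  then have "P *v u N = 0" by simp
  then show False using Pu[of N] y(3)[of N] by (simp add: N_def)
qed

text \<open>
  Solutions that enter the cone \<open>|z2| \<le> |z1|\<close> stay in it and grow at a rate \<open>\<alpha> > 1\<close>. Solutions that
  never enter it grow at most at a rate \<open>\<beta> < \<alpha>\<close>. The initial values with growth at rate at most \<open>\<beta>\<close> form
  a subspace, which is proper since it misses the nonzero solutions in the cone.
\<close>

lemma cone_growth:
  fixes M C :: "nat \<Rightarrow> real^2^2"
  assumes C: "C \<longlonglongrightarrow> diag b1 b2" and b: "1 < b1" "0 < b2" "b2 < b1"
    and M: "\<And>n. n \<ge> n0 \<Longrightarrow> M (Suc n) = C n ** M n" and inj: "\<And>n w. M n *v w = 0 \<Longrightarrow> w = 0"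
  shows "\<exists>V. subspace V \<and> V \<noteq> UNIV \<and> (\<forall>w. w \<notin> V \<longrightarrow> (\<exists>e>0. \<exists>n1. \<forall>n\<ge>n1. e \<le> norm (M n *v w)))"
proof -
  \<comment> \<open>Entries of \<open>C n\<close> closer than \<open>\<delta>\<close> to their limits change rates by at most \<open>2 * \<delta>\<close>.\<close>
  define \<delta> where "\<delta> = min (b1 - 1) (b1 - b2) / 8"
  have \<delta>: "\<delta> > 0" "2 * \<delta> < b1 - 1" "4 * \<delta> < b1 - b2" using b by (auto simp: \<delta>_def min_def)
  define \<alpha> where "\<alpha> = b1 - 2 * \<delta>"
  define \<beta> where "\<beta> = b2 + 2 * \<delta>"
  have \<alpha>: "\<alpha> > 1" and \<beta>: "\<beta> > 0" and \<beta>\<alpha>: "\<beta> < \<alpha>" using \<delta> b by (auto simp: \<alpha>_def \<beta>_def)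
  have "\<forall>\<^sub>F n in sequentially. \<forall>i j. \<bar>C n $ i $ j - diag b1 b2 $ i $ j\<bar> < \<delta>"
  proof (intro eventually_all_finite)
    fix i j
    have "(\<lambda>n. C n $ i $ j) \<longlonglongrightarrow> diag b1 b2 $ i $ j" by (intro tendsto_vec_nth C)
    from tendstoD[OF this \<delta>(1)] show "\<forall>\<^sub>F n in sequentially. \<bar>C n $ i $ j - diag b1 b2 $ i $ j\<bar> < \<delta>"
      by (simp add: dist_real_def)
  qed
  then obtain n1 where n1: "\<And>n i j. n \<ge> n1 \<Longrightarrow> \<bar>C n $ i $ j - diag b1 b2 $ i $ j\<bar> < \<delta>"
    unfolding eventually_sequentially by blast
  define N where "N = max n0 n1"
  define z where "z = (\<lambda>w k. M (N + k) *v w)"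
  have step: "\<bar>z w (Suc k) $ 1 - b1 * z w k $ 1\<bar> \<le> \<delta> * (\<bar>z w k $ 1\<bar> + \<bar>z w k $ 2\<bar>)"
    "\<bar>z w (Suc k) $ 2 - b2 * z w k $ 2\<bar> \<le> \<delta> * (\<bar>z w k $ 1\<bar> + \<bar>z w k $ 2\<bar>)" for w k
  proof -
    have zs: "z w (Suc k) = C (N + k) *v z w k" by (simp add: z_def M N_def matrix_vector_mul_assoc)
    let ?x = "z w k $ 1" and ?y = "z w k $ 2" and ?c = "C (N + k)"
    have ne: "N + k \<ge> n1" by (simp add: N_def)
    have small: "\<bar>p * s + q * t\<bar> \<le> \<delta> * (\<bar>s\<bar> + \<bar>t\<bar>)" if "\<bar>p\<bar> < \<delta>" "\<bar>q\<bar> < \<delta>" for p q s t :: real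
    proof -
      have "\<bar>p * s + q * t\<bar> \<le> \<bar>p\<bar> * \<bar>s\<bar> + \<bar>q\<bar> * \<bar>t\<bar>"
        using abs_triangle_ineq[of "p * s" "q * t"] by (simp add: abs_mult)
      also have "\<dots> \<le> \<delta> * \<bar>s\<bar> + \<delta> * \<bar>t\<bar>" using that by (intro add_mono mult_right_mono) auto
      finally show ?thesis by (simp add: distrib_left)
    qed
    have "z w (Suc k) $ 1 - b1 * ?x = (?c $ 1 $ 1 - b1) * ?x + ?c $ 1 $ 2 * ?y"
      by (simp add: zs matrix_vector_mult_def sum_2 algebra_simps)
    then show "\<bar>z w (Suc k) $ 1 - b1 * ?x\<bar> \<le> \<delta> * (\<bar>?x\<bar> + \<bar>?y\<bar>)"
      using small n1[OF ne, of 1 1] n1[OF ne, of 1 2] by (simp add: diag_def)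
    have "z w (Suc k) $ 2 - b2 * ?y = ?c $ 2 $ 1 * ?x + (?c $ 2 $ 2 - b2) * ?y"
      by (simp add: zs matrix_vector_mult_def sum_2 algebra_simps)
    then show "\<bar>z w (Suc k) $ 2 - b2 * ?y\<bar> \<le> \<delta> * (\<bar>?x\<bar> + \<bar>?y\<bar>)"
      using small n1[OF ne, of 2 1] n1[OF ne, of 2 2] by (simp add: diag_def)
  qed
  have cone: "\<bar>z w (Suc k) $ 2\<bar> \<le> \<bar>z w (Suc k) $ 1\<bar> \<and> \<alpha> * \<bar>z w k $ 1\<bar> \<le> \<bar>z w (Suc k) $ 1\<bar>"
    if "\<bar>z w k $ 2\<bar> \<le> \<bar>z w k $ 1\<bar>" for w k
  proof -
    let ?x = "z w k $ 1" and ?y = "z w k $ 2"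
    have "\<delta> * (\<bar>?x\<bar> + \<bar>?y\<bar>) \<le> \<delta> * (2 * \<bar>?x\<bar>)" using that \<delta> by (intro mult_left_mono) auto
    then have 1: "\<bar>z w (Suc k) $ 1 - b1 * ?x\<bar> \<le> 2 * \<delta> * \<bar>?x\<bar>" and 2: "\<bar>z w (Suc k) $ 2 - b2 * ?y\<bar> \<le> 2 * \<delta> * \<bar>?x\<bar>"
      using step[of w k] by linarith+
    have "\<bar>b1 * ?x\<bar> = b1 * \<bar>?x\<bar>" "\<bar>b2 * ?y\<bar> = b2 * \<bar>?y\<bar>" using b by (simp_all add: abs_mult)
    then have 3: "\<alpha> * \<bar>?x\<bar> \<le> \<bar>z w (Suc k) $ 1\<bar>" and "\<bar>z w (Suc k) $ 2\<bar> \<le> b2 * \<bar>?y\<bar> + 2 * \<delta> * \<bar>?x\<bar>"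
      unfolding \<alpha>_def left_diff_distrib using 1 2 by linarith+
    moreover have "b2 * \<bar>?y\<bar> \<le> b2 * \<bar>?x\<bar>" using that b by (intro mult_left_mono) auto
    moreover have "\<beta> * \<bar>?x\<bar> \<le> \<alpha> * \<bar>?x\<bar>" using \<beta>\<alpha> by (intro mult_right_mono) auto
    ultimately have "\<bar>z w (Suc k) $ 2\<bar> \<le> \<bar>z w (Suc k) $ 1\<bar>" by (simp add: \<beta>_def distrib_right)
    then show ?thesis using 3 by simp
  qed
  have grow: "\<bar>z w (k + i) $ 2\<bar> \<le> \<bar>z w (k + i) $ 1\<bar> \<and> \<alpha> ^ i * \<bar>z w k $ 1\<bar> \<le> \<bar>z w (k + i) $ 1\<bar>"
    if "\<bar>z w k $ 2\<bar> \<le> \<bar>z w k $ 1\<bar>" for w k i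
  proof (induction i)
    case (Suc i)
    then have c: "\<bar>z w (Suc (k + i)) $ 2\<bar> \<le> \<bar>z w (Suc (k + i)) $ 1\<bar>" "\<alpha> * \<bar>z w (k + i) $ 1\<bar> \<le> \<bar>z w (Suc (k + i)) $ 1\<bar>"
      using cone by blast+
    have "\<alpha> * (\<alpha> ^ i * \<bar>z w k $ 1\<bar>) \<le> \<alpha> * \<bar>z w (k + i) $ 1\<bar>" using Suc \<alpha> by (intro mult_left_mono) auto
    then show ?case using c by (simp add: mult.assoc)
  qed (use that in simp)
  have slow: "\<bar>z w k $ 2\<bar> \<le> \<beta> ^ k * \<bar>z w 0 $ 2\<bar>" if out: "\<And>k. \<bar>z w k $ 1\<bar> < \<bar>z w k $ 2\<bar>" for w k
  proof (induction k)
    case (Suc k)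
    let ?x = "z w k $ 1" and ?y = "z w k $ 2"
    have "\<delta> * (\<bar>?x\<bar> + \<bar>?y\<bar>) \<le> \<delta> * (2 * \<bar>?y\<bar>)" using out[of k] \<delta> by (intro mult_left_mono) auto
    moreover have "\<bar>b2 * ?y\<bar> = b2 * \<bar>?y\<bar>" using b by (simp add: abs_mult)
    ultimately have "\<bar>z w (Suc k) $ 2\<bar> \<le> \<beta> * \<bar>?y\<bar>" unfolding \<beta>_def distrib_right using step(2)[of w k] by linarith
    also have "\<dots> \<le> \<beta> * (\<beta> ^ k * \<bar>z w 0 $ 2\<bar>)" using Suc \<beta> by (intro mult_left_mono) auto
    finally show ?case by (simp add: mult.assoc)
  qed simp
  define V where "V = {w. \<exists>B. \<forall>k. norm (z w k) \<le> B * \<beta> ^ k}"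
  have "subspace V"
    unfolding subspace_def
  proof (intro conjI ballI allI)
    show "0 \<in> V" by (auto simp: V_def z_def intro: exI[of _ 0])
    fix v w assume "v \<in> V" "w \<in> V"
    then obtain B B' where B: "\<And>k. norm (z v k) \<le> B * \<beta> ^ k" "\<And>k. norm (z w k) \<le> B' * \<beta> ^ k" by (auto simp: V_def)
    have "norm (z (v + w) k) \<le> (B + B') * \<beta> ^ k" for k
    proof -
      have "z (v + w) k = z v k + z w k" by (simp add: z_def matrix_vector_right_distrib)
      then show ?thesis using B[of k] norm_triangle_ineq[of "z v k" "z w k"] by (simp add: distrib_right)
    qed
    then show "v + w \<in> V" by (auto simp: V_def)
  next
    fix r :: real and w assume "w \<in> V"
    then obtain B where B: "\<And>k. norm (z w k) \<le> B * \<beta> ^ k" by (auto simp: V_def)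
    have "norm (z (r *\<^sub>R w) k) \<le> (\<bar>r\<bar> * B) * \<beta> ^ k" for k
      using mult_left_mono[OF B[of k], of "\<bar>r\<bar>"] by (simp add: z_def matrix_vector_mult_scaleR mult.assoc)
    then show "r *\<^sub>R w \<in> V" by (auto simp: V_def)
  qed
  moreover have "V \<noteq> UNIV"
  proof
    assume V: "V = UNIV"
    obtain L where "L ** M N = mat 1" using matrix_left_invertible_ker[of "M N"] inj by blast
    then have "M N ** L = mat 1" using matrix_left_right_inverse by blast
    define w where "w = L *v axis 1 1"
    have z0: "z w 0 = axis 1 1" using \<open>M N ** L = mat 1\<close> by (simp add: z_def w_def matrix_vector_mul_assoc)
    obtain B where B: "\<And>k. norm (z w k) \<le> B * \<beta> ^ k" using V unfolding V_def by blast
    have bd: "(\<alpha> / \<beta>) ^ k \<le> B" for k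
    proof -
      have "\<alpha> ^ k \<le> \<bar>z w k $ 1\<bar>" using grow[of w 0 k] z0 by (simp add: axis_def)
      also have "\<dots> \<le> norm (z w k)" by (rule component_le_norm_cart)
      also have "\<dots> \<le> B * \<beta> ^ k" by (rule B)
      finally show ?thesis using \<beta> by (simp add: power_divide divide_le_eq)
    qed
    have "1 < \<alpha> / \<beta>" using \<beta> \<beta>\<alpha> by simp
    then obtain k where "B < (\<alpha> / \<beta>) ^ k" using real_arch_pow by blast
    then show False using bd[of k] by simp
  qed
  moreover have "\<exists>e>0. \<exists>n1. \<forall>n\<ge>n1. e \<le> norm (M n *v w)" if w: "w \<notin> V" for w
  proof -
    have "\<exists>k. \<bar>z w k $ 2\<bar> \<le> \<bar>z w k $ 1\<bar>"
    proof (rule ccontr)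
      assume "\<not> ?thesis"
      then have out: "\<And>k. \<bar>z w k $ 1\<bar> < \<bar>z w k $ 2\<bar>" by (simp add: not_le)
      have "norm (z w k) \<le> (2 * \<bar>z w 0 $ 2\<bar>) * \<beta> ^ k" for k
      proof -
        have "norm (z w k) \<le> \<bar>z w k $ 1\<bar> + \<bar>z w k $ 2\<bar>"
          using norm_le_l1_cart[of "z w k"] by (simp add: sum_2)
        also have "\<dots> \<le> 2 * \<bar>z w k $ 2\<bar>" using out[of k] by simp
        also have "\<dots> \<le> 2 * (\<beta> ^ k * \<bar>z w 0 $ 2\<bar>)" using slow[OF out, of k] by simp
        finally show ?thesis by (simp add: mult_ac)
      qed
      then show False using w unfolding V_def by blast
    qed
    then obtain k where k: "\<bar>z w k $ 2\<bar> \<le> \<bar>z w k $ 1\<bar>" by blast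
    have "z w k \<noteq> 0"
    proof
      assume "z w k = 0"
      then have "w = 0" using inj by (simp add: z_def)
      then show False using w \<open>subspace V\<close> by (simp add: subspace_0)
    qed
    then have pos: "\<bar>z w k $ 1\<bar> > 0" using k by (auto simp: vec_eq_iff forall_2)
    have "\<bar>z w k $ 1\<bar> \<le> norm (M n *v w)" if n: "n \<ge> N + k" for n
    proof -
      define i where "i = n - (N + k)"
      have n': "n = N + (k + i)" using n by (simp add: i_def)
      have "1 * \<bar>z w k $ 1\<bar> \<le> \<alpha> ^ i * \<bar>z w k $ 1\<bar>" using \<alpha> by (intro mult_right_mono one_le_power) auto
      also have "\<dots> \<le> \<bar>z w (k + i) $ 1\<bar>" using grow[OF k, of i] by simp
      also have "\<dots> \<le> norm (z w (k + i))" by (rule component_le_norm_cart)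
      finally show ?thesis by (simp add: z_def n')
    qed
    then show ?thesis using pos by blast
  qed
  ultimately show ?thesis by blast
qed

section \<open>Growth of covectors along orbits\<close>

context surface
begin

lemma funpow_diff_iso: "diff_iso h \<Longrightarrow> diff_iso (h ^^ n)"
proof (induction n)
  case 0 then show ?case using diff_iso_id by (simp add: id_def)
next
  case (Suc n)
  then show ?case using diff_iso_compose[of "h ^^ n" h] by (simp add: o_def)
qed

end

context weighted_surface
begin

text \<open>
  Near \<open>q\<close> the Gram matrix is bounded by some \<open>L\<close>, so its inverse is bounded below by \<open>1 / L\<close>.
\<close>

lemma covector_norm_lower_bound:
  assumes c: "c \<in> \<A>" "q \<in> fst c" and x: "x \<longlonglongrightarrow> q"
  shows "\<exists>e>0. \<forall>\<^sub>F n in sequentially. \<forall>\<xi>\<in>cotangent \<A> (x n). e * norm (\<xi> c) \<le> covector_norm \<A> G (x n, \<xi>)"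
proof -
  define B where "B = norm (G c q) + 1"
  have B: "B > 0" by (simp add: B_def add_nonneg_pos)
  have "(\<lambda>n. norm (G c (x n))) \<longlonglongrightarrow> norm (G c q)"
    by (intro tendsto_norm isCont_tendsto_compose[OF metric_isCont[OF c] x])
  then have ev: "\<forall>\<^sub>F n in sequentially. norm (G c (x n)) < B" by (rule order_tendstoD(2)) (simp add: B_def)
  have main: "(1 / sqrt (4 * B)) * norm (\<xi> c) \<le> covector_norm \<A> G (y, \<xi>)"
    if y: "y \<in> fst c" "norm (G c y) < B" and \<xi>: "\<xi> \<in> cotangent \<A> y" for y \<xi>
  proof -
    define \<eta> where "\<eta> = \<xi> c"
    define w where "w = matrix_inv (G c y) *v \<eta>"
    define L where "L = 4 * B"
    have L: "L > 0" using B by (simp add: L_def)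
    have Gw: "G c y *v w = \<eta>" by (simp add: w_def matrix_vector_mul_assoc metric_inverse(1)[OF c(1) y(1)])
    have sym: "transpose (G c y) = G c y" using metric c(1) y(1) unfolding riemannian_metric_def by blast
    have "\<bar>G c y $ i $ j\<bar> \<le> B" for i j
      using component_le_norm_cart[of "G c y $ i" j] Finite_Cartesian_Product.norm_nth_le[of "G c y" i] y(2) by linarith
    then have "onorm ((*v) (G c y)) \<le> real CARD(2) * real CARD(2) * B"
      by (intro onorm_le_matrix_component) auto
    then have on: "onorm ((*v) (G c y)) \<le> L" by (simp add: L_def)
    have "norm (G c y *v \<eta>) \<le> onorm ((*v) (G c y)) * norm \<eta>"
      by (rule onorm[OF matrix_vector_mul_bounded_linear])
    also have "\<dots> \<le> L * norm \<eta>" using on by (intro mult_right_mono) auto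
    finally have "norm \<eta> * norm (G c y *v \<eta>) \<le> norm \<eta> * (L * norm \<eta>)" by (intro mult_left_mono) auto
    then have \<eta>G: "\<eta> \<bullet> (G c y *v \<eta>) \<le> L * (norm \<eta>)\<^sup>2"
      using norm_cauchy_schwarz[of \<eta> "G c y *v \<eta>"] by (simp add: power2_eq_square mult_ac)
    \<comment> \<open>The bound expresses that the metric is nonnegative on this vector; among the multiples of \<open>\<eta>\<close>,
      the factor \<open>1 / L\<close> gives the best constant.\<close>
    let ?v = "w - (1 / L) *\<^sub>R \<eta>"
    have "0 \<le> ?v \<bullet> (G c y *v ?v)" using metric_pos[OF c(1) y(1), of ?v] by (cases "?v = 0") auto
    also have "G c y *v ?v = \<eta> - (1 / L) *\<^sub>R (G c y *v \<eta>)"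
      by (simp add: matrix_vector_mult_diff_distrib matrix_vector_mult_scaleR Gw)
    also have "?v \<bullet> (\<eta> - (1 / L) *\<^sub>R (G c y *v \<eta>))
        = w \<bullet> \<eta> - (1 / L) * (w \<bullet> (G c y *v \<eta>)) - (1 / L) * (\<eta> \<bullet> \<eta>) + (1 / L)\<^sup>2 * (\<eta> \<bullet> (G c y *v \<eta>))"
      by (simp add: inner_diff_left inner_diff_right power2_eq_square algebra_simps)
    also have "w \<bullet> (G c y *v \<eta>) = \<eta> \<bullet> \<eta>"
      using adjoint_dot[of "G c y" w \<eta>] by (simp add: sym Gw)
    finally have "0 \<le> w \<bullet> \<eta> - 2 * ((1 / L) * (\<eta> \<bullet> \<eta>)) + (1 / L)\<^sup>2 * (\<eta> \<bullet> (G c y *v \<eta>))" by simp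
    moreover have "(1 / L)\<^sup>2 * (\<eta> \<bullet> (G c y *v \<eta>)) \<le> (1 / L)\<^sup>2 * (L * (norm \<eta>)\<^sup>2)"
      using \<eta>G by (intro mult_left_mono) auto
    moreover have "(1 / L)\<^sup>2 * (L * (norm \<eta>)\<^sup>2) = (1 / L) * (\<eta> \<bullet> \<eta>)"
      using L by (simp add: power2_eq_square power2_norm_eq_inner[symmetric])
    ultimately have "(1 / L) * (\<eta> \<bullet> \<eta>) \<le> \<eta> \<bullet> w" by (simp add: inner_commute)
    then have "sqrt ((1 / L) * (norm \<eta>)\<^sup>2) \<le> sqrt (\<eta> \<bullet> w)"
      by (simp add: power2_norm_eq_inner)
    then have "(1 / sqrt L) * norm \<eta> \<le> sqrt (\<eta> \<bullet> w)" by (simp add: real_sqrt_mult real_sqrt_divide)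
    moreover have "covector_norm \<A> G (y, \<xi>) = sqrt (\<eta> \<bullet> w)"
      using covector_norm_coord[of "(y, \<xi>)" c] \<xi> c(1) y(1) by (simp add: \<eta>_def w_def)
    ultimately show ?thesis by (simp add: \<eta>_def L_def)
  qed
  have "\<forall>\<^sub>F n in sequentially. \<forall>\<xi>\<in>cotangent \<A> (x n). (1 / sqrt (4 * B)) * norm (\<xi> c) \<le> covector_norm \<A> G (x n, \<xi>)"
    using ev eventually_in_chart[OF x c] by eventually_elim (use main in blast)
  moreover have "1 / sqrt (4 * B) > 0" using B by simp
  ultimately show ?thesis by blast
qed

text \<open>
  In a chart at the limit \<open>q\<close> the codifferential acts on covectors along the orbit by matrices that
  converge to the inverse transpose of the derivative at \<open>q\<close>. Its eigenvalues are \<open>1 / l1\<close> and \<open>1 / l2\<close>, and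
  \<open>1 / l1 > 1\<close> because an orbit that is not constant does not converge to a source.
\<close>

lemma forward_growth:
  assumes h: "diff_iso h" and lim: "(\<lambda>n. (h ^^ n) x) \<longlonglongrightarrow> q" and hq: "h q = q" and hx: "h x \<noteq> x"
    and c: "c \<in> \<A>" "q \<in> fst c" and hyp: "hyperbolic (dmat c c h q)" and c0: "c0 \<in> \<A>" "x \<in> fst c0"
  shows "\<exists>V. subspace V \<and> V \<noteq> UNIV \<and> (\<forall>\<eta>. \<eta> \<notin> V \<longrightarrow>
     (\<exists>e>0. \<exists>n1. \<forall>n\<ge>n1. e \<le> covector_norm \<A> G (codiff \<A> (h ^^ n) (x, covector c0 x \<eta>))))"
proof -
  define X where "X = (\<lambda>n. (h ^^ n) x)"
  have XS: "X (Suc n) = h (X n)" for n by (simp add: X_def)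
  have limX: "X \<longlonglongrightarrow> q" using lim by (simp add: X_def)
  have injn: "inj (h ^^ n)" for n using funpow_diff_iso[OF h, of n] by (simp add: diff_iso_def bij_is_inj)
  have Xq: "X n \<noteq> q" for n
  proof
    assume "X n = q"
    then have "(h ^^ n) (h x) = (h ^^ n) x" using hq by (simp add: X_def funpow_swap1[symmetric])
    then show False using injn[of n] hx by (simp add: inj_eq)
  qed
  obtain n0 where n0: "\<And>n. n \<ge> n0 \<Longrightarrow> X n \<in> fst c"
    using eventually_in_chart[OF limX c] unfolding eventually_sequentially by blast
  obtain P Q l1 l2 where PQ: "P ** Q = mat 1" "Q ** P = mat 1" and AP: "dmat c c h q ** P = P ** diag l1 l2"
    and l: "0 < l1" "l1 < l2" "l1 \<noteq> 1" "l2 \<noteq> 1"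
    using hyperbolic_diagonalize[OF hyp] by metis
  have inv: "inv_into (fst c) (snd c) (snd c y) = y" if "y \<in> fst c" for y
    using chartD(4)[OF c(1)] that by simp
  have hd: "diff_map \<A> h" "diff_map \<A> (inv h)" using h by (auto simp: diff_iso_def)
  have "l1 < 1"
  proof (rule ccontr)
    assume "\<not> l1 < 1"
    then have l1: "1 < l1" using l by simp
    show False
    proof (rule no_convergence_to_source[OF PQ AP l1 l(2)])
      show "(in_charts c c h has_derivative (\<lambda>v. dmat c c h q *v v)) (at (snd c q))"
        by (rule dmat_has_derivative[OF hd(1) c(1) c(1) c(2)]) (simp add: hq c)
      show "in_charts c c h (snd c q) = snd c q" by (simp add: in_charts_def inv c hq)
      show "(\<lambda>n. snd c (X n)) \<longlonglongrightarrow> snd c q"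
        by (rule isCont_tendsto_compose[OF chart_isCont[OF c] limX])
      show "snd c (X (Suc n)) = in_charts c c h (snd c (X n))" if "n \<ge> n0" for n
        by (simp add: in_charts_def inv n0[OF that] XS)
      show "snd c (X n) \<noteq> snd c q" if "n \<ge> n0" for n
        using inj_onD[OF chartD(4)[OF c(1)]] n0[OF that] c(2) Xq by metis
    qed
  qed
  then have b: "1 < 1 / l1" "0 < 1 / l2" "1 / l2 < 1 / l1" using l by (auto simp: field_simps)
  define H where "H = (\<lambda>k. h ^^ (n0 + k))"
  have H: "diff_iso (H k)" for k unfolding H_def by (rule funpow_diff_iso[OF h])
  have Hx: "H k x = X (n0 + k)" "H k x \<in> fst c" for k using n0[of "n0 + k"] by (simp_all add: H_def X_def)
  define T where "T = (\<lambda>k. transpose (dmat c c0 (inv (H k)) (H k x)))"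
  define S where "S = (\<lambda>k. transpose (dmat c c (inv h) (H (Suc k) x)))"
  \<comment> \<open>In coordinates that diagonalize the limit, \<open>M k\<close> takes a covector at \<open>x\<close> to its image after
    \<open>n0 + k\<close> steps, and \<open>C k\<close> is the step that follows.\<close>
  define M where "M = (\<lambda>k. transpose P ** T k)"
  define C where "C = (\<lambda>k. transpose P ** S k ** transpose Q)"
  have QP: "transpose Q ** transpose P = mat 1" unfolding matrix_transpose_mul[symmetric] by (simp add: PQ)
  have "M (Suc k) = C k ** M k" for k
  proof -
    have HS: "H (Suc k) = (\<lambda>x. h (H k x))" by (simp add: H_def fun_eq_iff)
    have "inv (H (Suc k)) = (\<lambda>y. inv (H k) (inv h y))"
      unfolding HS using o_inv_distrib[of h "H k"] h H[of k] by (simp add: diff_iso_def o_def)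
    moreover have "dmat c c0 (\<lambda>y. inv (H k) (inv h y)) (H (Suc k) x)
       = dmat c c0 (inv (H k)) (inv h (H (Suc k) x)) ** dmat c c (inv h) (H (Suc k) x)"
    proof (rule dmat_compose[OF hd(2) _ c(1) c(1) c0(1)])
      show "diff_map \<A> (inv (H k))" using H[of k] by (simp add: diff_iso_def)
      show "H (Suc k) x \<in> fst c" by (rule Hx)
      show "inv h (H (Suc k) x) \<in> fst c" using Hx(2)[of k] by (simp add: HS diff_iso_inv_apply[OF h])
      show "inv (H k) (inv h (H (Suc k) x)) \<in> fst c0"
        using c0 by (simp add: HS diff_iso_inv_apply[OF h] diff_iso_inv_apply[OF H])
    qed
    moreover have "inv h (H (Suc k) x) = H k x" by (simp add: HS diff_iso_inv_apply[OF h])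
    ultimately have TS: "T (Suc k) = S k ** T k" by (simp add: T_def S_def matrix_transpose_mul)
    have "C k ** M k = transpose P ** S k ** (transpose Q ** transpose P) ** T k"
      by (simp only: C_def M_def matrix_mul_assoc)
    also have "\<dots> = M (Suc k)" by (simp only: QP matrix_mul_rid M_def TS matrix_mul_assoc)
    finally show ?thesis ..
  qed
  moreover have "C \<longlonglongrightarrow> diag (1 / l1) (1 / l2)"
  proof -
    let ?A = "dmat c c h q" and ?B = "dmat c c (inv h) q" and ?D = "diag (1 / l1) (1 / l2)"
    have ihq: "inv h q = q" using diff_iso_inv_apply(1)[OF h, of q] hq by simp
    have BA: "?B ** ?A = mat 1" using dmat_inverse(1)[OF h c(1) c(1) c(2)] c(2) hq by simp
    have DD: "diag l1 l2 ** ?D = mat 1"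
      using l by (simp add: vec_eq_iff forall_2 diag_def matrix_matrix_mult_def sum_2 mat_def)
    have "Q ** ?B ** P = Q ** ?B ** P ** (diag l1 l2 ** ?D)" by (simp add: DD)
    also have "\<dots> = Q ** ?B ** (P ** diag l1 l2) ** ?D" by (simp only: matrix_mul_assoc)
    also have "\<dots> = Q ** (?B ** ?A) ** P ** ?D" unfolding AP[symmetric] by (simp only: matrix_mul_assoc)
    also have "\<dots> = ?D" by (simp add: BA PQ)
    finally have "transpose (Q ** ?B ** P) = ?D" by (simp add: transpose_diag)
    then have D: "transpose P ** transpose ?B ** transpose Q = ?D"
      by (simp only: matrix_transpose_mul matrix_mul_assoc)
    have "(\<lambda>k. H (Suc k) x) \<longlonglongrightarrow> q"
      unfolding Hx(1) using LIMSEQ_ignore_initial_segment[OF limX, of "Suc n0"] by (simp add: add.commute)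
    then have "S \<longlonglongrightarrow> transpose ?B" unfolding S_def
      by (intro tendsto_transpose dmat_tendsto[OF hd(2) _ c(1) c(1) c(2)]) (simp_all add: ihq c)
    then show ?thesis unfolding C_def D[symmetric] by (intro tendsto_matrix_mult tendsto_const)
  qed
  moreover have "w = 0" if w: "M k *v w = 0" for k w
  proof -
    have t: "transpose (dmat c0 c (H k) x) ** T k = mat 1"
      unfolding T_def matrix_transpose_mul[symmetric] using dmat_inverse(1)[OF H c0(1) c(1) c0(2) Hx(2)] by simp
    have "transpose (dmat c0 c (H k) x) ** transpose Q ** M k = transpose (dmat c0 c (H k) x) ** (transpose Q ** transpose P) ** T k"
      by (simp only: M_def matrix_mul_assoc)
    also have "\<dots> = mat 1" by (simp add: QP t)
    finally have "w = (transpose (dmat c0 c (H k) x) ** transpose Q ** M k) *v w" by simp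
    also have "\<dots> = 0" by (simp only: matrix_vector_mul_assoc[symmetric] w matrix_vector_mult_0_right)
    finally show ?thesis .
  qed
  ultimately obtain V where V: "subspace V" "V \<noteq> UNIV"
    and grow: "\<And>w. w \<notin> V \<Longrightarrow> \<exists>e>0. \<exists>k1. \<forall>k\<ge>k1. e \<le> norm (M k *v w)"
    using cone_growth[of C "1 / l1" "1 / l2" 0 M] b by blast
  obtain a where a: "a > 0" "\<And>v. norm (transpose P *v v) \<le> a * norm v"
    using bounded_linear.pos_bounded[OF matrix_vector_mul_bounded_linear, of "transpose P"] by (metis mult.commute)
  obtain e1 where e1: "e1 > 0" and "\<forall>\<^sub>F n in sequentially. \<forall>\<xi>\<in>cotangent \<A> (X n). e1 * norm (\<xi> c) \<le> covector_norm \<A> G (X n, \<xi>)"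
    using covector_norm_lower_bound[OF c limX] by blast
  then obtain n2 where n2: "\<And>n \<xi>. n \<ge> n2 \<Longrightarrow> \<xi> \<in> cotangent \<A> (X n) \<Longrightarrow> e1 * norm (\<xi> c) \<le> covector_norm \<A> G (X n, \<xi>)"
    unfolding eventually_sequentially by blast
  have "\<exists>e>0. \<exists>n1. \<forall>n\<ge>n1. e \<le> covector_norm \<A> G (codiff \<A> (h ^^ n) (x, covector c0 x \<eta>))" if \<eta>: "\<eta> \<notin> V" for \<eta>
  proof -
    obtain e k1 where e: "e > 0" and k1: "\<And>k. k \<ge> k1 \<Longrightarrow> e \<le> norm (M k *v \<eta>)" using grow[OF \<eta>] by blast
    have "e1 * (e / a) \<le> covector_norm \<A> G (codiff \<A> (h ^^ n) (x, covector c0 x \<eta>))" if n: "n \<ge> n0 + k1 + n2" for n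
    proof -
      define k where "k = n - n0"
      have nk: "n = n0 + k" "k \<ge> k1" "n \<ge> n2" using n by (auto simp: k_def)
      let ?\<xi> = "snd (codiff \<A> (H k) (x, covector c0 x \<eta>))"
      have "?\<xi> c = T k *v \<eta>"
        using codiff_coord[OF H covector(1)[OF c0] c0(1) c(1) c0(2) Hx(2)] covector(2)[OF c0] by (simp add: T_def)
      then have "M k *v \<eta> = transpose P *v ?\<xi> c" by (simp add: M_def matrix_vector_mul_assoc)
      then have "e \<le> a * norm (?\<xi> c)" using k1[OF nk(2)] a(2)[of "?\<xi> c"] by simp
      then have "e / a \<le> norm (?\<xi> c)" using a(1) by (simp add: divide_le_eq mult.commute)
      then have "e1 * (e / a) \<le> e1 * norm (?\<xi> c)" using e1 by (intro mult_left_mono) auto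
      also have "\<dots> \<le> covector_norm \<A> G (X n, ?\<xi>)"
      proof (rule n2[OF nk(3)])
        show "?\<xi> \<in> cotangent \<A> (X n)"
          using codiff_cotangent[OF H covector(1)[OF c0], of k] unfolding Hx(1) nk(1) .
      qed
      also have "(X n, ?\<xi>) = codiff \<A> (h ^^ n) (x, covector c0 x \<eta>)"
        by (simp add: prod_eq_iff X_def H_def nk(1))
      finally show ?thesis .
    qed
    moreover have "e1 * (e / a) > 0" using e1 e a(1) by simp
    ultimately show ?thesis by blast
  qed
  then show ?thesis using V by blast
qed

end

lemma proper_subspace_negligible:
  fixes V :: "(real^2) set"
  assumes "subspace V" "V \<noteq> UNIV" shows "negligible V"
proof (rule negligible_lowdim)
  have "span V \<noteq> UNIV" using assms by (simp add: span_eq_iff[THEN iffD2])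
  then have "dim V \<noteq> DIM(real^2)" using dim_eq_full by blast
  then show "dim V < DIM(real^2)" using dim_subset_UNIV[of V] by linarith
qed

context weighted_diffeo
begin

text \<open>
  Forward growth is applied to \<open>g\<close> and to its inverse; each excludes a proper subspace of covectors.
\<close>

lemma log_norm_bounded_below:
  assumes nf: "g x \<noteq> x" and conv: "orbits_converge g"
    and hyp: "\<And>q c. g q = q \<Longrightarrow> c \<in> \<A> \<Longrightarrow> q \<in> fst c \<Longrightarrow> hyperbolic (dmat c c g q)"
    and c0: "c0 \<in> \<A>" "x \<in> fst c0"
  shows "\<exists>Z. negligible Z \<and> (\<forall>\<eta>. \<eta> \<notin> Z \<longrightarrow> (x, covector c0 x \<eta>) \<in> cotangent0 \<A> \<and>
     (\<exists>b. \<forall>n. b \<le> log_norm (x, covector c0 x \<eta>) n))"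
proof -
  obtain p q where p: "g p = p" "(\<lambda>n. (g ^^ n) x) \<longlonglongrightarrow> p" and q: "g q = q" "(\<lambda>n. (inv g ^^ n) x) \<longlonglongrightarrow> q"
    using conv unfolding orbits_converge_def by blast
  have iq: "inv g q = q" using diff_iso_inv_apply(1)[OF g, of q] q(1) by simp
  have ix: "inv g x \<noteq> x" using diff_iso_inv_apply(2)[OF g, of x] nf by metis
  let ?cp = "chart_at \<A> p" and ?cq = "chart_at \<A> q"
  obtain V1 where V1: "subspace V1" "V1 \<noteq> UNIV" "\<And>\<eta>. \<eta> \<notin> V1 \<Longrightarrow>
     \<exists>e>0. \<exists>n1. \<forall>n\<ge>n1. e \<le> covector_norm \<A> G (codiff \<A> (g ^^ n) (x, covector c0 x \<eta>))"
    using forward_growth[OF g p(2) p(1) nf chart_at hyp[OF p(1) chart_at] c0] by blast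
  have "dmat ?cq ?cq (inv g) q ** dmat ?cq ?cq g q = mat 1"
    using dmat_inverse(1)[OF g chart_at(1) chart_at(1) chart_at(2), of q q] q(1) chart_at(2)[of q] by simp
  then have hq: "hyperbolic (dmat ?cq ?cq (inv g) q)"
    by (rule hyperbolic_inverse[OF hyp[OF q(1) chart_at]])
  obtain V2 where V2: "subspace V2" "V2 \<noteq> UNIV" "\<And>\<eta>. \<eta> \<notin> V2 \<Longrightarrow>
     \<exists>e>0. \<exists>n1. \<forall>n\<ge>n1. e \<le> covector_norm \<A> G (codiff \<A> (inv g ^^ n) (x, covector c0 x \<eta>))"
    using forward_growth[OF diff_iso_inv[OF g] q(2) iq ix chart_at hq c0] by blast
  have "negligible (V1 \<union> V2 \<union> {0})"
    using V1 V2 by (intro negligible_Un proper_subspace_negligible negligible_sing) auto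
  moreover have "(x, covector c0 x \<eta>) \<in> cotangent0 \<A> \<and> (\<exists>b. \<forall>n. b \<le> log_norm (x, covector c0 x \<eta>) n)"
    if \<eta>: "\<eta> \<notin> V1 \<union> V2 \<union> {0}" for \<eta>
  proof -
    let ?p = "(x, covector c0 x \<eta>)"
    have p0: "?p \<in> cotangent0 \<A>" using \<eta> cotangent0_iff_coord[OF c0] covector[OF c0] by simp
    define N where "N = (\<lambda>n. covector_norm \<A> G (cov_iter n ?p))"
    have Npos: "N n > 0" for n unfolding N_def by (rule covector_norm_pos[OF codiff_iter_cotangent0[OF g p0]])
    have it: "iter (int n) = g ^^ n" "iter (- int n) = inv g ^^ n" for n
      by (cases n; simp add: int_iter_def nat_add_distrib)+
    have Nf: "N (int n) = covector_norm \<A> G (codiff \<A> (g ^^ n) ?p)"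
      "N (- int n) = covector_norm \<A> G (codiff \<A> (inv g ^^ n) ?p)" for n
      unfolding N_def codiff_iter_eq[OF g p0] it by simp_all
    obtain e1 n1 where e1: "e1 > 0" "\<And>n. n \<ge> n1 \<Longrightarrow> e1 \<le> N (int n)" using V1(3)[of \<eta>] \<eta> unfolding Nf by blast
    obtain e2 n2 where e2: "e2 > 0" "\<And>n. n \<ge> n2 \<Longrightarrow> e2 \<le> N (- int n)" using V2(3)[of \<eta>] \<eta> unfolding Nf by blast
    define S where "S = insert e1 (insert e2 (N ` {- int n2..int n1}))"
    have S: "finite S" "S \<noteq> {}" by (auto simp: S_def)
    have m: "Min S > 0" using S Npos e1 e2 by (auto simp: S_def)
    have "Min S \<le> N n" for n
    proof -
      consider "n \<ge> int n1" | "n \<le> - int n2" | "n \<in> {- int n2..int n1}" by fastforce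
      then show ?thesis
      proof cases
        case 1
        then have "e1 \<le> N n" using e1(2)[of "nat n"] by simp
        moreover have "Min S \<le> e1" by (rule Min_le[OF S(1)]) (simp add: S_def)
        ultimately show ?thesis by simp
      next
        case 2
        then have "e2 \<le> N n" using e2(2)[of "nat (- n)"] by simp
        moreover have "Min S \<le> e2" by (rule Min_le[OF S(1)]) (simp add: S_def)
        ultimately show ?thesis by simp
      next
        case 3
        then show ?thesis by (intro Min_le[OF S(1)]) (simp add: S_def)
      qed
    qed
    then have "ln (Min S) \<le> ln (N n)" for n
      using m Npos by (subst ln_le_cancel_iff) auto
    then have "ln (Min S) \<le> log_norm ?p n" for n
      by (simp add: log_norm_def N_def)
    then show ?thesis using p0 by blast
  qed
  ultimately show ?thesis by blast
qed

text \<open>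
  Both exceptional sets are negligible in coordinates: the finitely many fixed points among the base
  points, and two proper subspaces among the covectors. Hence good covectors exist
  arbitrarily close to any given one.
\<close>

lemma bounded_below_dense:
  assumes fin: "finite {x. g x = x}" and conv: "orbits_converge g"
    and hyp: "\<And>q c. g q = q \<Longrightarrow> c \<in> \<A> \<Longrightarrow> q \<in> fst c \<Longrightarrow> hyperbolic (dmat c c g q)"
    and p: "p \<in> cotangent0 \<A>"
  shows "\<exists>f. (\<forall>j. f j \<in> cotangent0 \<A> \<and> (\<exists>b. \<forall>n. b \<le> log_norm (f j) n)) \<and> cov_tendsto f p sequentially"
proof -
  define x where "x = fst p"
  define c where "c = chart_at \<A> x"
  have c: "c \<in> \<A>" "x \<in> fst c" using chart_at by (auto simp: c_def)
  let ?O = "snd c ` fst c"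
  have inv: "inv_into (fst c) (snd c) (snd c y) = y" if "y \<in> fst c" for y
    using chartD(4)[OF c(1)] that by simp
  have ball_point: "\<exists>z. z \<in> ball a e \<inter> W \<and> z \<notin> Z" if "negligible Z" "open W" "a \<in> W" "e > 0" for Z W e and a :: "real^2"
  proof (rule ccontr)
    assume "\<not> ?thesis"
    then have "ball a e \<inter> W \<subseteq> Z" by blast
    then have "negligible (ball a e \<inter> W)" using that(1) negligible_subset by blast
    moreover have "a \<in> ball a e \<inter> W" using that by simp
    then have "ball a e \<inter> W \<noteq> {}" by blast
    moreover have "open (ball a e \<inter> W)" using that by auto
    ultimately show False using open_not_negligible by blast
  qed
  have "\<exists>y \<eta>. y \<in> fst c \<and> dist (snd c x) (snd c y) < 1 / (real j + 1) \<and> dist (snd p c) \<eta> < 1 / (real j + 1) \<and>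
     (y, covector c y \<eta>) \<in> cotangent0 \<A> \<and> (\<exists>b. \<forall>n. b \<le> log_norm (y, covector c y \<eta>) n)" for j :: nat
  proof -
    let ?e = "1 / (real j + 1)"
    have e: "?e > 0" by simp
    have "negligible (snd c ` {x. g x = x})" using fin by (intro negligible_finite) auto
    then obtain z where z: "z \<in> ball (snd c x) ?e \<inter> ?O" "z \<notin> snd c ` {x. g x = x}"
      using ball_point[of _ ?O "snd c x" ?e] chartD(2)[OF c(1)] c(2) e by blast
    then obtain y where y: "y \<in> fst c" "z = snd c y" by blast
    then have nf: "g y \<noteq> y" using z(2) by blast
    obtain Z where Z: "negligible Z" "\<And>\<eta>. \<eta> \<notin> Z \<Longrightarrow> (y, covector c y \<eta>) \<in> cotangent0 \<A> \<and>
       (\<exists>b. \<forall>n. b \<le> log_norm (y, covector c y \<eta>) n)"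
      using log_norm_bounded_below[OF nf conv hyp c(1) y(1)] by blast
    obtain \<eta> where \<eta>: "\<eta> \<in> ball (snd p c) ?e \<inter> UNIV" "\<eta> \<notin> Z"
      using ball_point[OF Z(1), of UNIV "snd p c" ?e] e by blast
    have "dist (snd c x) (snd c y) < ?e" using z(1) y(2) by simp
    moreover have "dist (snd p c) \<eta> < ?e" using \<eta>(1) by simp
    ultimately show ?thesis using y(1) Z(2)[OF \<eta>(2)] by blast
  qed
  then obtain y \<eta> where y: "\<And>j. y j \<in> fst c" and dy: "\<And>j. dist (snd c x) (snd c (y j)) < 1 / (real j + 1)"
    and d\<eta>: "\<And>j. dist (snd p c) (\<eta> j) < 1 / (real j + 1)"
    and f: "\<And>j. (y j, covector c (y j) (\<eta> j)) \<in> cotangent0 \<A>"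
      "\<And>j. \<exists>b. \<forall>n. b \<le> log_norm (y j, covector c (y j) (\<eta> j)) n"
    by metis
  have small: "u \<longlonglongrightarrow> a" if "\<And>j. dist a (u j) < 1 / (real j + 1)" for u :: "nat \<Rightarrow> real^2" and a
  proof (rule metric_LIMSEQ_I)
    fix r :: real assume "r > 0"
    then obtain m :: nat where m: "1 / (real m + 1) < r"
      using reals_Archimedean[of r] by (auto simp: inverse_eq_divide add.commute)
    have "dist (u n) a < r" if "n \<ge> m" for n
    proof -
      have "1 / (real n + 1) \<le> 1 / (real m + 1)" using that by (simp add: frac_le)
      then show ?thesis using m \<open>\<And>j. dist a (u j) < 1 / (real j + 1)\<close>[of n] by (simp add: dist_commute)
    qed
    then show "\<exists>m. \<forall>n\<ge>m. dist (u n) a < r" by blast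
  qed
  have "(\<lambda>j. inv_into (fst c) (snd c) (snd c (y j))) \<longlonglongrightarrow> inv_into (fst c) (snd c) (snd c x)"
    by (rule continuous_on_tendsto_compose[OF chartD(5)[OF c(1)] small[OF dy]]) (use c y in auto)
  then have ylim: "y \<longlonglongrightarrow> x" by (simp add: inv y c)
  have "cov_tendsto (\<lambda>j. (y j, covector c (y j) (\<eta> j))) p sequentially"
    by (rule cov_tendstoI[OF c(1)])
       (use c p f(1) ylim small[OF d\<eta>] covector(2)[OF c(1) y] in \<open>auto simp: x_def\<close>)
  then show ?thesis using f by (intro exI[of _ "\<lambda>j. (y j, covector c (y j) (\<eta> j))"]) auto
qed

end

section \<open>The interval of ellipticity\<close>

theorem theorem3:
  fixes \<A> :: "'m::t2_space chart set"
    and g :: "'m \<Rightarrow> 'm"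
    and \<rho> :: "'m chart \<Rightarrow> 'm \<Rightarrow> real"
    and G :: "'m chart \<Rightarrow> 'm \<Rightarrow> real^2^2"
    and d :: real
    and K :: "int set"
    and Dk :: "int \<Rightarrow> ('m \<Rightarrow> complex) \<Rightarrow> 'm \<Rightarrow> complex"
    and D :: "('m \<Rightarrow> complex) \<Rightarrow> 'm \<Rightarrow> complex"
  assumes "closed_smooth_surface \<A>"
    and "morse_smale \<A> g"
    and "orbits_converge g"
    and "smooth_measure \<A> \<rho>"
    and "riemannian_metric \<A> G"
    and "nonlocal_operator \<A> g d K Dk D"
  shows "\<exists>s0 s1 :: ereal. s0 \<le> s1 \<and>
    ((\<exists>s::real. s0 < ereal s \<and> ereal s < s1 \<and> elliptic \<A> g \<rho> G d K Dk s) \<longrightarrow>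
       (\<forall>s::real. s0 < ereal s \<and> ereal s < s1 \<longrightarrow> elliptic \<A> g \<rho> G d K Dk s)) \<and>
    (\<forall>s::real. \<not> (s0 < ereal s \<and> ereal s < s1) \<longrightarrow> \<not> elliptic \<A> g \<rho> G d K Dk s)"
proof -
  interpret surface \<A>
    using assms(1) by unfold_locales (simp add: closed_smooth_surface_def)
  have g: "diff_iso g" using assms(2) diffeo_imp_diff_iso by (simp add: morse_smale_def)
  interpret nonlocal_symbol \<A> \<rho> G g d K Dk
    using assms(4,5,6) g by unfold_locales (auto simp: nonlocal_operator_def)
  have fin: "finite {x. g x = x}" using assms(2) by (simp add: morse_smale_def)
  have hyp: "hyperbolic (dmat c c g q)" if q: "g q = q" and c: "c \<in> \<A>" "q \<in> fst c" for q c
  proof -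
    have "\<forall>x. g x = x \<longrightarrow> (\<forall>c\<in>\<A>. x \<in> fst c \<longrightarrow>
        (\<exists>l1 l2 :: real. 0 < l1 \<and> 0 < l2 \<and> l1 \<noteq> l2 \<and> l1 \<noteq> 1 \<and> l2 \<noteq> 1 \<and>
           eigenvalues (dmat c c g x) = {complex_of_real l1, complex_of_real l2}))"
      using assms(2) unfolding morse_smale_def by blast
    then obtain l1 l2 :: real where "0 < l1" "0 < l2" "l1 \<noteq> l2" "l1 \<noteq> 1" "l2 \<noteq> 1"
      "eigenvalues (dmat c c g q) = {complex_of_real l1, complex_of_real l2}"
      using q c by blast
    then show ?thesis using eigenvalues_hyperbolic by blast
  qed
  have "\<exists>s0 s1 :: ereal. s0 \<le> s1 \<and> (\<forall>s. s0 < ereal s \<and> ereal s < s1 \<longleftrightarrow> elliptic \<A> g \<rho> G d K Dk s)"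
  proof (rule elliptic_interval)
    show "compact (UNIV :: 'm set)" using assms(1) by (simp add: closed_smooth_surface_def)
  qed (rule bounded_below_dense[OF fin assms(3) hyp])
  then obtain s0 s1 :: ereal where le: "s0 \<le> s1"
    and eq: "\<And>s. s0 < ereal s \<and> ereal s < s1 \<longleftrightarrow> elliptic \<A> g \<rho> G d K Dk s"
    by blast
  show ?thesis
  proof (rule exI[of _ s0], rule exI[of _ s1], intro conjI impI allI le)
    show "elliptic \<A> g \<rho> G d K Dk s" if "s0 < ereal s \<and> ereal s < s1" for s
      using that eq[of s] by simp
    show "\<not> elliptic \<A> g \<rho> G d K Dk s" if "\<not> (s0 < ereal s \<and> ereal s < s1)" for s
      using that eq[of s] by simp
  qed
qed

end
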